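(* Let $(X,T,\mu)$ be a measure-preserving system as in the context that satisfies the Multiple Decorrelation condition. Let $(M_n)$ be a sequence in $[0,1]$ with associated radius functions $\hat r_n$ and sets $\hat E_n=\{x\in X:T^nx\in B(x,\hat r_n(x))\}$, and define $$\hat\sigma_n^2=\operatorname{Var}\Bigl(\sum_{k=1}^n\mathbf 1_{\hat E_k}\Bigr),\qquad \hat s_n^2(y)=\operatorname{Var}\Bigl(\sum_{k=1}^n\mathbf 1_{B(y,\hat r_k(y))}\circ T^k\Bigr).$$ Assume that: (i) $\mu$ satisfies the Frostman property and the Thin annuli property; (ii) $(M_n)$ satisfies condition $\mathcal S(\gamma,\upsilon)$ for some $\gamma\in(0,1)$ and $\upsilon>1$; (iii) for $\mu$-a.e. $y\in X$, the functions $\frac1{\hat s_n(y)}\sum_{k=1}^n\bigl(\mathbf 1_{B(y,\hat r_k(y))}\circ T^k-M_k\bigr)$ on $(X,\mu)$ converge in distribution to $N(0,1)$; (iv) $\hat s_n^2/\hat\sigma_n^2$ converges in distribution to the constant $1$, where $\hat s_n^2:y\mapsto\hat s_n^2(y)$ is considered as a random variable on $(X,\mu)$. Then $$x\mapsto\frac1{\hat\sigma_n}\sum_{k=1}^n\Bigl(\mathbf 1_{B(x,\hat r_k(x))}(T^kx)-\mu\bigl(B(x,\hat r_k(x))\bigr)\Bigr)$$ converges in distribution, as $n\to\infty$, to a standard Gaussian variable.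
   Context: $(X,d)$ is a smooth compact Riemannian manifold; $(X,T,\mu)$ is a measure-preserving system: $\mu$ is a non-atomic Borel probability measure on $X$ and $T:X\to X$ is measurable and preserves $\mu$. $B(x,r)$ is the open ball. $\mu(f)=\int_X f\,d\mu$; $\operatorname{Cov}(f,g)=\mu(fg)-\mu(f)\mu(g)$, $\operatorname{Var}(f)=\operatorname{Cov}(f,f)$ (for real $f$). For $\alpha\in(0,1]$, $\mathcal H_\alpha(\mathbb C)$ is the space of complex-valued $\alpha$-Hölder functions on $X$, $\|f\|_\infty=\sup|f|$ and $|f|_\alpha=\sup_{x\ne y}|f(x)-f(y)|/d(x,y)^\alpha$. **Radius functions.** $\hat r_n(x)=\inf\{r\ge0:\mu(B(x,r))\ge M_n\}$; these satisfy $\mu(B(x,\hat r_n(x)))=M_n$ for $\mu$-a.e. $x$. **Multiple Decorrelation.** For every $\alpha\in(0,1]$ there exist $r\ge1$, $\tau_r>0$ and a polynomial $P_r$ with real non-negative coefficients such that, for all integers $m_1,m_2,N\ge0$, all integer sequences $0\le k_1\le\dots\le k_{m_1}$ and $0\le l_1\le\dots\le l_{m_2}$, and all $\varphi_1,\dots,\varphi_{m_1+m_2}\in\mathcal H_\alpha(\mathbb C)$, $$\Bigl|\operatorname{Cov}\Bigl(\prod_{i=1}^{m_1}\varphi_i\circ T^{k_i},\prod_{j=1}^{m_2}\varphi_{m_1+j}\circ T^{N+l_j}\Bigr)\Bigr|\le\Bigl(\prod_{i=1}^{m_1+m_2}\|\varphi_i\|_\infty+\sum_{i=1}^{m_1+m_2}|\varphi_i|_\alpha\prod_{j\ne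 i}\|\varphi_j\|_\infty\Bigr)P_r(l_{m_2})e^{-\tau_r(N-rk_{m_1})}.$$ **Frostman property.** There exist $s_0>0$, $C>0$ with $\mu(B(x,r))\le Cr^{s_0}$ for all $x\in X$, $r>0$. **Thin annuli property.** There exist $\alpha_0,\rho_0>0$ and $C>0$ with $\mu(B(x,r+\varepsilon)\setminus B(x,r))\le C\varepsilon^{\alpha_0}$ for all $x\in X$ and $0<\varepsilon\le r\le\rho_0$. **Condition $\mathcal S(\gamma,\upsilon)$** for a sequence $(a_n)$: $(a_n)$ is monotone decreasing and there is a constant $C>0$ with $C^{-1}n^{-\gamma}\le a_n\le C(\log n)^{-\upsilon}$ for all $n\in\mathbb N$ (the upper bound being vacuous for $n=1$). *)

theory Defs
  imports "HOL-Probability.Probability" "HOL-Computational_Algebra.Polynomial"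
begin

section \<open>Compact Riemannian manifolds\<close>

text \<open>
  \<open>C\<^sup>k\<close> and \<open>C\<^sup>\<infinity>\<close> functions; only meant for open sets \<open>S\<close>.
\<close>

primrec Ck_on :: "nat \<Rightarrow> ('e::euclidean_space \<Rightarrow> 'f::real_normed_vector) \<Rightarrow> 'e set \<Rightarrow> bool" where
  "Ck_on 0 f S \<longleftrightarrow> continuous_on S f"
| "Ck_on (Suc k) f S \<longleftrightarrow>
     (\<forall>z\<in>S. f differentiable (at z)) \<and> (\<forall>v. Ck_on k (\<lambda>z. frechet_derivative f (at z) v) S)"

definition smooth_on :: "('e::euclidean_space \<Rightarrow> 'f::real_normed_vector) \<Rightarrow> 'e set \<Rightarrow> bool" where
  "smooth_on f S \<longleftrightarrow> (\<forall>k. Ck_on k f S)"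

text \<open>
  A chart is a pair \<open>(U, \<phi>)\<close>; the values of \<open>\<phi>\<close> outside \<open>U\<close> are irrelevant. The manifold is the
  whole type, and the dimension is that of the model space \<open>'e\<close>.
\<close>

type_synonym ('a, 'e) chart = "'a set \<times> ('a \<Rightarrow> 'e)"

abbreviation transition :: "('a, 'e) chart \<Rightarrow> ('a, 'e) chart \<Rightarrow> 'e \<Rightarrow> 'e" where
  "transition c c' \<equiv> snd c' \<circ> inv_into (fst c) (snd c)"

definition smooth_atlas :: "('a::topological_space, 'e::euclidean_space) chart set \<Rightarrow> bool" where
  "smooth_atlas A \<longleftrightarrow>
     (\<Union>c\<in>A. fst c) = UNIV \<and>
     (\<forall>(U, \<phi>)\<in>A. open U \<and> open (\<phi> ` U) \<and> homeomorphism U (\<phi> ` U) \<phi> (inv_into U \<phi>)) \<and>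
     (\<forall>c\<in>A. \<forall>c'\<in>A. smooth_on (transition c c') (snd c ` (fst c \<inter> fst c')))"

text \<open>
  \<open>g c p u v\<close> is the inner product at the point \<open>p\<close> of the two tangent vectors whose coordinates in
  the chart \<open>c\<close> are \<open>u\<close> and \<open>v\<close>. The last clause says that these local expressions define one tensor.
\<close>

type_synonym ('a, 'e) metric_tensor = "('a, 'e) chart \<Rightarrow> 'a \<Rightarrow> 'e \<Rightarrow> 'e \<Rightarrow> real"

definition riemannian_metric ::
    "('a::topological_space, 'e::euclidean_space) chart set \<Rightarrow> ('a, 'e) metric_tensor \<Rightarrow> bool" where
  "riemannian_metric A g \<longleftrightarrow>
     (\<forall>c\<in>A. \<forall>p\<in>fst c.
        bilinear (g c p) \<and> (\<forall>u v. g c p u v = g c p v u) \<and> (\<forall>u. u \<noteq> 0 \<longrightarrow> g c p u u > 0)) \<and>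
     (\<forall>c\<in>A. \<forall>u v. smooth_on (\<lambda>z. g c (inv_into (fst c) (snd c) z) u v) (snd c ` fst c)) \<and>
     (\<forall>c\<in>A. \<forall>c'\<in>A. \<forall>p\<in>fst c \<inter> fst c'. \<forall>u v.
        let D = frechet_derivative (transition c c') (at (snd c p))
        in g c p u v = g c' p (D u) (D v))"

text \<open>
  On a compact interval, including its end points (one-sided derivatives). The library's
  \<^const>\<open>piecewise_C1_differentiable_on\<close> does not control the derivative near the break points, so
  piecewise \<open>C\<^sup>1\<close> curves are described below by their \<open>C\<^sup>1\<close> pieces.
\<close>

definition C1_curve_on ::
    "('a::topological_space, 'e::euclidean_space) chart set \<Rightarrow> (real \<Rightarrow> 'a) \<Rightarrow> real \<Rightarrow> real \<Rightarrow> bool" where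
  "C1_curve_on A \<gamma> a b \<longleftrightarrow>
     continuous_on {a..b} \<gamma> \<and>
     (\<forall>(U, \<phi>)\<in>A. let I = {t\<in>{a..b}. \<gamma> t \<in> U} in
        (\<forall>t\<in>I. (\<phi> \<circ> \<gamma>) differentiable (at t within {a..b})) \<and>
        continuous_on I (\<lambda>t. vector_derivative (\<phi> \<circ> \<gamma>) (at t within {a..b})))"

text \<open>The speed does not depend on the chart selected around \<open>\<gamma> t\<close>.\<close>

definition speed ::
    "('a, 'e::euclidean_space) chart set \<Rightarrow> ('a, 'e) metric_tensor \<Rightarrow> (real \<Rightarrow> 'a) \<Rightarrow> real set \<Rightarrow> real \<Rightarrow> real" where
  "speed A g \<gamma> I t =
     (let c = (SOME c. c \<in> A \<and> \<gamma> t \<in> fst c);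
          v = vector_derivative (snd c \<circ> \<gamma>) (at t within I)
      in sqrt (g c (\<gamma> t) v v))"

text \<open>Lengths of the piecewise \<open>C\<^sup>1\<close> curves from \<open>x\<close> to \<open>y\<close>, with break points \<open>s 0 < \<dots> < s n\<close>.\<close>

definition curve_lengths ::
    "('a::topological_space, 'e::euclidean_space) chart set \<Rightarrow> ('a, 'e) metric_tensor \<Rightarrow> 'a \<Rightarrow> 'a \<Rightarrow> real set" where
  "curve_lengths A g x y =
     {(\<Sum>i<n. integral {s i..s (Suc i)} (speed A g \<gamma> {s i..s (Suc i)})) | \<gamma> s (n::nat).
        (\<forall>i<n. s i < s (Suc i) \<and> C1_curve_on A \<gamma> (s i) (s (Suc i))) \<and>
        \<gamma> (s 0) = x \<and> \<gamma> (s n) = y}"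

text \<open>
  The distance of the type is the Riemannian distance (and induces the manifold topology, as the
  charts are homeomorphisms). On a connected manifold any two points are joined by a curve;
  connectedness is not demanded, and the distance between different components is then
  only required to be part of a metric compatible with the topology.
\<close>

definition compact_riemannian_manifold ::
    "('a::metric_space, 'e::euclidean_space) chart set \<Rightarrow> ('a, 'e) metric_tensor \<Rightarrow> bool" where
  "compact_riemannian_manifold A g \<longleftrightarrow>
     compact (UNIV :: 'a set) \<and> smooth_atlas A \<and> riemannian_metric A g \<and>
     (\<forall>x y. curve_lengths A g x y \<noteq> {} \<longrightarrow> dist x y = Inf (curve_lengths A g x y))"


section \<open>Measure-preserving systems\<close>

definition non_atomic :: "'a measure \<Rightarrow> bool" where
  "non_atomic \<mu> \<longleftrightarrow>
     (\<forall>S\<in>sets \<mu>. emeasure \<mu> S > 0 \<longrightarrow>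
        (\<exists>S'\<in>sets \<mu>. S' \<subseteq> S \<and> 0 < emeasure \<mu> S' \<and> emeasure \<mu> S' < emeasure \<mu> S))"

definition measure_preserving_system :: "'a::topological_space measure \<Rightarrow> ('a \<Rightarrow> 'a) \<Rightarrow> bool" where
  "measure_preserving_system \<mu> T \<longleftrightarrow>
     prob_space \<mu> \<and> sets \<mu> = sets borel \<and> non_atomic \<mu> \<and> T \<in> measurable \<mu> \<mu> \<and> distr \<mu> \<mu> T = \<mu>"

text \<open>For complex functions this is the bilinear covariance: no conjugation.\<close>

definition Cov ::
    "'a measure \<Rightarrow> ('a \<Rightarrow> 'b::{real_normed_field, banach, second_countable_topology}) \<Rightarrow> ('a \<Rightarrow> 'b) \<Rightarrow> 'b" where
  "Cov \<mu> f h = (LINT x|\<mu>. f x * h x) - (LINT x|\<mu>. f x) * (LINT x|\<mu>. h x)"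

definition Var :: "'a measure \<Rightarrow> ('a \<Rightarrow> real) \<Rightarrow> real" where
  "Var \<mu> f = Cov \<mu> f f"

definition hoelder :: "real \<Rightarrow> ('a::metric_space \<Rightarrow> complex) set" where
  "hoelder \<alpha> = {f. \<exists>C. \<forall>x y. cmod (f x - f y) \<le> C * dist x y powr \<alpha>}"

definition sup_norm :: "('a \<Rightarrow> complex) \<Rightarrow> real" where
  "sup_norm f = (SUP x. cmod (f x))"

definition hoelder_seminorm :: "real \<Rightarrow> ('a::metric_space \<Rightarrow> complex) \<Rightarrow> real" where
  "hoelder_seminorm \<alpha> f = Sup {cmod (f x - f y) / dist x y powr \<alpha> | x y. x \<noteq> y}"

text \<open>
  Sequences are indexed from 1. If \<open>m1 = 0\<close> or \<open>m2 = 0\<close>, the covariance vanishes and the right-hand side is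
  nonnegative, so the value of \<open>k m1 = k 0\<close> or \<open>l m2 = l 0\<close> does not matter.
\<close>

definition multiple_decorrelation :: "'a::metric_space measure \<Rightarrow> ('a \<Rightarrow> 'a) \<Rightarrow> bool" where
  "multiple_decorrelation \<mu> T \<longleftrightarrow>
     (\<forall>\<alpha>. 0 < \<alpha> \<and> \<alpha> \<le> 1 \<longrightarrow>
       (\<exists>(r::real) (\<tau>::real) (P::real poly). r \<ge> 1 \<and> \<tau> > 0 \<and> (\<forall>i. coeff P i \<ge> 0) \<and>
         (\<forall>(m1::nat) (m2::nat) (N::nat) (k::nat \<Rightarrow> nat) (l::nat \<Rightarrow> nat) (\<phi>::nat \<Rightarrow> 'a \<Rightarrow> complex).
            mono_on {1..m1} k \<and> mono_on {1..m2} l \<and> (\<forall>i\<in>{1..m1+m2}. \<phi> i \<in> hoelder \<alpha>) \<longrightarrow>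
            cmod (Cov \<mu> (\<lambda>x. \<Prod>i=1..m1. \<phi> i ((T ^^ k i) x))
                        (\<lambda>x. \<Prod>j=1..m2. \<phi> (m1 + j) ((T ^^ (N + l j)) x)))
            \<le> ((\<Prod>i=1..m1+m2. sup_norm (\<phi> i)) +
                (\<Sum>i=1..m1+m2. hoelder_seminorm \<alpha> (\<phi> i) * (\<Prod>j\<in>{1..m1+m2} - {i}. sup_norm (\<phi> j))))
              * poly P (real (l m2)) * exp (- \<tau> * (real N - r * real (k m1))))))"

definition frostman :: "'a::metric_space measure \<Rightarrow> bool" where
  "frostman \<mu> \<longleftrightarrow> (\<exists>s0>0. \<exists>C>0. \<forall>x. \<forall>r>0. measure \<mu> (ball x r) \<le> C * r powr s0)"

definition thin_annuli :: "'a::metric_space measure \<Rightarrow> bool" where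
  "thin_annuli \<mu> \<longleftrightarrow>
     (\<exists>\<alpha>0>0. \<exists>\<rho>0>0. \<exists>C>0. \<forall>x r \<epsilon>. 0 < \<epsilon> \<and> \<epsilon> \<le> r \<and> r \<le> \<rho>0 \<longrightarrow>
        measure \<mu> (ball x (r + \<epsilon>) - ball x r) \<le> C * \<epsilon> powr \<alpha>0)"

text \<open>Sequences are indexed by positive integers; the upper bound is void for \<open>n = 1\<close>.\<close>

definition condition_S :: "real \<Rightarrow> real \<Rightarrow> (nat \<Rightarrow> real) \<Rightarrow> bool" where
  "condition_S \<gamma> \<upsilon> a \<longleftrightarrow>
     antimono_on {1..} a \<and>
     (\<exists>C>0. (\<forall>n\<ge>1. inverse C * real n powr (- \<gamma>) \<le> a n) \<and>
            (\<forall>n\<ge>2. a n \<le> C * ln (real n) powr (- \<upsilon>)))"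


section \<open>Radius functions, recurrence sets and variances\<close>

definition radius :: "'a::metric_space measure \<Rightarrow> (nat \<Rightarrow> real) \<Rightarrow> nat \<Rightarrow> 'a \<Rightarrow> real" where
  "radius \<mu> M n x = Inf {r. r \<ge> 0 \<and> measure \<mu> (ball x r) \<ge> M n}"

definition rec_set :: "'a::metric_space measure \<Rightarrow> ('a \<Rightarrow> 'a) \<Rightarrow> (nat \<Rightarrow> real) \<Rightarrow> nat \<Rightarrow> 'a set" where
  "rec_set \<mu> T M n = {x. (T ^^ n) x \<in> ball x (radius \<mu> M n x)}"

definition sigma_sq :: "'a::metric_space measure \<Rightarrow> ('a \<Rightarrow> 'a) \<Rightarrow> (nat \<Rightarrow> real) \<Rightarrow> nat \<Rightarrow> real" where
  "sigma_sq \<mu> T M n = Var \<mu> (\<lambda>x. \<Sum>k=1..n. indicator (rec_set \<mu> T M k) x)"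

definition s_sq :: "'a::metric_space measure \<Rightarrow> ('a \<Rightarrow> 'a) \<Rightarrow> (nat \<Rightarrow> real) \<Rightarrow> nat \<Rightarrow> 'a \<Rightarrow> real" where
  "s_sq \<mu> T M n y = Var \<mu> (\<lambda>x. \<Sum>k=1..n. indicator (ball y (radius \<mu> M k y)) ((T ^^ k) x))"

end

theory Submission
  imports Defs "HOL-Real_Asymp.Real_Asymp"
begin

text \<open>
  The recurrence sum differs from the sum of the hits of the targets \<open>B(y, r\<^sub>k(y))\<close> around a fixed
  centre \<open>y\<close> in that the centre is the starting point \<open>x\<close> of the orbit itself. The idea is that the
  orbit forgets its starting point: when \<open>x\<close> is known only up to a tiny error, the points
  \<open>T\<^sup>k x\<close> with \<open>k\<close> large are distributed as if \<open>x\<close> were drawn from \<open>\<mu>\<close>. Hence the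
  characteristic function of the recurrence sum is close to the average over \<open>y\<close> of the
  characteristic functions of the sums with centre \<open>y\<close>, and those are Gaussian in the limit by assumption.

  The step from the diagonal to the average is \<open>decoupling\<close>. Let \<open>h\<^sub>k(y, z)\<close> be bounded by 1 and
  Lipschitz in both variables. Cover the space by \<open>J\<close> balls of radius \<open>\<eta>\<close> and take a subordinate
  Lipschitz partition of unity. On each piece the first variable may be replaced by the centre of
  the piece, and then multiple decorrelation separates the weight of the piece from the product of the
  \<open>h\<^sub>k(w, T\<^sup>k x)\<close>, \<open>k \<ge> m\<close>, at a cost of \<open>e\<^sup>-\<^sup>\<tau>\<^sup>m\<close> times a polynomial in \<open>n\<close>, \<open>J\<close>, \<open>1/\<eta>\<close> and the
  Lipschitz constant. That decorrelation holds for products of arbitrarily many factors is what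
  makes it applicable to \<open>exp(i\<theta>\<Sum>\<dots>)\<close>, which is such a product. Two facts make the total error
  small. First, \<open>J\<close> is polynomial in \<open>1/\<eta>\<close>: this is where the Riemannian structure enters, since straight
  segments in a chart show that inverse charts are Lipschitz on compact balls (\<open>chart_inverse_lipschitz\<close>,
  \<open>compact_riemannian_polynomial_nets\<close>). Secondly, indicators of balls are within \<open>O(\<delta>\<^sup>\<alpha>)\<close> in
  \<open>L\<^sup>1\<close> of functions with Lipschitz constant \<open>2/\<delta>\<close>, by the thin annuli property (\<open>soft_ball_gap\<close>); the
  radii are at least of polynomial size by the Frostman property, so \<open>\<delta>\<close> may be a negative power of \<open>n\<close>.

  The terms with \<open>k < m\<close> have to be dropped, with \<open>m\<close> a small power of \<open>n\<close>, and this is harmless only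
  if the normalisation \<open>\<sigma>\<^sub>n\<close> grows faster than \<open>m\<close>. The growth comes from the
  centres \<open>y\<close>: the variance of the sum with centre \<open>y\<close> is at least a constant times \<open>n\<^sup>1\<^sup>-\<^sup>\<gamma>\<close>
  (\<open>s_sq_growth\<close>). Indeed covariances are never below \<open>-M\<^sub>k M\<^sub>l\<close>, and beyond a lag of order \<open>log n\<close> they are
  negligible. So the negative part of the off-diagonal sum is at most of order \<open>(log n) M\<^sub>m \<Sum> M\<^sub>k\<close>,
  which is \<open>o(\<Sum> M\<^sub>k)\<close> because \<open>M\<^sub>m = O((log m)\<^sup>-\<^sup>\<upsilon>)\<close> with \<open>\<upsilon> > 1\<close>. Since the quotient of the two variances tends
  to 1 in probability, \<open>\<sigma>\<^sub>n\<^sup>2\<close> grows in the same way (\<open>sigma_sq_growth\<close>).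

  Finally the average over \<open>y\<close> of the characteristic functions, normalised by \<open>\<sigma>\<^sub>n\<close>, tends to
  \<open>exp(-t\<^sup>2/2)\<close> by dominated convergence, after \<open>\<sigma>\<^sub>n\<close> has been exchanged for the standard
  deviation of the sum with centre \<open>y\<close> (\<open>quenched_to_annealed\<close>); Levy's continuity theorem concludes.
\<close>


section \<open>Polynomial nets in a compact Riemannian manifold\<close>

text \<open>
  The image under the inverse chart of the straight segment from \<open>u\<close> to \<open>v\<close> is a \<open>C\<^sup>1\<close> curve, and the metric
  coefficients are bounded on the compact ball; so the length of this curve, hence the distance
  of its end points, is at most a constant times the Euclidean distance of \<open>u\<close> and \<open>v\<close>.
\<close>
lemma chart_inverse_lipschitz:
  fixes A :: "('a::metric_space, 'e::euclidean_space) chart set"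
  assumes man: "compact_riemannian_manifold A g" and c: "c \<in> A"
    and ball: "cball z \<rho> \<subseteq> snd c ` fst c"
  obtains K where "K \<ge> 0" "K-lipschitz_on (cball z \<rho>) (inv_into (fst c) (snd c))"
proof -
  define U where "U = fst c"
  define \<phi> where "\<phi> = snd c"
  define \<iota> where "\<iota> = inv_into U \<phi>"
  have atlas: "smooth_atlas A" and metric: "riemannian_metric A g"
    and dist_Inf: "\<And>x y. curve_lengths A g x y \<noteq> {} \<Longrightarrow> dist x y = Inf (curve_lengths A g x y)"
    using man unfolding compact_riemannian_manifold_def by blast+
  have cover: "(\<Union>c\<in>A. fst c) = UNIV"
    and chart: "\<And>U \<phi>. (U, \<phi>) \<in> A \<Longrightarrow> open U \<and> open (\<phi> ` U) \<and> homeomorphism U (\<phi> ` U) \<phi> (inv_into U \<phi>)"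
    and trans: "\<And>c c'. c \<in> A \<Longrightarrow> c' \<in> A \<Longrightarrow> smooth_on (transition c c') (snd c ` (fst c \<inter> fst c'))"
    using atlas unfolding smooth_atlas_def by (blast+)
  have cU: "(U, \<phi>) \<in> A" using c by (simp add: U_def \<phi>_def)
  have hom: "homeomorphism U (\<phi> ` U) \<phi> \<iota>"
    using chart[OF cU] by (auto simp: \<iota>_def)
  have contI: "continuous_on (\<phi> ` U) \<iota>"
    using hom unfolding homeomorphism_def by blast
  have sub: "cball z \<rho> \<subseteq> \<phi> ` U" using ball by (simp add: U_def \<phi>_def)
  have bil: "\<And>c p. c \<in> A \<Longrightarrow> p \<in> fst c \<Longrightarrow> bilinear (g c p)"
    and pos: "\<And>c p u. c \<in> A \<Longrightarrow> p \<in> fst c \<Longrightarrow> u \<noteq> 0 \<Longrightarrow> g c p u u > 0"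
    and smo: "\<And>c u v. c \<in> A \<Longrightarrow> smooth_on (\<lambda>z. g c (inv_into (fst c) (snd c) z) u v) (snd c ` fst c)"
    and tensor: "\<And>c c' p u v. c \<in> A \<Longrightarrow> c' \<in> A \<Longrightarrow> p \<in> fst c \<inter> fst c' \<Longrightarrow>
        g c p u v = g c' p (frechet_derivative (transition c c') (at (snd c p)) u)
                           (frechet_derivative (transition c c') (at (snd c p)) v)"
    using metric unfolding riemannian_metric_def Let_def by blast+
  have nonneg: "g c p u u \<ge> 0" if "c \<in> A" "p \<in> fst c" for c p u
    using pos[OF that, of u] bilinear_lzero[OF bil[OF that]] by (cases "u = 0") auto
  have "\<exists>B. \<forall>w\<in>cball z \<rho>. \<bar>g c (\<iota> w) a b\<bar> \<le> B" for a b
  proof -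
    have "Ck_on 0 (\<lambda>w. g c (\<iota> w) a b) (\<phi> ` U)"
      using smo[OF c, of a b] unfolding smooth_on_def U_def \<phi>_def \<iota>_def by blast
    then have "continuous_on (cball z \<rho>) (\<lambda>w. g c (\<iota> w) a b)"
      using continuous_on_subset sub by auto
    then have "bounded ((\<lambda>w. g c (\<iota> w) a b) ` cball z \<rho>)"
      using compact_cball compact_continuous_image compact_imp_bounded by blast
    then show ?thesis unfolding bounded_iff by auto
  qed
  then obtain B where B: "\<And>a b w. w \<in> cball z \<rho> \<Longrightarrow> \<bar>g c (\<iota> w) a b\<bar> \<le> B a b" by metis
  define K2 where "K2 = \<bar>\<Sum>(a,b)\<in>Basis \<times> Basis. B a b\<bar>"
  have Ucarr: "\<iota> w \<in> U" "\<phi> (\<iota> w) = w" if "w \<in> \<phi> ` U" for w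
    using that hom unfolding homeomorphism_def by auto
  have gbound: "g c (\<iota> w) v v \<le> K2 * (norm v)\<^sup>2" if w: "w \<in> cball z \<rho>" for w v
  proof -
    have p: "\<iota> w \<in> fst c" using Ucarr w sub by (auto simp: U_def)
    have "g c (\<iota> w) v v = g c (\<iota> w) (\<Sum>a\<in>Basis. (v \<bullet> a) *\<^sub>R a) (\<Sum>a\<in>Basis. (v \<bullet> a) *\<^sub>R a)"
      by (simp add: euclidean_representation)
    also have "\<dots> = (\<Sum>(a,b)\<in>Basis \<times> Basis. g c (\<iota> w) ((v \<bullet> a) *\<^sub>R a) ((v \<bullet> b) *\<^sub>R b))"
      by (rule bilinear_sum[OF bil[OF c p]])
    also have "\<dots> = (\<Sum>(a,b)\<in>Basis \<times> Basis. (v \<bullet> a) * (v \<bullet> b) * g c (\<iota> w) a b)"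
      by (intro sum.cong refl)
         (auto simp: bilinear_lmul[OF bil[OF c p]] bilinear_rmul[OF bil[OF c p]])
    also have "\<dots> \<le> (\<Sum>(a,b)\<in>Basis \<times> Basis. (norm v)\<^sup>2 * B a b)"
    proof (intro sum_mono, clarify)
      fix a b :: 'e assume ab: "a \<in> Basis" "b \<in> Basis"
      have "(v \<bullet> a) * (v \<bullet> b) * g c (\<iota> w) a b \<le> \<bar>v \<bullet> a\<bar> * \<bar>v \<bullet> b\<bar> * \<bar>g c (\<iota> w) a b\<bar>"
        by (metis abs_ge_self abs_mult)
      also have "\<dots> \<le> norm v * norm v * B a b"
        using ab B[OF w] by (intro mult_mono) (auto simp: Basis_le_norm)
      finally show "(v \<bullet> a) * (v \<bullet> b) * g c (\<iota> w) a b \<le> (norm v)\<^sup>2 * B a b"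
        by (simp add: power2_eq_square)
    qed
    also have "\<dots> = (norm v)\<^sup>2 * (\<Sum>(a,b)\<in>Basis \<times> Basis. B a b)"
      by (simp add: sum_distrib_left case_prod_beta)
    also have "\<dots> \<le> (norm v)\<^sup>2 * K2"
      unfolding K2_def by (intro mult_left_mono) auto
    finally show ?thesis by (simp add: mult.commute)
  qed
  have "dist (\<iota> u) (\<iota> v) \<le> sqrt K2 * dist u v" if u: "u \<in> cball z \<rho>" and v: "v \<in> cball z \<rho>" for u v
  proof -
    define line where "line t = u + t *\<^sub>R (v - u)" for t :: real
    define \<gamma> where "\<gamma> t = \<iota> (line t)" for t :: real
    have line_in: "line t \<in> cball z \<rho>" if "t \<in> {0..1}" for t
    proof -
      have "line t = (1 - t) *\<^sub>R u + t *\<^sub>R v" by (simp add: line_def algebra_simps)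
      then show ?thesis using convexD[OF convex_cball[of z \<rho>] u v, of "1 - t" t] that by auto
    qed
    have line_img: "line t \<in> \<phi> ` U" if "t \<in> {0..1}" for t using line_in[OF that] sub by auto
    have cont_line: "continuous_on S line" for S unfolding line_def by (intro continuous_intros)
    have cont\<gamma>: "continuous_on {0..1} \<gamma>"
      unfolding \<gamma>_def by (rule continuous_on_compose2[OF contI cont_line]) (use line_img in auto)
    have smooth1: "\<forall>w\<in>\<phi> ` (U \<inter> fst c'). transition c c' differentiable (at w)"
      "continuous_on (\<phi> ` (U \<inter> fst c')) (\<lambda>w. frechet_derivative (transition c c') (at w) x)"
      if "c' \<in> A" for c' x
    proof -
      have "Ck_on (Suc 0) (transition c c') (\<phi> ` (U \<inter> fst c'))"
        using trans[OF c that] unfolding smooth_on_def U_def \<phi>_def by blast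
      then show "\<forall>w\<in>\<phi> ` (U \<inter> fst c'). transition c c' differentiable (at w)"
        "continuous_on (\<phi> ` (U \<inter> fst c')) (\<lambda>w. frechet_derivative (transition c c') (at w) x)"
        by auto
    qed
    have in_overlap: "line t \<in> \<phi> ` (U \<inter> fst c')" if "t \<in> {0..1}" "\<gamma> t \<in> fst c'" for t and c' :: "('a, 'e) chart"
      using Ucarr[OF line_img[OF that(1)]] that(2) unfolding \<gamma>_def by (metis IntI imageI)
    have deriv: "((snd c' \<circ> \<gamma>) has_vector_derivative
        frechet_derivative (transition c c') (at (line t)) (v - u)) (at t within {0..1})"
      if c': "c' \<in> A" and t: "t \<in> {0..1}" and \<gamma>t: "\<gamma> t \<in> fst c'" for c' t
    proof -
      let ?D = "frechet_derivative (transition c c') (at (line t))"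
      have D: "(transition c c' has_derivative ?D) (at (line t))"
        using smooth1(1)[OF c'] in_overlap[OF t \<gamma>t] frechet_derivative_works by blast
      have "(line has_derivative (\<lambda>h. h *\<^sub>R (v - u))) (at t within {0..1})"
        unfolding line_def by (auto intro!: derivative_eq_intros)
      from has_derivative_compose[OF this D]
      have "((transition c c' \<circ> line) has_derivative (\<lambda>h. ?D (h *\<^sub>R (v - u)))) (at t within {0..1})"
        by (simp add: comp_def)
      moreover have "?D (h *\<^sub>R (v - u)) = h *\<^sub>R ?D (v - u)" for h
        using has_derivative_linear[OF D] by (simp add: linear_cmul)
      moreover have "transition c c' \<circ> line = snd c' \<circ> \<gamma>"
        by (auto simp: \<gamma>_def \<iota>_def U_def \<phi>_def)
      ultimately show ?thesis by (simp add: has_vector_derivative_def)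
    qed
    have vderiv: "vector_derivative (snd c' \<circ> \<gamma>) (at t within {0..1}) =
        frechet_derivative (transition c c') (at (line t)) (v - u)"
      if "c' \<in> A" "t \<in> {0..1}" "\<gamma> t \<in> fst c'" for c' t
      using vector_derivative_within_cbox[of 0 1 t] deriv[OF that] that(2)
      by (simp only: cbox_interval) auto
    have C1: "C1_curve_on A \<gamma> 0 1"
    proof -
      have "(\<phi>' \<circ> \<gamma>) differentiable (at t within {0..1})"
        if "(U', \<phi>') \<in> A" "t \<in> {0..1}" "\<gamma> t \<in> U'" for U' \<phi>' t
        using deriv[OF that(1,2)] that(3) by (auto simp: has_vector_derivative_def differentiable_def)
      moreover have "continuous_on {t \<in> {0..1}. \<gamma> t \<in> U'} (\<lambda>t. vector_derivative (\<phi>' \<circ> \<gamma>) (at t within {0..1}))"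
        if "(U', \<phi>') \<in> A" for U' \<phi>'
      proof -
        have "continuous_on {t \<in> {0..1}. \<gamma> t \<in> U'} (\<lambda>t. frechet_derivative (transition c (U',\<phi>')) (at (line t)) (v - u))"
          by (rule continuous_on_compose2[OF smooth1(2)[OF that] cont_line])
             (use in_overlap[of _ "(U',\<phi>')"] in auto)
        then show ?thesis
          by (rule continuous_on_cong[THEN iffD1, rotated -1]) (use vderiv[OF that] in auto)
      qed
      ultimately show ?thesis unfolding C1_curve_on_def Let_def using cont\<gamma> by auto
    qed
    \<comment> \<open>The speed is defined through an arbitrary chart around the point; the transformation rule
      of the metric tensor moves the computation to the given chart.\<close>
    have speed: "speed A g \<gamma> {0..1} t \<le> sqrt K2 * dist u v" if t: "t \<in> {0..1}" for t
    proof -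
      define c' where "c' = (SOME c. c \<in> A \<and> \<gamma> t \<in> fst c)"
      have "\<exists>c. c \<in> A \<and> \<gamma> t \<in> fst c" using cover by blast
      from someI_ex[OF this] have c': "c' \<in> A" "\<gamma> t \<in> fst c'" by (auto simp: c'_def)
      have \<gamma>t: "\<gamma> t \<in> fst c" "snd c (\<gamma> t) = line t"
        using Ucarr[OF line_img[OF t]] by (auto simp: \<gamma>_def U_def \<phi>_def)
      have "speed A g \<gamma> {0..1} t = sqrt (g c (\<gamma> t) (v - u) (v - u))"
        unfolding speed_def Let_def c'_def[symmetric] vderiv[OF c'(1) t c'(2)]
        using tensor[OF c c'(1), of "\<gamma> t" "v - u" "v - u"] \<gamma>t c' by simp
      also have "\<dots> \<le> sqrt (K2 * (norm (v - u))\<^sup>2)"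
        using gbound[OF line_in[OF t]] by (simp add: \<gamma>_def)
      also have "\<dots> = sqrt K2 * dist u v"
        by (simp add: real_sqrt_mult dist_norm norm_minus_commute)
      finally show ?thesis .
    qed
    have K2: "K2 \<ge> 0" by (simp add: K2_def)
    \<comment> \<open>The integral of a non-integrable function is 0, so the pointwise bound on the speed suffices.\<close>
    have int_le: "integral {0..1} (speed A g \<gamma> {0..1}) \<le> sqrt K2 * dist u v"
    proof (cases "speed A g \<gamma> {0..1} integrable_on {0..1}")
      case True
      then have "integral {0..1} (speed A g \<gamma> {0..1}) \<le> integral {0..1} (\<lambda>_::real. sqrt K2 * dist u v)"
        using speed by (intro integral_le) auto
      then show ?thesis by simp
    next
      case False then show ?thesis using K2 by (simp add: not_integrable_integral)
    qed
    have mem: "integral {0..1} (speed A g \<gamma> {0..1}) \<in> curve_lengths A g (\<iota> u) (\<iota> v)"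
      unfolding curve_lengths_def
      by (rule CollectI, rule exI[of _ \<gamma>], rule exI[of _ real], rule exI[of _ "1::nat"])
         (use C1 in \<open>auto simp: \<gamma>_def line_def\<close>)
    have speed0: "speed A g \<gamma> I t \<ge> 0" for \<gamma> I t
    proof -
      have "\<exists>c. c \<in> A \<and> \<gamma> t \<in> fst c" using cover by blast
      from someI_ex[OF this] nonneg show ?thesis unfolding speed_def Let_def by auto
    qed
    \<comment> \<open>The infimum of a set of reals is only meaningful if the set is bounded below.\<close>
    have "bdd_below (curve_lengths A g (\<iota> u) (\<iota> v))"
      unfolding curve_lengths_def
    proof (rule bdd_belowI[of _ 0], clarify)
      fix \<gamma> s and n :: nat
      have "integral S (speed A g \<gamma> I) \<ge> 0" for S I
      proof (cases "speed A g \<gamma> I integrable_on S")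
        case True then show ?thesis using speed0 by (intro integral_nonneg) auto
      next
        case False then show ?thesis by (simp add: not_integrable_integral)
      qed
      then show "0 \<le> (\<Sum>i<n. integral {s i..s (Suc i)} (speed A g \<gamma> {s i..s (Suc i)}))"
        by (intro sum_nonneg) auto
    qed
    from cInf_lower[OF mem this] have "Inf (curve_lengths A g (\<iota> u) (\<iota> v)) \<le> sqrt K2 * dist u v"
      using int_le by linarith
    then show ?thesis using dist_Inf[of "\<iota> u" "\<iota> v"] mem by force
  qed
  then have "(sqrt K2)-lipschitz_on (cball z \<rho>) \<iota>"
    by (intro lipschitz_onI) (auto simp: K2_def)
  then show ?thesis using that[of "sqrt K2"] by (auto simp: \<iota>_def U_def \<phi>_def K2_def)
qed

text \<open>
  Compactness gives some number \<open>m\<close> of half-size balls that cover the unit ball; by translation and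
  scaling the same \<open>m\<close> serves for every ball, so halving the radius \<open>j\<close> times costs a factor \<open>m\<^sup>j\<close>.
  With \<open>2\<^sup>j \<approx> 1/\<eta>\<close> this is a power of \<open>1/\<eta>\<close>.
\<close>
lemma cball_cover_halving:
  obtains m :: nat where "m \<ge> 1"
    "\<And>(z::'e::euclidean_space) \<rho> j. \<rho> > 0 \<Longrightarrow>
       \<exists>F. finite F \<and> card F \<le> m ^ j \<and> cball z \<rho> \<subseteq> (\<Union>w\<in>F. cball w (\<rho> / 2 ^ j))"
proof -
  have "\<exists>F \<subseteq> cball 0 1. finite F \<and> cball (0::'e) 1 \<subseteq> (\<Union>w\<in>F. ball w (1/2))"
  proof (rule compactE_image[OF compact_cball[of "0::'e" 1], of "cball 0 1" "\<lambda>w. ball w (1/2)"])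
    show "cball (0::'e) 1 \<subseteq> (\<Union>w\<in>cball 0 1. ball w (1/2))"
    proof
      fix x :: 'e assume "x \<in> cball 0 1"
      moreover have "x \<in> ball x (1/2)" by simp
      ultimately show "x \<in> (\<Union>w\<in>cball 0 1. ball w (1/2))" by blast
    qed
  qed blast+
  then obtain F0 where F0: "finite F0" "cball (0::'e) 1 \<subseteq> (\<Union>w\<in>F0. ball w (1/2))"
    by blast
  define m where "m = card F0"
  have "F0 \<noteq> {}" using F0(2) by fastforce
  then have "m \<ge> 1" using F0(1) by (simp add: m_def Suc_leI card_gt_0_iff)
  moreover have "\<exists>F. finite F \<and> card F \<le> m ^ j \<and> cball z \<rho> \<subseteq> (\<Union>w\<in>F. cball w (\<rho> / 2 ^ j))"
    if "\<rho> > 0" for z :: 'e and \<rho> j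
  proof (induction j)
    case 0
    show ?case by (rule exI[of _ "{z}"]) simp
  next
    case (Suc j)
    then obtain F where F: "finite F" "card F \<le> m ^ j" "cball z \<rho> \<subseteq> (\<Union>w\<in>F. cball w (\<rho> / 2 ^ j))"
      by blast
    define r where "r = \<rho> / 2 ^ j"
    have r: "r > 0" using that by (simp add: r_def)
    define F' where "F' = (\<lambda>(w, v). w + r *\<^sub>R v) ` (F \<times> F0)"
    have "card F' \<le> card (F \<times> F0)" unfolding F'_def using F(1) F0(1) by (intro card_image_le) auto
    also have "\<dots> \<le> m ^ j * m" using F(2) by (simp add: card_cartesian_product m_def)
    finally have card: "card F' \<le> m ^ Suc j" by (simp add: mult.commute)
    have "x \<in> (\<Union>w\<in>F'. cball w (\<rho> / 2 ^ Suc j))" if x: "x \<in> cball z \<rho>" for x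
    proof -
      obtain w where w: "w \<in> F" "dist w x \<le> r" using F(3) x by (auto simp: r_def)
      have "(1 / r) *\<^sub>R (x - w) \<in> cball 0 1"
        using w(2) r by (simp add: dist_norm norm_minus_commute divide_simps)
      then obtain v where v: "v \<in> F0" "norm (v - (1 / r) *\<^sub>R (x - w)) < 1/2"
        using F0(2) unfolding subset_iff UN_iff mem_ball dist_norm by blast
      have "w + r *\<^sub>R v - x = r *\<^sub>R (v - (1 / r) *\<^sub>R (x - w))"
        using r by (simp add: algebra_simps)
      then have "norm (w + r *\<^sub>R v - x) = r * norm (v - (1 / r) *\<^sub>R (x - w))"
        using r by simp
      also have "\<dots> \<le> r * (1/2)" using v(2) r by (intro mult_left_mono) auto
      finally have "dist (w + r *\<^sub>R v) x \<le> \<rho> / 2 ^ Suc j"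
        by (simp add: dist_norm r_def)
      moreover have "w + r *\<^sub>R v \<in> F'" using w v unfolding F'_def by force
      ultimately show ?thesis by auto
    qed
    then have "cball z \<rho> \<subseteq> (\<Union>w\<in>F'. cball w (\<rho> / 2 ^ Suc j))" by (rule subsetI)
    moreover have "finite F'" using F0(1) F(1) unfolding F'_def by simp
    ultimately show ?case using card by (intro exI[of _ F'] conjI)
  qed
  ultimately show ?thesis using that by blast
qed

text \<open>Finite Minkowski dimension of the whole space, in quantitative form.\<close>
definition polynomial_nets :: "'a::metric_space itself \<Rightarrow> real \<Rightarrow> real \<Rightarrow> bool" where
  "polynomial_nets _ C q \<longleftrightarrow> (\<forall>\<eta>. 0 < \<eta> \<and> \<eta> \<le> 1 \<longrightarrow>
     (\<exists>F::'a set. finite F \<and> real (card F) \<le> C * \<eta> powr (-q) \<and> (\<forall>x. \<exists>y\<in>F. dist x y < \<eta>)))"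

lemma lipschitz_image_of_cball_nets:
  fixes \<iota> :: "'e::euclidean_space \<Rightarrow> 'a::metric_space"
  assumes lip: "K-lipschitz_on (cball z \<rho>) \<iota>" and \<rho>: "\<rho> > 0"
    and m: "m \<ge> 1"
      "\<And>(z::'e::euclidean_space) \<rho> j. \<rho> > 0 \<Longrightarrow>
       \<exists>F. finite F \<and> card F \<le> m ^ j \<and> cball z \<rho> \<subseteq> (\<Union>w\<in>F. cball w (\<rho> / 2 ^ j))"
  shows "\<exists>C>0. \<forall>\<eta>. 0 < \<eta> \<and> \<eta> \<le> 1 \<longrightarrow> (\<exists>F. finite F \<and> real (card F) \<le> C * \<eta> powr (- log 2 (real m)) \<and>
           (\<forall>x\<in>\<iota> ` cball z \<rho>. \<exists>y\<in>F. dist x y < \<eta>))"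
proof -
  have K: "K \<ge> 0" using lip lipschitz_on_nonneg by blast
  define b where "b = 2 * (K + 1) * \<rho>"
  have b: "b > 0" using K \<rho> by (simp add: b_def)
  define q where "q = log 2 (real m)"
  have q: "q \<ge> 0" using m by (simp add: q_def)
  have main: "\<exists>F. finite F \<and> real (card F) \<le> (real m * max b 1 powr q) * \<eta> powr (- q) \<and>
           (\<forall>x\<in>\<iota> ` cball z \<rho>. \<exists>y\<in>F. dist x y < \<eta>)" if \<eta>: "0 < \<eta>" "\<eta> \<le> 1" for \<eta>
  proof -
    define j where "j = nat \<lceil>log 2 (max b 1 / \<eta>)\<rceil>"
    have l0: "log 2 (max b 1 / \<eta>) \<ge> 0" using \<eta> by (simp add: divide_simps)
    have j1: "log 2 (max b 1 / \<eta>) \<le> real j" "real j \<le> log 2 (max b 1 / \<eta>) + 1"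
      using l0 unfolding j_def by linarith+
    have "max b 1 / \<eta> = 2 powr (log 2 (max b 1 / \<eta>))" using \<eta> by (simp add: )
    also have "\<dots> \<le> 2 powr real j" using j1 by simp
    finally have "max b 1 / \<eta> \<le> 2 ^ j" by (simp add: powr_realpow)
    then have small: "b / 2 ^ j \<le> \<eta>" using \<eta> by (simp add: divide_simps mult.commute)
    obtain F where F: "finite F" "card F \<le> m ^ j" "cball z \<rho> \<subseteq> (\<Union>w\<in>F. cball w (\<rho> / 2 ^ j))"
      using m(2)[OF \<rho>] by blast
    \<comment> \<open>The centres \<open>w\<close> need not lie in the ball on which \<open>\<iota>\<close> is Lipschitz, so each is replaced by a
      point of the ball nearby; this doubles the radius.\<close>
    define pick where "pick w = (SOME v. v \<in> cball z \<rho> \<inter> cball w (\<rho> / 2 ^ j))" for w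
    have "card ((\<lambda>w. \<iota> (pick w)) ` F) \<le> m ^ j" using card_image_le[OF F(1)] F(2) le_trans by blast
    then have "real (card ((\<lambda>w. \<iota> (pick w)) ` F)) \<le> real m ^ j" by (metis of_nat_le_iff of_nat_power)
    also have "\<dots> = real m powr real j" using m by (simp add: powr_realpow)
    also have "\<dots> \<le> real m powr (log 2 (max b 1 / \<eta>) + 1)" using j1 m by (intro powr_mono) auto
    also have "\<dots> = real m * real m powr (log 2 (max b 1 / \<eta>))" using m by (simp add: powr_add mult.commute)
    also have "real m powr (log 2 (max b 1 / \<eta>)) = (max b 1 / \<eta>) powr q"
    proof -
      have m2: "real m = 2 powr q" using m(1) by (simp add: q_def)
      have "real m powr (log 2 (max b 1 / \<eta>)) = (2 powr (log 2 (max b 1 / \<eta>))) powr q"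
        by (subst m2, simp only: powr_powr mult.commute)
      moreover have "2 powr (log 2 (max b 1 / \<eta>)) = max b 1 / \<eta>" using \<eta> by simp
      ultimately show ?thesis by metis
    qed
    also have "\<dots> = max b 1 powr q * \<eta> powr (- q)"
      using \<eta> by (simp add: powr_divide powr_minus_divide)
    finally have card: "real (card ((\<lambda>w. \<iota> (pick w)) ` F)) \<le> (real m * max b 1 powr q) * \<eta> powr (- q)"
      by (simp add: mult.assoc)
    have "\<exists>y\<in>(\<lambda>w. \<iota> (pick w)) ` F. dist (\<iota> x) y < \<eta>" if x: "x \<in> cball z \<rho>" for x
    proof -
      obtain w where w: "w \<in> F" "x \<in> cball w (\<rho> / 2 ^ j)" using F(3) x by blast
      have "\<exists>v. v \<in> cball z \<rho> \<inter> cball w (\<rho> / 2 ^ j)" using w x by blast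
      then have pw: "pick w \<in> cball z \<rho> \<inter> cball w (\<rho> / 2 ^ j)" unfolding pick_def by (rule someI_ex)
      have "dist x (pick w) \<le> dist x w + dist w (pick w)" by (rule dist_triangle)
      also have "\<dots> \<le> 2 * (\<rho> / 2 ^ j)" using w pw by (simp add: dist_commute)
      finally have d: "dist x (pick w) \<le> 2 * (\<rho> / 2 ^ j)" .
      have "dist (\<iota> x) (\<iota> (pick w)) \<le> K * dist x (pick w)"
        using lipschitz_onD[OF lip x, of "pick w"] pw by blast
      also have "\<dots> \<le> K * (2 * (\<rho> / 2 ^ j))" using d K by (intro mult_left_mono)
      also have "\<dots> < b / 2 ^ j" using \<rho> by (simp add: b_def field_simps)
      also have "\<dots> \<le> \<eta>" by (rule small)
      finally show ?thesis using w by blast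
    qed
    then show ?thesis using card F(1) by (intro exI[of _ "(\<lambda>w. \<iota> (pick w)) ` F"]) auto
  qed
  have "real m * max b 1 powr q > 0" using m b by simp
  then show ?thesis using main unfolding q_def[symmetric] by blast
qed

lemma compact_riemannian_polynomial_nets:
  fixes A :: "('a::metric_space, 'e::euclidean_space) chart set"
  assumes man: "compact_riemannian_manifold A g"
  obtains C q where "C > 0" "q \<ge> 0" "polynomial_nets TYPE('a) C q"
proof -
  obtain m where m: "m \<ge> 1" "\<And>(z::'e::euclidean_space) \<rho> j. \<rho> > 0 \<Longrightarrow>
       \<exists>F. finite F \<and> card F \<le> m ^ j \<and> cball z \<rho> \<subseteq> (\<Union>w\<in>F. cball w (\<rho> / 2 ^ j))"
    by (rule cball_cover_halving) blast
  define q where "q = log 2 (real m)"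
  have q: "q \<ge> 0" using m(1) by (simp add: q_def)
  have cover: "(\<Union>c\<in>A. fst c) = UNIV" and comp: "compact (UNIV :: 'a set)"
    and chart: "\<And>U \<phi>. (U, \<phi>) \<in> A \<Longrightarrow> open U \<and> open (\<phi> ` U) \<and> homeomorphism U (\<phi> ` U) \<phi> (inv_into U \<phi>)"
    using man unfolding compact_riemannian_manifold_def smooth_atlas_def by (blast+)
  have "\<exists>V C. open V \<and> p \<in> V \<and> C > 0 \<and> (\<forall>\<eta>. 0 < \<eta> \<and> \<eta> \<le> 1 \<longrightarrow>
          (\<exists>F. finite F \<and> real (card F) \<le> C * \<eta> powr (- q) \<and> (\<forall>x\<in>V. \<exists>y\<in>F. dist x y < \<eta>)))" for p :: 'a
  proof -
    obtain U \<phi> where c: "(U, \<phi>) \<in> A" and p: "p \<in> U" using cover by fastforce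
    have opU: "open U" and op: "open (\<phi> ` U)" and hom: "homeomorphism U (\<phi> ` U) \<phi> (inv_into U \<phi>)"
      using chart[OF c] by auto
    obtain \<rho> where \<rho>: "\<rho> > 0" "cball (\<phi> p) \<rho> \<subseteq> \<phi> ` U"
      using op p open_contains_cball by (metis imageI)
    obtain K where "K-lipschitz_on (cball (\<phi> p) \<rho>) (inv_into U \<phi>)"
      using chart_inverse_lipschitz[OF man c, of "\<phi> p" \<rho>] \<rho>(2) by auto
    from lipschitz_image_of_cball_nets[OF this \<rho>(1) m]
    obtain C where C: "C > 0" "\<And>\<eta>. 0 < \<eta> \<and> \<eta> \<le> 1 \<Longrightarrow> (\<exists>F. finite F \<and> real (card F) \<le> C * \<eta> powr (- q) \<and>
           (\<forall>x\<in>inv_into U \<phi> ` cball (\<phi> p) \<rho>. \<exists>y\<in>F. dist x y < \<eta>))"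
      unfolding q_def by blast
    define V where "V = U \<inter> \<phi> -` ball (\<phi> p) \<rho>"
    have "continuous_on U \<phi>" using hom by (simp add: homeomorphism_def)
    then have V: "open V" unfolding V_def using opU by (intro continuous_open_preimage) auto
    have "V \<subseteq> inv_into U \<phi> ` cball (\<phi> p) \<rho>"
    proof
      fix x assume x: "x \<in> V"
      then have "x = inv_into U \<phi> (\<phi> x)" using hom by (auto simp: V_def homeomorphism_def)
      moreover have "\<phi> x \<in> cball (\<phi> p) \<rho>" using x by (simp add: V_def)
      ultimately show "x \<in> inv_into U \<phi> ` cball (\<phi> p) \<rho>" by blast
    qed
    moreover have "p \<in> V" using p \<rho> by (simp add: V_def)
    moreover have "\<exists>F. finite F \<and> real (card F) \<le> C * \<eta> powr (- q) \<and> (\<forall>x\<in>V. \<exists>y\<in>F. dist x y < \<eta>)"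
      if "0 < \<eta> \<and> \<eta> \<le> 1" for \<eta>
      using C(2)[OF that] \<open>V \<subseteq> inv_into U \<phi> ` cball (\<phi> p) \<rho>\<close> by blast
    ultimately show ?thesis using V C(1) by blast
  qed
  then obtain V C where V: "\<And>p. open (V p)" "\<And>p::'a. p \<in> V p" "\<And>p. C p > 0"
    and net: "\<And>p \<eta>. 0 < \<eta> \<and> \<eta> \<le> 1 \<Longrightarrow>
        \<exists>F. finite F \<and> real (card F) \<le> C p * \<eta> powr (- q) \<and> (\<forall>x\<in>V p. \<exists>y\<in>F. dist x y < \<eta>)"
    by metis
  obtain D where D: "finite D" "UNIV \<subseteq> (\<Union>p\<in>D. V p)"
  proof (rule compactE_image[OF comp, of UNIV V])
    show "UNIV \<subseteq> (\<Union>p. V p)" using V(2) by blast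
  qed (use V(1) in auto)
  have "D \<noteq> {}" using D(2) by blast
  then have pos: "(\<Sum>p\<in>D. C p) > 0" using D(1) V(3) by (intro sum_pos) auto
  have "polynomial_nets TYPE('a) (\<Sum>p\<in>D. C p) q"
    unfolding polynomial_nets_def
  proof (intro allI impI)
    fix \<eta> :: real assume \<eta>: "0 < \<eta> \<and> \<eta> \<le> 1"
    obtain F where F: "\<And>p. finite (F p)" "\<And>p. real (card (F p)) \<le> C p * \<eta> powr (- q)"
      "\<And>p. \<forall>x\<in>V p. \<exists>y\<in>F p. dist x y < \<eta>"
      using net[OF \<eta>] by metis
    have "real (card (\<Union>p\<in>D. F p)) \<le> (\<Sum>p\<in>D. real (card (F p)))"
      using card_UN_le[OF D(1), of F] by (metis of_nat_le_iff of_nat_sum)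
    also have "\<dots> \<le> (\<Sum>p\<in>D. C p * \<eta> powr (- q))" by (intro sum_mono F)
    finally have "real (card (\<Union>p\<in>D. F p)) \<le> (\<Sum>p\<in>D. C p) * \<eta> powr (- q)" by (simp add: sum_distrib_right)
    moreover have "\<forall>x. \<exists>y\<in>(\<Union>p\<in>D. F p). dist x y < \<eta>" using D(2) F(3) by blast
    moreover have "finite (\<Union>p\<in>D. F p)" using D(1) F(1) by blast
    ultimately show "\<exists>F::'a set. finite F \<and> real (card F) \<le> (\<Sum>p\<in>D. C p) * \<eta> powr (- q) \<and> (\<forall>x. \<exists>y\<in>F. dist x y < \<eta>)"
      by (meson exI conjI)
  qed
  then show ?thesis using that pos q by blast
qed

section \<open>Decorrelation against products of Lipschitz observables\<close>
locale invariant_system = prob_space \<mu>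
  for \<mu> :: "'a::{metric_space, second_countable_topology} measure" +
  fixes T :: "'a \<Rightarrow> 'a"
  assumes sets_eq [measurable_cong]: "sets \<mu> = sets borel"
    and T_measurable [measurable]: "T \<in> measurable \<mu> \<mu>"
    and T_invariant: "distr \<mu> \<mu> T = \<mu>"
begin

lemma space_eq [simp]: "space \<mu> = UNIV"
  using sets_eq_imp_space_eq[OF sets_eq] by simp

lemma iterate_measurable [measurable]: "T ^^ k \<in> measurable \<mu> \<mu>"
  by (induction k) auto

lemma iterate_invariant: "distr \<mu> \<mu> (T ^^ k) = \<mu>"
proof (induction k)
  case 0
  show ?case by (simp add: distr_id2)
next
  case (Suc k)
  have "distr \<mu> \<mu> (T ^^ Suc k) = distr \<mu> \<mu> (T \<circ> T ^^ k)" by (simp only: funpow.simps)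
  also have "\<dots> = distr (distr \<mu> \<mu> (T ^^ k)) \<mu> T" by (subst distr_distr) auto
  also have "\<dots> = \<mu>" by (simp only: Suc T_invariant)
  finally show ?case .
qed

lemma integral_iterate:
  fixes f :: "'a \<Rightarrow> 'b::{banach, second_countable_topology}"
  assumes [measurable]: "f \<in> borel_measurable \<mu>"
  shows "(LINT x|\<mu>. f ((T ^^ k) x)) = (LINT x|\<mu>. f x)"
  using integral_distr[OF iterate_measurable[of k] assms] by (simp add: iterate_invariant)

lemma integrable_bounded:
  fixes f :: "'a \<Rightarrow> 'b::{banach, second_countable_topology}"
  assumes "f \<in> borel_measurable \<mu>" "\<And>x. norm (f x) \<le> B"
  shows "integrable \<mu> f"
  using assms by (intro integrable_const_bound[where B = B]) auto

lemma norm_integral_le_AE: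
  fixes f :: "'a \<Rightarrow> 'b::{banach, second_countable_topology}"
  assumes "f \<in> borel_measurable \<mu>" "AE x in \<mu>. norm (f x) \<le> B"
  shows "norm (LINT x|\<mu>. f x) \<le> B"
proof -
  have int: "integrable \<mu> f" using assms by (intro integrable_const_bound[where B = B])
  have "norm (LINT x|\<mu>. f x) \<le> (LINT x|\<mu>. norm (f x))" by (rule integral_norm_bound)
  also have "\<dots> \<le> (LINT x|\<mu>. B)"
    by (intro integral_mono_AE) (use int assms in auto)
  finally show ?thesis by (simp add: prob_space[simplified])
qed

lemma norm_integral_le:
  fixes f :: "'a \<Rightarrow> 'b::{banach, second_countable_topology}"
  assumes "f \<in> borel_measurable \<mu>" "\<And>x. norm (f x) \<le> B"
  shows "norm (LINT x|\<mu>. f x) \<le> B"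
  using assms by (intro norm_integral_le_AE) auto

lemma integral_pair_measurable:
  fixes f :: "'a \<Rightarrow> 'a \<Rightarrow> 'b::{banach, second_countable_topology}"
  assumes "(\<lambda>p. f (fst p) (snd p)) \<in> borel_measurable (\<mu> \<Otimes>\<^sub>M \<mu>)"
  shows "(\<lambda>y. LINT x|\<mu>. f y x) \<in> borel_measurable \<mu>"
  using assms by (intro borel_measurable_lebesgue_integral) (simp add: case_prod_beta')

end

text \<open>
  The case of multiple decorrelation that the argument uses: exponent \<open>\<alpha> = 1\<close>, one observable at time 0
  and a product of observables at the consecutive times \<open>a, \<dots>, b\<close>, all bounded by 1. The
  polynomial is replaced by a multiple of a single power.
\<close>
locale decorrelating_system = invariant_system \<mu> T
  for \<mu> :: "'a::{metric_space, second_countable_topology} measure" and T +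
  fixes D d \<tau> :: real
  assumes \<tau>_pos: "\<tau> > 0" and D_nonneg: "D \<ge> 0" and d_nonneg: "d \<ge> 0"
    and decorrelation: "\<And>f h L\<^sub>f L a b. \<lbrakk>a \<le> b; \<And>x. cmod (f x) \<le> 1; L\<^sub>f-lipschitz_on UNIV f;
        \<And>k x. k \<in> {a..b} \<Longrightarrow> cmod (h k x) \<le> 1; \<And>k. k \<in> {a..b} \<Longrightarrow> L-lipschitz_on UNIV (h k)\<rbrakk> \<Longrightarrow>
      cmod (Cov \<mu> f (\<lambda>x. \<Prod>k=a..b. h k ((T ^^ k) x)))
        \<le> (1 + L\<^sub>f + real (b + 1 - a) * L) * (D * (1 + real b) powr d) * exp (- \<tau> * real a)"

lemma poly_le_power_bound:
  fixes P :: "real poly"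
  assumes "\<And>i. coeff P i \<ge> 0" "x \<ge> 0"
  shows "poly P x \<le> (\<Sum>i\<le>degree P. coeff P i) * (1 + x) ^ degree P"
proof -
  have "poly P x = (\<Sum>i\<le>degree P. coeff P i * x ^ i)" by (simp add: poly_altdef)
  also have "\<dots> \<le> (\<Sum>i\<le>degree P. coeff P i * (1 + x) ^ degree P)"
  proof (intro sum_mono mult_left_mono assms)
    fix i assume "i \<in> {..degree P}"
    then have "x ^ i \<le> (1 + x) ^ i" "(1 + x) ^ i \<le> (1 + x) ^ degree P"
      using assms by (auto intro!: power_mono power_increasing)
    then show "x ^ i \<le> (1 + x) ^ degree P" by linarith
  qed
  finally show ?thesis by (simp add: sum_distrib_right)
qed

text \<open>
  On a one-point space the Hoelder seminorm would be the supremum of the empty set, about which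
  nothing is known.
\<close>
lemma non_atomic_two_points:
  assumes "prob_space \<mu>" "non_atomic \<mu>"
  shows "\<exists>x y. x \<in> space \<mu> \<and> y \<in> space \<mu> \<and> x \<noteq> y"
proof (rule ccontr)
  assume *: "\<not> ?thesis"
  interpret prob_space \<mu> by fact
  have "emeasure \<mu> (space \<mu>) > 0" by (simp add: emeasure_space_1)
  then obtain S where S: "S \<in> sets \<mu>" "0 < emeasure \<mu> S" "emeasure \<mu> S < emeasure \<mu> (space \<mu>)"
    using assms(2) sets.top[of \<mu>] unfolding non_atomic_def by blast
  have "S \<subseteq> space \<mu>" using S(1) sets.sets_into_space by blast
  moreover have "S \<noteq> {}" using S(2) by auto
  ultimately have "S = space \<mu>" using * by blast
  then show False using S(3) by simp
qed

text \<open>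
  Apply multiple decorrelation with \<open>m\<^sub>1 = 1\<close>, \<open>k\<^sub>1 = 0\<close>, \<open>N = a\<close> and \<open>l\<^sub>j = j - 1\<close>; since all sup norms
  are at most 1, the prefactor is at most 1 plus the sum of the Lipschitz constants.
\<close>
lemma decorrelating_systemI:
  fixes \<mu> :: "'a::{metric_space, second_countable_topology} measure"
  assumes sys: "measure_preserving_system \<mu> T" and dec: "multiple_decorrelation \<mu> T"
  shows "\<exists>D d \<tau>. decorrelating_system \<mu> T D d \<tau>"
proof -
  interpret invariant_system \<mu> T
    using sys unfolding measure_preserving_system_def invariant_system_def invariant_system_axioms_def by blast
  obtain p q :: 'a where pq: "p \<noteq> q"
    using non_atomic_two_points[of \<mu>] sys unfolding measure_preserving_system_def by blast
  have unit: "(0::real) < 1 \<and> (1::real) \<le> 1" by simp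
  obtain r \<tau> :: real and P :: "real poly" where \<tau>: "\<tau> > 0" and P: "\<forall>i. coeff P i \<ge> 0"
    and dec: "\<forall>(m1::nat) (m2::nat) (N::nat) (k::nat \<Rightarrow> nat) (l::nat \<Rightarrow> nat) (\<phi>::nat \<Rightarrow> 'a \<Rightarrow> complex).
            mono_on {1..m1} k \<and> mono_on {1..m2} l \<and> (\<forall>i\<in>{1..m1+m2}. \<phi> i \<in> hoelder 1) \<longrightarrow>
            cmod (Cov \<mu> (\<lambda>x. \<Prod>i=1..m1. \<phi> i ((T ^^ k i) x))
                        (\<lambda>x. \<Prod>j=1..m2. \<phi> (m1 + j) ((T ^^ (N + l j)) x)))
            \<le> ((\<Prod>i=1..m1+m2. sup_norm (\<phi> i)) +
                (\<Sum>i=1..m1+m2. hoelder_seminorm 1 (\<phi> i) * (\<Prod>j\<in>{1..m1+m2} - {i}. sup_norm (\<phi> j))))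
              * poly P (real (l m2)) * exp (- \<tau> * (real N - r * real (k m1)))"
    using dec[unfolded multiple_decorrelation_def, THEN spec[of _ 1], THEN mp, OF unit]
    by (elim exE conjE) (rule that)
  note P = P[rule_format] and dec = dec[rule_format]
  define D where "D = (\<Sum>i\<le>degree P. coeff P i)"
  have D: "D \<ge> 0" unfolding D_def using P by (intro sum_nonneg) auto
  have sup: "0 \<le> sup_norm f \<and> sup_norm f \<le> 1" if "\<And>x. cmod (f x) \<le> 1" for f :: "'a \<Rightarrow> complex"
  proof
    show "sup_norm f \<le> 1" unfolding sup_norm_def using that by (intro cSUP_least) auto
    have "cmod (f p) \<le> sup_norm f"
      unfolding sup_norm_def by (rule cSUP_upper) (use that in \<open>auto intro!: bdd_aboveI[of _ 1]\<close>)
    then show "0 \<le> sup_norm f" using norm_ge_zero order_trans by blast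
  qed
  have holder: "f \<in> hoelder 1 \<and> 0 \<le> hoelder_seminorm 1 f \<and> hoelder_seminorm 1 f \<le> L"
    if f: "L-lipschitz_on UNIV f" for f :: "'a \<Rightarrow> complex" and L
  proof -
    have le: "cmod (f x - f y) \<le> L * dist x y" for x y
      using lipschitz_onD[OF f, of x y] by (simp add: dist_norm)
    have quot: "cmod (f x - f y) / dist x y powr 1 \<le> L" if "x \<noteq> y" for x y
      using le[of x y] that by (simp add: divide_simps)
    let ?Q = "{cmod (f x - f y) / dist x y powr 1 |x y. x \<noteq> y}"
    have mem: "cmod (f p - f q) / dist p q powr 1 \<in> ?Q" using pq by blast
    have "bdd_above ?Q" using quot by (intro bdd_aboveI[of _ L]) blast
    from cSup_upper[OF mem this] have "0 \<le> hoelder_seminorm 1 f"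
      unfolding hoelder_seminorm_def by (rule order_trans[rotated]) simp
    moreover have "hoelder_seminorm 1 f \<le> L"
      unfolding hoelder_seminorm_def using mem quot by (intro cSup_least) blast+
    moreover have "f \<in> hoelder 1" unfolding hoelder_def using le by (auto intro!: exI[of _ L])
    ultimately show ?thesis by blast
  qed
  have "cmod (Cov \<mu> f (\<lambda>x. \<Prod>k=a..b. h k ((T ^^ k) x)))
        \<le> (1 + L\<^sub>f + real (b + 1 - a) * L) * (D * (1 + real b) powr real (degree P)) * exp (- \<tau> * real a)"
    if ab: "a \<le> b" and f: "\<And>x. cmod (f x) \<le> 1" "L\<^sub>f-lipschitz_on UNIV f"
      and h: "\<And>k x. k \<in> {a..b} \<Longrightarrow> cmod (h k x) \<le> 1" "\<And>k. k \<in> {a..b} \<Longrightarrow> L-lipschitz_on UNIV (h k)"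
    for f h L\<^sub>f L a b
  proof -
    define m where "m = b + 1 - a"
    define \<phi> where "\<phi> i = (if i = 1 then f else h (a + i - 2))" for i :: nat
    have Lf: "L\<^sub>f \<ge> 0" using f(2) lipschitz_on_nonneg by blast
    have L: "L \<ge> 0" using h(2)[of a] ab lipschitz_on_nonneg by auto
    have idx: "i = 1 \<or> (i \<noteq> 1 \<and> a + i - 2 \<in> {a..b})" if "i \<in> {1..1+m}" for i
      using that ab by (auto simp: m_def)
    have \<phi>_sup: "0 \<le> sup_norm (\<phi> i) \<and> sup_norm (\<phi> i) \<le> 1" if "i \<in> {1..1+m}" for i
      using idx[OF that] f(1) h(1) by (auto simp: \<phi>_def intro!: sup)
    have \<phi>_lip: "(if i = 1 then L\<^sub>f else L)-lipschitz_on UNIV (\<phi> i)" if "i \<in> {1..1+m}" for i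
      using idx[OF that] f(2) h(2) by (auto simp: \<phi>_def)
    have mono: "mono_on {1..1} (\<lambda>_. 0::nat)" "mono_on {1..m} (\<lambda>j. j - 1::nat)"
      by (auto simp: mono_on_def)
    have "(\<Prod>j=1..m. \<phi> (1 + j) ((T ^^ (a + (j - 1))) x)) = (\<Prod>k=a..b. h k ((T ^^ k) x))" for x
      by (rule prod.reindex_bij_witness[where i = "\<lambda>k. k + 1 - a" and j = "\<lambda>j. a + (j - 1)"])
         (auto simp: m_def \<phi>_def)
    then have eq: "Cov \<mu> f (\<lambda>x. \<Prod>k=a..b. h k ((T ^^ k) x)) =
        Cov \<mu> (\<lambda>x. \<Prod>i=1..1. \<phi> i ((T ^^ 0) x)) (\<lambda>x. \<Prod>j=1..m. \<phi> (1 + j) ((T ^^ (a + (j - 1))) x))"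
      by (simp add: \<phi>_def)
    have prod1: "(\<Prod>j\<in>J. sup_norm (\<phi> j)) \<le> 1 \<and> 0 \<le> (\<Prod>j\<in>J. sup_norm (\<phi> j))" if "J \<subseteq> {1..1+m}" for J
      using \<phi>_sup that by (auto intro!: prod_le_1 prod_nonneg)
    have "(\<Sum>i=1..1+m. hoelder_seminorm 1 (\<phi> i) * (\<Prod>j\<in>{1..1+m} - {i}. sup_norm (\<phi> j)))
        \<le> (\<Sum>i=1..1+m. (if i = 1 then L\<^sub>f else L) * 1)"
      using holder[OF \<phi>_lip] prod1 L Lf by (intro sum_mono mult_mono) auto
    also have "\<dots> = L\<^sub>f + real m * L"
    proof -
      have "{1..1+m} = insert 1 {2..1+m}" by auto
      moreover have "(\<Sum>i\<in>{2..1+m}. if i = 1 then L\<^sub>f else L) = (\<Sum>i\<in>{2..1+m}. L)"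
        by (intro sum.cong) auto
      ultimately show ?thesis by simp
    qed
    finally have S: "(\<Sum>i=1..1+m. hoelder_seminorm 1 (\<phi> i) * (\<Prod>j\<in>{1..1+m} - {i}. sup_norm (\<phi> j)))
        \<le> L\<^sub>f + real m * L" .
    have poly: "poly P (real (m - 1)) \<le> D * (1 + real b) powr real (degree P)"
    proof -
      have "poly P (real (m - 1)) \<le> D * (1 + real (m - 1)) ^ degree P"
        unfolding D_def by (rule poly_le_power_bound[OF P]) simp
      also have "\<dots> \<le> D * (1 + real b) ^ degree P"
        using D by (intro mult_left_mono power_mono) (auto simp: m_def)
      finally show ?thesis by (simp add: powr_realpow)
    qed
    have "poly P (real (m - 1)) \<ge> 0"
      unfolding poly_altdef using P by (intro sum_nonneg) auto
    then have "((\<Prod>i=1..1+m. sup_norm (\<phi> i)) +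
                (\<Sum>i=1..1+m. hoelder_seminorm 1 (\<phi> i) * (\<Prod>j\<in>{1..1+m} - {i}. sup_norm (\<phi> j))))
              * poly P (real (m - 1)) * exp (- \<tau> * (real a - r * real 0))
        \<le> (1 + (L\<^sub>f + real m * L)) * (D * (1 + real b) powr real (degree P)) * exp (- \<tau> * real a)"
      using S prod1[of "{1..1+m}"] poly L Lf by (intro mult_mono add_mono) auto
    moreover have "\<forall>i\<in>{1..1+m}. \<phi> i \<in> hoelder 1" using holder[OF \<phi>_lip] by blast
    then have "cmod (Cov \<mu> f (\<lambda>x. \<Prod>k=a..b. h k ((T ^^ k) x))) \<le> ((\<Prod>i=1..1+m. sup_norm (\<phi> i)) +
                (\<Sum>i=1..1+m. hoelder_seminorm 1 (\<phi> i) * (\<Prod>j\<in>{1..1+m} - {i}. sup_norm (\<phi> j))))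
              * poly P (real (m - 1)) * exp (- \<tau> * (real a - r * real 0))"
      unfolding eq using mono by (intro dec conjI)
    ultimately show ?thesis unfolding m_def[symmetric] add.assoc by (rule order_trans[rotated])
  qed
  then have "decorrelating_system \<mu> T D (real (degree P)) \<tau>"
    using \<tau> D by unfold_locales auto
  then show ?thesis by blast
qed

definition ramp :: "real \<Rightarrow> real" where "ramp s = max 0 (min 1 s)"

lemma ramp_bounds [simp]: "0 \<le> ramp s" "ramp s \<le> 1"
  by (auto simp: ramp_def)

lemma ramp_eq_0 [simp]: "s \<le> 0 \<Longrightarrow> ramp s = 0" and ramp_eq_1 [simp]: "s \<ge> 1 \<Longrightarrow> ramp s = 1"
  by (auto simp: ramp_def)

lemma ramp_diff_le: "\<bar>ramp s - ramp t\<bar> \<le> \<bar>s - t\<bar>"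
  by (auto simp: ramp_def)

text \<open>
  Normalise the bumps \<open>b\<^sub>w\<close> that are 1 on \<open>B(w, \<eta>)\<close> and vanish outside \<open>B(w, 2\<eta>)\<close>. Their sum
  is at least 1 because the \<open>B(w, \<eta>)\<close> cover, so that the quotients inherit a Lipschitz constant
  that is linear in the number of bumps.
\<close>
lemma lipschitz_partition_of_unity:
  fixes F :: "'a::metric_space set"
  assumes F: "finite F" and net: "\<And>x. \<exists>w\<in>F. dist x w < \<eta>" and \<eta>: "\<eta> > 0"
  obtains \<psi> :: "'a \<Rightarrow> 'a \<Rightarrow> real" where "\<And>w x. w \<in> F \<Longrightarrow> 0 \<le> \<psi> w x \<and> \<psi> w x \<le> 1"
    "\<And>x. (\<Sum>w\<in>F. \<psi> w x) = 1" "\<And>w x. \<psi> w x \<noteq> 0 \<Longrightarrow> dist x w < 2 * \<eta>"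
    "\<And>w. w \<in> F \<Longrightarrow> ((1 + real (card F)) / \<eta>)-lipschitz_on UNIV (\<psi> w)"
proof -
  define b where "b w x = ramp (2 - dist x w / \<eta>)" for w x :: 'a
  define S where "S x = (\<Sum>w\<in>F. b w x)" for x
  define \<psi> where "\<psi> w x = b w x / S x" for w x
  have b01: "0 \<le> b w x" "b w x \<le> 1" for w x by (auto simp: b_def)
  have b_lip: "\<bar>b w x - b w y\<bar> \<le> dist x y / \<eta>" for w x y
  proof -
    have "\<bar>b w x - b w y\<bar> \<le> \<bar>dist y w / \<eta> - dist x w / \<eta>\<bar>"
      unfolding b_def by (rule order_trans[OF ramp_diff_le]) simp
    also have "\<dots> = \<bar>dist y w - dist x w\<bar> / \<eta>" using \<eta> by (simp add: diff_divide_distrib[symmetric])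
    also have "\<dots> \<le> dist x y / \<eta>"
      using \<eta> abs_dist_diff_le[of y w x] by (intro divide_right_mono) (auto simp: dist_commute)
    finally show ?thesis .
  qed
  have S1: "S x \<ge> 1" for x
  proof -
    obtain w where w: "w \<in> F" "dist x w < \<eta>" using net by blast
    have "b w x = 1" unfolding b_def using w \<eta> by (intro ramp_eq_1) (simp add: field_simps)
    moreover have "b w x \<le> S x" unfolding S_def using w b01 F by (intro member_le_sum) auto
    ultimately show ?thesis by simp
  qed
  have S_lip: "\<bar>S x - S y\<bar> \<le> real (card F) * (dist x y / \<eta>)" for x y
  proof -
    have "\<bar>S x - S y\<bar> \<le> (\<Sum>w\<in>F. \<bar>b w x - b w y\<bar>)"
      unfolding S_def sum_subtractf[symmetric] by (rule sum_abs)
    also have "\<dots> \<le> (\<Sum>w\<in>F. dist x y / \<eta>)" by (intro sum_mono b_lip)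
    finally show ?thesis by simp
  qed
  have bS: "b w x \<le> S x" if "w \<in> F" for w x
    unfolding S_def using that b01 F by (intro member_le_sum) auto
  have \<psi>01: "0 \<le> \<psi> w x \<and> \<psi> w x \<le> 1" if "w \<in> F" for w x
    using bS[OF that, of x] b01[of w x] S1[of x] by (auto simp: \<psi>_def divide_simps)
  have \<psi>_lip: "\<bar>\<psi> w x - \<psi> w y\<bar> \<le> (1 + real (card F)) / \<eta> * dist x y" if w: "w \<in> F" for w x y
  proof -
    have Sx: "S x > 0" and Sy: "S y > 0" using S1[of x] S1[of y] by linarith+
    have "\<psi> w x - \<psi> w y = ((b w x - b w y) + \<psi> w y * (S y - S x)) / S x"
      using Sx Sy by (simp add: \<psi>_def field_simps)
    then have "\<bar>\<psi> w x - \<psi> w y\<bar> = \<bar>(b w x - b w y) + \<psi> w y * (S y - S x)\<bar> / S x"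
      using Sx by (simp add: abs_divide)
    also have "\<dots> \<le> \<bar>(b w x - b w y) + \<psi> w y * (S y - S x)\<bar> / 1"
      using S1[of x] by (intro divide_left_mono) auto
    also have "\<dots> \<le> \<bar>b w x - b w y\<bar> + \<bar>\<psi> w y * (S y - S x)\<bar>" by simp
    also have "\<bar>\<psi> w y * (S y - S x)\<bar> \<le> 1 * \<bar>S y - S x\<bar>"
      unfolding abs_mult using \<psi>01[OF w] by (intro mult_right_mono) auto
    also have "\<bar>b w x - b w y\<bar> + 1 * \<bar>S y - S x\<bar> \<le> dist x y / \<eta> + real (card F) * (dist x y / \<eta>)"
      using b_lip[of w x y] S_lip[of y x] by (simp add: dist_commute)
    finally show ?thesis by (simp add: algebra_simps add_divide_distrib)
  qed
  show ?thesis
  proof (rule that[of \<psi>])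
    show "(\<Sum>w\<in>F. \<psi> w x) = 1" for x
      using S1[of x] unfolding \<psi>_def sum_divide_distrib[symmetric] S_def[symmetric] by simp
    show "dist x w < 2 * \<eta>" if "\<psi> w x \<noteq> 0" for w x
    proof (rule ccontr)
      assume "\<not> ?thesis"
      then have "b w x = 0" unfolding b_def using \<eta> by (intro ramp_eq_0) (simp add: field_simps)
      then show False using that by (simp add: \<psi>_def)
    qed
    show "((1 + real (card F)) / \<eta>)-lipschitz_on UNIV (\<psi> w)" if "w \<in> F" for w
      using \<psi>_lip[OF that] \<eta> by (intro lipschitz_onI) (auto simp: dist_real_def)
  qed (use \<psi>01 in auto)
qed

context decorrelating_system
begin

text \<open>
  Freezing the first variable at the centre \<open>w\<close> of a piece costs at most \<open>2\<eta>\<close> times the Lipschitz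
  constant of the product; this is paid once on the diagonal and once in the double
  integral. In between, each of the pieces costs one use of decorrelation, with the weight of the
  piece as the observable at time 0.
\<close>
lemma decoupling:
  fixes F :: "'a set" and h :: "nat \<Rightarrow> 'a \<Rightarrow> 'a \<Rightarrow> complex"
  assumes F: "finite F" and net: "\<And>x. \<exists>w\<in>F. dist x w < \<eta>" and \<eta>: "\<eta> > 0" and ab: "a \<le> b"
    and h1: "\<And>k y z. k \<in> {a..b} \<Longrightarrow> cmod (h k y z) \<le> 1"
    and hy: "\<And>k z. k \<in> {a..b} \<Longrightarrow> L-lipschitz_on UNIV (\<lambda>y. h k y z)"
    and hz: "\<And>k y. k \<in> {a..b} \<Longrightarrow> L-lipschitz_on UNIV (h k y)"
  shows "cmod ((LINT x|\<mu>. (\<Prod>k=a..b. h k x ((T ^^ k) x)))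
             - (LINT y|\<mu>. LINT x|\<mu>. (\<Prod>k=a..b. h k y ((T ^^ k) x))))
    \<le> 4 * \<eta> * (real (b + 1 - a) * L)
      + real (card F) * ((1 + (1 + real (card F)) / \<eta> + real (b + 1 - a) * L)
          * (D * (1 + real b) powr d) * exp (- \<tau> * real a))"
proof -
  obtain \<psi> :: "'a \<Rightarrow> 'a \<Rightarrow> real" where \<psi>01: "\<And>w x. w \<in> F \<Longrightarrow> 0 \<le> \<psi> w x \<and> \<psi> w x \<le> 1"
    and \<psi>_sum: "\<And>x. (\<Sum>w\<in>F. \<psi> w x) = 1" and \<psi>_supp: "\<And>w x. \<psi> w x \<noteq> 0 \<Longrightarrow> dist x w < 2 * \<eta>"
    and \<psi>_lip: "\<And>w. w \<in> F \<Longrightarrow> ((1 + real (card F)) / \<eta>)-lipschitz_on UNIV (\<psi> w)"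
    using lipschitz_partition_of_unity[OF F net \<eta>] by blast
  define H where "H y x = (\<Prod>k=a..b. h k y ((T ^^ k) x))" for y x
  define I where "I y = (LINT x|\<mu>. H y x)" for y
  define c where "c = real (b + 1 - a) * L"
  have L: "L \<ge> 0" using hz[of a] ab lipschitz_on_nonneg by auto
  have c: "c \<ge> 0" using L by (simp add: c_def)
  have h_cont: "continuous_on UNIV (\<lambda>p. h k (fst p) (snd p))" if k: "k \<in> {a..b}" for k
  proof -
    have "(2 * L)-lipschitz_on UNIV (\<lambda>p. h k (fst p) (snd p))"
    proof (rule lipschitz_onI)
      fix p p' :: "'a \<times> 'a"
      have "dist (h k (fst p) (snd p)) (h k (fst p') (snd p'))
          \<le> dist (h k (fst p) (snd p)) (h k (fst p') (snd p)) + dist (h k (fst p') (snd p)) (h k (fst p') (snd p'))"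
        by (rule dist_triangle)
      also have "\<dots> \<le> L * dist (fst p) (fst p') + L * dist (snd p) (snd p')"
        using lipschitz_onD[OF hy[OF k]] lipschitz_onD[OF hz[OF k]] by (intro add_mono) auto
      also have "\<dots> \<le> L * dist p p' + L * dist p p'"
        using L by (intro add_mono mult_left_mono dist_fst_le dist_snd_le)
      finally show "dist (h k (fst p) (snd p)) (h k (fst p') (snd p')) \<le> 2 * L * dist p p'" by simp
    qed (use L in simp)
    then show ?thesis by (rule lipschitz_on_continuous_on)
  qed
  have h_meas: "(\<lambda>x. h k (f x) (g x)) \<in> borel_measurable \<mu>"
    if "k \<in> {a..b}" "f \<in> measurable \<mu> borel" "g \<in> measurable \<mu> borel" for f g k
    by (rule borel_measurable_continuous_Pair[OF that(2,3) h_cont[OF that(1)]])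
  have iter [measurable]: "(T ^^ k) \<in> measurable \<mu> borel" for k
    using iterate_measurable[of k] by (simp add: measurable_cong_sets[OF refl sets_eq])
  have idm: "(\<lambda>x. x) \<in> measurable \<mu> borel"
    by (simp add: measurable_cong_sets[OF sets_eq refl])
  have H_meas [measurable]: "H y \<in> borel_measurable \<mu>" for y
    unfolding H_def by (intro borel_measurable_prod h_meas iter) simp_all
  have Hd_meas [measurable]: "(\<lambda>x. H x x) \<in> borel_measurable \<mu>"
    unfolding H_def by (intro borel_measurable_prod h_meas iter idm)
  have H1: "cmod (H y x) \<le> 1" for y x
    unfolding H_def prod_norm[symmetric] by (intro prod_le_1) (auto simp: h1)
  have H_diff: "cmod (H y x - H y' x) \<le> c * dist y y'" for y y' x
  proof -
    have "cmod (H y x - H y' x) \<le> (\<Sum>k=a..b. cmod (h k y ((T ^^ k) x) - h k y' ((T ^^ k) x)))"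
      unfolding H_def by (intro norm_prod_diff h1)
    also have "\<dots> \<le> (\<Sum>k=a..b. L * dist y y')"
      using lipschitz_onD[OF hy] by (intro sum_mono) (auto simp: dist_norm)
    finally show ?thesis by (simp add: c_def)
  qed
  have H_int: "integrable \<mu> (H y)" for y by (rule integrable_bounded[OF H_meas H1])
  have I_diff: "cmod (I y - I y') \<le> c * dist y y'" for y y'
  proof -
    have "I y - I y' = (LINT x|\<mu>. H y x - H y' x)" unfolding I_def using H_int by simp
    also have "cmod \<dots> \<le> c * dist y y'" by (rule norm_integral_le) (auto simp: H_diff)
    finally show ?thesis .
  qed
  have I1: "cmod (I y) \<le> 1" for y unfolding I_def by (rule norm_integral_le[OF H_meas H1])
  have "c-lipschitz_on UNIV I" using I_diff c by (intro lipschitz_onI) (auto simp: dist_norm)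
  then have I_meas [measurable]: "I \<in> borel_measurable \<mu>"
    using borel_measurable_continuous_onI[OF lipschitz_on_continuous_on]
    by (simp add: measurable_cong_sets[OF sets_eq refl])
  have \<psi>_meas: "(\<lambda>x. complex_of_real (\<psi> w x)) \<in> borel_measurable \<mu>" if "w \<in> F" for w
  proof -
    have "\<psi> w \<in> borel_measurable borel"
      using borel_measurable_continuous_onI[OF lipschitz_on_continuous_on[OF \<psi>_lip[OF that]]] .
    then have "\<psi> w \<in> borel_measurable \<mu>" by (simp add: measurable_cong_sets[OF sets_eq refl])
    then show ?thesis by measurable
  qed
  have loc: "cmod (\<Sum>w\<in>F. of_real (\<psi> w x) * (G x - G' w)) \<le> c * (2 * \<eta>)"
    if "\<And>w. cmod (G x - G' w) \<le> c * dist x w" for x and G G' :: "'a \<Rightarrow> complex"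
  proof -
    have "cmod (\<Sum>w\<in>F. of_real (\<psi> w x) * (G x - G' w)) \<le> (\<Sum>w\<in>F. \<psi> w x * (c * (2 * \<eta>)))"
    proof (rule order_trans[OF norm_sum sum_mono])
      fix w assume w: "w \<in> F"
      show "cmod (of_real (\<psi> w x) * (G x - G' w)) \<le> \<psi> w x * (c * (2 * \<eta>))"
      proof (cases "\<psi> w x = 0")
        case False
        have "cmod (G x - G' w) \<le> c * (2 * \<eta>)"
          by (rule order_trans[OF that]) (use \<psi>_supp[OF False] c in \<open>intro mult_left_mono, auto\<close>)
        then show ?thesis using \<psi>01[OF w, of x] by (auto simp: norm_mult intro!: mult_left_mono)
      qed simp
    qed
    also have "\<dots> = c * (2 * \<eta>)" using \<psi>_sum[of x] by (simp add: sum_distrib_right[symmetric])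
    finally show ?thesis .
  qed
  have int1: "integrable \<mu> (\<lambda>x. of_real (\<psi> w x) * G x)"
    if "w \<in> F" "G \<in> borel_measurable \<mu>" "\<And>x. cmod (G x) \<le> B" for w B and G :: "'a \<Rightarrow> complex"
  proof (rule integrable_bounded)
    show "(\<lambda>x. of_real (\<psi> w x) * G x) \<in> borel_measurable \<mu>"
      using \<psi>_meas[OF that(1)] that(2) by measurable
    show "cmod (of_real (\<psi> w x) * G x) \<le> B" for x
      using \<psi>01[OF that(1), of x] that(3)[of x] mult_mono[of "\<psi> w x" 1 "cmod (G x)" B]
      by (auto simp: norm_mult)
  qed
  have dd: "(\<Sum>w\<in>F. of_real (\<psi> w x) * G x) = G x" for x and G :: "'a \<Rightarrow> complex"
    unfolding sum_distrib_right[symmetric] of_real_sum[symmetric] \<psi>_sum by simp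
  have e1: "cmod ((LINT x|\<mu>. H x x) - (\<Sum>w\<in>F. LINT x|\<mu>. of_real (\<psi> w x) * H w x)) \<le> c * (2 * \<eta>)"
  proof -
    have "(LINT x|\<mu>. H x x) - (\<Sum>w\<in>F. LINT x|\<mu>. of_real (\<psi> w x) * H w x)
        = (LINT x|\<mu>. (\<Sum>w\<in>F. of_real (\<psi> w x) * H x x)) - (LINT x|\<mu>. (\<Sum>w\<in>F. of_real (\<psi> w x) * H w x))"
      using int1[OF _ H_meas H1] by (subst (2) Bochner_Integration.integral_sum) (auto simp: dd)
    also have "\<dots> = (LINT x|\<mu>. (\<Sum>w\<in>F. of_real (\<psi> w x) * (H x x - H w x)))"
      using int1[OF _ H_meas H1] int1[OF _ Hd_meas H1]
      by (subst Bochner_Integration.integral_diff[symmetric]) (auto simp: sum_subtractf right_diff_distrib)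
    also have "cmod \<dots> \<le> c * (2 * \<eta>)"
    proof (rule norm_integral_le)
      show "(\<lambda>x. \<Sum>w\<in>F. of_real (\<psi> w x) * (H x x - H w x)) \<in> borel_measurable \<mu>"
        using \<psi>_meas by (intro borel_measurable_sum borel_measurable_times borel_measurable_diff) auto
      show "cmod (\<Sum>w\<in>F. of_real (\<psi> w x) * (H x x - H w x)) \<le> c * (2 * \<eta>)" for x
        by (rule loc[of "\<lambda>_. H x x" x "\<lambda>w. H w x"]) (rule H_diff)
    qed
    finally show ?thesis .
  qed
  have e2: "cmod ((\<Sum>w\<in>F. LINT x|\<mu>. of_real (\<psi> w x) * I w) - (LINT x|\<mu>. I x)) \<le> c * (2 * \<eta>)"
  proof -
    have cI: "(\<lambda>x. I w) \<in> borel_measurable \<mu>" for w by simp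
    have "(LINT x|\<mu>. I x) - (\<Sum>w\<in>F. LINT x|\<mu>. of_real (\<psi> w x) * I w)
        = (LINT x|\<mu>. (\<Sum>w\<in>F. of_real (\<psi> w x) * I x)) - (LINT x|\<mu>. (\<Sum>w\<in>F. of_real (\<psi> w x) * I w))"
      using int1[OF _ cI I1] by (subst (2) Bochner_Integration.integral_sum) (auto simp: dd)
    also have "\<dots> = (LINT x|\<mu>. (\<Sum>w\<in>F. of_real (\<psi> w x) * (I x - I w)))"
      using int1[OF _ cI I1] int1[OF _ I_meas I1]
      by (subst Bochner_Integration.integral_diff[symmetric]) (auto simp: sum_subtractf right_diff_distrib)
    also have "cmod \<dots> \<le> c * (2 * \<eta>)"
    proof (rule norm_integral_le)
      show "(\<lambda>x. \<Sum>w\<in>F. of_real (\<psi> w x) * (I x - I w)) \<in> borel_measurable \<mu>"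
        using \<psi>_meas by (intro borel_measurable_sum borel_measurable_times borel_measurable_diff) auto
      show "cmod (\<Sum>w\<in>F. of_real (\<psi> w x) * (I x - I w)) \<le> c * (2 * \<eta>)" for x
        by (rule loc[of I x I]) (rule I_diff)
    qed
    finally show ?thesis by (simp add: norm_minus_commute)
  qed
  let ?E = "(1 + (1 + real (card F)) / \<eta> + c) * (D * (1 + real b) powr d) * exp (- \<tau> * real a)"
  have e3: "cmod ((LINT x|\<mu>. of_real (\<psi> w x) * H w x) - (LINT x|\<mu>. of_real (\<psi> w x) * I w)) \<le> ?E"
    if w: "w \<in> F" for w
  proof -
    have "cmod (Cov \<mu> (\<lambda>x. complex_of_real (\<psi> w x)) (\<lambda>x. \<Prod>k=a..b. h k w ((T ^^ k) x))) \<le> ?E"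
      unfolding c_def
    proof (rule decorrelation[OF ab])
      show "cmod (complex_of_real (\<psi> w x)) \<le> 1" for x using \<psi>01[OF w, of x] by simp
      show "((1 + real (card F)) / \<eta>)-lipschitz_on UNIV (\<lambda>x. complex_of_real (\<psi> w x))"
        using \<psi>_lip[OF w] unfolding lipschitz_on_def by simp
    qed (use h1 hz in auto)
    then show ?thesis
      using int1[OF w _ ] by (simp add: Cov_def H_def[symmetric] I_def[symmetric])
  qed
  have "cmod ((\<Sum>w\<in>F. LINT x|\<mu>. of_real (\<psi> w x) * H w x) - (\<Sum>w\<in>F. LINT x|\<mu>. of_real (\<psi> w x) * I w))
      \<le> (\<Sum>w\<in>F. ?E)"
    unfolding sum_subtractf[symmetric] by (rule order_trans[OF norm_sum sum_mono]) (rule e3)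
  then have e3': "cmod ((\<Sum>w\<in>F. LINT x|\<mu>. of_real (\<psi> w x) * H w x) - (\<Sum>w\<in>F. LINT x|\<mu>. of_real (\<psi> w x) * I w))
      \<le> real (card F) * ?E" by simp
  have "cmod ((LINT x|\<mu>. H x x) - (LINT x|\<mu>. I x)) \<le> 4 * \<eta> * c + real (card F) * ?E"
    using norm_triangle_ineq[of "(LINT x|\<mu>. H x x) - (\<Sum>w\<in>F. LINT x|\<mu>. of_real (\<psi> w x) * H w x)"
        "(\<Sum>w\<in>F. LINT x|\<mu>. of_real (\<psi> w x) * H w x) - (LINT x|\<mu>. I x)"]
      norm_triangle_ineq[of "(\<Sum>w\<in>F. LINT x|\<mu>. of_real (\<psi> w x) * H w x) - (\<Sum>w\<in>F. LINT x|\<mu>. of_real (\<psi> w x) * I w)"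
        "(\<Sum>w\<in>F. LINT x|\<mu>. of_real (\<psi> w x) * I w) - (LINT x|\<mu>. I x)"] e1 e2 e3'
    by (simp add: mult.commute)
  then show ?thesis unfolding H_def I_def c_def .
qed

end

section \<open>Radius functions and soft balls\<close>

text \<open>
  The hypotheses on \<open>\<mu>\<close> and \<open>M\<close> with their constants made explicit. Compactness of the space enters
  through the nets, which also yield its finite diameter and the finite cover in \<open>AE_small_radii\<close>.
\<close>
locale shrinking_targets = decorrelating_system \<mu> T D d \<tau>
  for \<mu> :: "'a::{metric_space, second_countable_topology} measure" and T and D d \<tau> :: real +
  fixes M :: "nat \<Rightarrow> real" and \<gamma> \<upsilon> C\<^sub>M s\<^sub>0 C\<^sub>F \<alpha>\<^sub>0 \<rho>\<^sub>0 C\<^sub>A C\<^sub>N q\<^sub>N :: real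
  assumes nets: "polynomial_nets TYPE('a) C\<^sub>N q\<^sub>N" "C\<^sub>N > 0" "q\<^sub>N \<ge> 0"
    and frostman: "s\<^sub>0 > 0" "C\<^sub>F > 0" "\<And>x r. r > 0 \<Longrightarrow> measure \<mu> (ball x r) \<le> C\<^sub>F * r powr s\<^sub>0"
    and thin_annuli: "\<alpha>\<^sub>0 > 0" "\<rho>\<^sub>0 > 0" "C\<^sub>A > 0"
      "\<And>x r \<epsilon>. 0 < \<epsilon> \<Longrightarrow> \<epsilon> \<le> r \<Longrightarrow> r \<le> \<rho>\<^sub>0 \<Longrightarrow>
         measure \<mu> (ball x (r + \<epsilon>) - ball x r) \<le> C\<^sub>A * \<epsilon> powr \<alpha>\<^sub>0"
    and exponents: "0 < \<gamma>" "\<gamma> < 1" "\<upsilon> > 1" "C\<^sub>M > 0"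
    and M_le_1: "\<And>n. n \<ge> 1 \<Longrightarrow> M n \<le> 1"
    and M_antimono: "\<And>j k. 1 \<le> j \<Longrightarrow> j \<le> k \<Longrightarrow> M k \<le> M j"
    and M_lower: "\<And>n. n \<ge> 1 \<Longrightarrow> inverse C\<^sub>M * real n powr (- \<gamma>) \<le> M n"
    and M_upper: "\<And>n. n \<ge> 2 \<Longrightarrow> M n \<le> C\<^sub>M * ln (real n) powr (- \<upsilon>)"
begin

abbreviation \<rho> :: "nat \<Rightarrow> 'a \<Rightarrow> real" where "\<rho> k y \<equiv> radius \<mu> M k y"

lemma M_pos: "n \<ge> 1 \<Longrightarrow> M n > 0"
  by (rule less_le_trans[OF _ M_lower]) (use exponents(4) in auto)

lemma ball_measurable [measurable]: "ball x r \<in> sets \<mu>"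
  by (simp add: sets_eq)

lemma measure_ball_mono: "r \<le> r' \<Longrightarrow> measure \<mu> (ball x r) \<le> measure \<mu> (ball x r')"
  by (intro finite_measure_mono subset_ball) auto

lemma bounded_diameter: "\<exists>R>0. \<forall>x y::'a. dist x y < R"
proof -
  obtain F :: "'a set" where F: "finite F" "\<And>x. \<exists>y\<in>F. dist x y < 1"
    using nets(1) unfolding polynomial_nets_def by (metis order_refl zero_less_one)
  obtain w where w: "w \<in> F" using F(2) by blast
  define R where "R = 1 + (\<Sum>v\<in>F. dist v w)"
  have "dist x w < R" for x :: 'a
  proof -
    obtain v where v: "v \<in> F" "dist x v < 1" using F(2) by blast
    have "dist v w \<le> (\<Sum>v\<in>F. dist v w)" using v F(1) by (intro member_le_sum) auto
    then show ?thesis using v dist_triangle[of x w v] by (simp add: R_def)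
  qed
  then have "dist x y < 2 * R" for x y :: 'a
    using dist_triangle2[of x y w] by (smt (verit))
  moreover have "2 * R > 0" unfolding R_def by (smt (verit) sum_nonneg zero_le_dist)
  ultimately show ?thesis by blast
qed

text \<open>
  The infimum that defines the radius is taken over a nonempty set; the value \<open>M 0\<close> is arbitrary, which is
  why the index is assumed to be positive here and below.
\<close>
lemma radius_set_nonempty:
  assumes "k \<ge> 1"
  shows "{r. r \<ge> 0 \<and> measure \<mu> (ball y r) \<ge> M k} \<noteq> {}"
proof -
  obtain R where R: "R > 0" "\<And>x y::'a. dist x y < R" using bounded_diameter by blast
  then have "ball y R = space \<mu>" by auto
  then have "measure \<mu> (ball y R) = 1" using prob_space by simp
  then show ?thesis using R M_le_1[OF assms] by (auto intro!: exI[of _ R])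
qed

lemma radius_le:
  assumes "r \<ge> 0" "measure \<mu> (ball y r) \<ge> M k"
  shows "\<rho> k y \<le> r"
  unfolding radius_def by (rule cInf_lower) (use assms in \<open>auto intro: bdd_belowI[of _ 0]\<close>)

lemma radius_nonneg: "k \<ge> 1 \<Longrightarrow> \<rho> k y \<ge> 0"
  unfolding radius_def by (intro cInf_greatest radius_set_nonempty) auto

lemma radius_less:
  assumes "k \<ge> 1" "\<rho> k y < r"
  shows "M k \<le> measure \<mu> (ball y r)"
proof -
  obtain r' where "r' \<ge> 0" "measure \<mu> (ball y r') \<ge> M k" "r' < r"
    using cInf_lessD[OF radius_set_nonempty[OF assms(1)] assms(2)[unfolded radius_def]] by blast
  then show ?thesis using measure_ball_mono[of r' r y] by linarith
qed

lemma radius_gt: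
  assumes "k \<ge> 1" "measure \<mu> (ball y r) < M k"
  shows "r \<le> \<rho> k y"
  using radius_less[OF assms(1), of y r] assms(2) by force

text \<open>\<open>B(z, r)\<close> is contained in \<open>B(y, r + d(y, z))\<close>.\<close>
lemma radius_lipschitz:
  assumes k: "k \<ge> 1"
  shows "1-lipschitz_on UNIV (\<rho> k)"
proof -
  have "\<rho> k y \<le> \<rho> k z + dist y z" for y z
  proof (rule field_le_epsilon)
    fix e :: real assume e: "e > 0"
    have "M k \<le> measure \<mu> (ball z (\<rho> k z + e))" using k e by (intro radius_less) auto
    also have "\<dots> \<le> measure \<mu> (ball y (\<rho> k z + e + dist y z))"
    proof (intro finite_measure_mono)
      show "ball z (\<rho> k z + e) \<subseteq> ball y (\<rho> k z + e + dist y z)"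
      proof
        fix w assume "w \<in> ball z (\<rho> k z + e)"
        then show "w \<in> ball y (\<rho> k z + e + dist y z)" using dist_triangle[of y w z] by simp
      qed
    qed auto
    finally have "\<rho> k y \<le> \<rho> k z + e + dist y z"
      using radius_nonneg[OF k, of z] e by (intro radius_le) auto
    then show "\<rho> k y \<le> \<rho> k z + dist y z + e" by simp
  qed
  then have "dist (\<rho> k y) (\<rho> k z) \<le> 1 * dist y z" for y z
    by (smt (verit) dist_commute dist_real_def)
  then show ?thesis by (intro lipschitz_onI) auto
qed

lemma radius_measurable [measurable]: "k \<ge> 1 \<Longrightarrow> \<rho> k \<in> borel_measurable \<mu>"
  using borel_measurable_continuous_onI[OF lipschitz_on_continuous_on[OF radius_lipschitz]]
  by (simp add: measurable_cong_sets[OF sets_eq refl])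

text \<open>Open balls depend on their radius continuously from the left.\<close>
lemma measure_ball_radius_le:
  assumes k: "k \<ge> 1"
  shows "measure \<mu> (ball y (\<rho> k y)) \<le> M k"
proof -
  define B where "B n = ball y (\<rho> k y - 1 / real (Suc n))" for n
  have inc: "incseq B" unfolding B_def
    by (intro incseq_SucI subset_ball) (simp add: frac_le)
  have "(\<Union>n. B n) = ball y (\<rho> k y)"
  proof
    show "(\<Union>n. B n) \<subseteq> ball y (\<rho> k y)"
      unfolding B_def by (intro UN_least subset_ball) simp
    show "ball y (\<rho> k y) \<subseteq> (\<Union>n. B n)"
    proof
      fix z assume "z \<in> ball y (\<rho> k y)"
      then have "0 < \<rho> k y - dist y z" by simp
      then obtain n where "1 / real (Suc n) < \<rho> k y - dist y z" using nat_approx_posE by blast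
      then show "z \<in> (\<Union>n. B n)" by (auto simp: B_def intro!: exI[of _ n])
    qed
  qed
  moreover have "range B \<subseteq> sets \<mu>" by (auto simp: B_def)
  ultimately have lim: "(\<lambda>n. measure \<mu> (B n)) \<longlonglongrightarrow> measure \<mu> (ball y (\<rho> k y))"
    using finite_Lim_measure_incseq[OF _ inc] by simp
  have "measure \<mu> (B n) \<le> M k" for n
  proof (rule ccontr)
    assume *: "\<not> ?thesis"
    show False
    proof (cases "\<rho> k y - 1 / real (Suc n) \<ge> 0")
      case True
      then have "\<rho> k y \<le> \<rho> k y - 1 / real (Suc n)" using * unfolding B_def by (intro radius_le) auto
      then show False by (simp add: not_le[symmetric])
    next
      case False
      then have "B n = {}" by (simp add: B_def)
      then show False using * M_pos[OF k] by simp
    qed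
  qed
  then show ?thesis using LIMSEQ_le_const2[OF lim] by blast
qed

text \<open>The range of indices in which the thin annuli property is available around \<open>y\<close>.\<close>
definition small_radii :: "nat \<Rightarrow> 'a \<Rightarrow> bool" where
  "small_radii k\<^sub>0 y \<longleftrightarrow> (\<forall>k\<ge>k\<^sub>0. \<rho> k y \<le> \<rho>\<^sub>0)"

lemma M_tendsto_0: "M \<longlonglongrightarrow> 0"
proof (rule tendsto_sandwich)
  show "(\<lambda>n. 0) \<longlonglongrightarrow> (0::real)" by simp
  show "eventually (\<lambda>n. 0 \<le> M n) sequentially"
    using M_pos by (auto intro!: eventually_sequentiallyI[of 1] less_imp_le)
  show "eventually (\<lambda>n. M n \<le> C\<^sub>M * ln (real n) powr (- \<upsilon>)) sequentially"
    using M_upper by (auto intro!: eventually_sequentiallyI[of 2])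
  show "(\<lambda>n. C\<^sub>M * ln (real n) powr (- \<upsilon>)) \<longlonglongrightarrow> 0"
    using exponents by real_asymp
qed

text \<open>
  Up to a null set, every point lies in one of finitely many small balls of positive measure, so that
  \<open>\<mu>(B(y, \<rho>\<^sub>0))\<close> is bounded below uniformly in \<open>y\<close>; and \<open>M\<close> tends to 0.
\<close>
lemma AE_small_radii: "\<exists>k\<^sub>0\<ge>1. AE y in \<mu>. small_radii k\<^sub>0 y"
proof -
  define \<eta> where "\<eta> = min 1 (\<rho>\<^sub>0 / 2)"
  have \<eta>: "0 < \<eta>" "\<eta> \<le> 1" "2 * \<eta> \<le> \<rho>\<^sub>0" using thin_annuli(2) by (auto simp: \<eta>_def)
  obtain F :: "'a set" where F: "finite F" "\<And>x. \<exists>w\<in>F. dist x w < \<eta>"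
    using nets(1) \<eta> unfolding polynomial_nets_def by metis
  define G where "G = {w\<in>F. measure \<mu> (ball w \<eta>) > 0}"
  define p where "p = Min (insert 1 ((\<lambda>w. measure \<mu> (ball w \<eta>)) ` G))"
  have finG: "finite G" using F(1) by (simp add: G_def)
  have "p > 0" unfolding p_def using finG by (subst Min_gr_iff) (auto simp: G_def)
  then have "eventually (\<lambda>k. M k < p) sequentially"
    using order_tendstoD(2)[OF M_tendsto_0] by blast
  then obtain k1 where k1: "\<And>k. k \<ge> k1 \<Longrightarrow> M k < p" unfolding eventually_sequentially by blast
  have "AE y in \<mu>. y \<notin> ball w \<eta>" if "w \<in> F - G" for w
  proof (rule AE_not_in)
    show "ball w \<eta> \<in> null_sets \<mu>"
      using that measure_nonneg[of \<mu> "ball w \<eta>"]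
      by (auto simp: G_def null_sets_def emeasure_eq_measure)
  qed
  then have "AE y in \<mu>. \<forall>w\<in>F - G. y \<notin> ball w \<eta>" using F(1) by (intro AE_finite_allI) auto
  then have "AE y in \<mu>. small_radii (max 1 k1) y"
  proof (rule AE_mp, intro AE_I2 impI)
    fix y assume y: "\<forall>w\<in>F - G. y \<notin> ball w \<eta>"
    obtain w where w: "w \<in> F" "dist y w < \<eta>" using F(2) by blast
    then have "w \<in> G" using y by (auto simp: dist_commute)
    then have "p \<le> measure \<mu> (ball w \<eta>)" unfolding p_def using finG by (intro Min_le) auto
    also have "\<dots> \<le> measure \<mu> (ball y \<rho>\<^sub>0)"
    proof (intro finite_measure_mono)
      show "ball w \<eta> \<subseteq> ball y \<rho>\<^sub>0"
      proof
        fix z assume "z \<in> ball w \<eta>"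
        then show "z \<in> ball y \<rho>\<^sub>0" using dist_triangle[of y z w] w \<eta> by simp
      qed
    qed auto
    finally have "M k \<le> measure \<mu> (ball y \<rho>\<^sub>0)" if "k \<ge> k1" for k using k1[OF that] by linarith
    then show "small_radii (max 1 k1) y"
      unfolding small_radii_def using thin_annuli(2) by (simp add: radius_le)
  qed
  then show ?thesis by (intro exI[of _ "max 1 k1"]) auto
qed

text \<open>
  A Lipschitz version of the indicator of \<open>B(y, r\<^sub>k(y))\<close>, with slope \<open>1/\<delta>\<close>. For \<open>c = 0\<close> it vanishes
  outside the ball, for \<open>c = 1\<close> it is 1 on the ball; so these two values give a lower and an upper
  bound for the indicator, which differ only within \<open>\<delta>\<close> of the sphere.
\<close>
definition soft_ball :: "real \<Rightarrow> real \<Rightarrow> nat \<Rightarrow> 'a \<Rightarrow> 'a \<Rightarrow> real" where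
  "soft_ball c \<delta> k y z = ramp ((\<rho> k y - dist y z) / \<delta> + c)"

abbreviation hit :: "nat \<Rightarrow> 'a \<Rightarrow> 'a \<Rightarrow> real" where
  "hit k y z \<equiv> indicator (ball y (\<rho> k y)) z"

lemma soft_ball_bounds [simp]: "0 \<le> soft_ball c \<delta> k y z" "soft_ball c \<delta> k y z \<le> 1"
  by (auto simp: soft_ball_def)

lemma soft_ball_lipschitz:
  assumes "\<delta> > 0" "k \<ge> 1"
  shows "(2 / \<delta>)-lipschitz_on UNIV (soft_ball c \<delta> k y)"
    "(2 / \<delta>)-lipschitz_on UNIV (\<lambda>y. soft_ball c \<delta> k y z)"
proof -
  have *: "\<bar>ramp (a / \<delta> + c) - ramp (b / \<delta> + c)\<bar> \<le> \<bar>a - b\<bar> / \<delta>" for a b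
  proof -
    have "\<bar>ramp (a / \<delta> + c) - ramp (b / \<delta> + c)\<bar> \<le> \<bar>a / \<delta> - b / \<delta>\<bar>"
      by (rule order_trans[OF ramp_diff_le]) simp
    then show ?thesis using assms by (simp add: diff_divide_distrib[symmetric] abs_divide)
  qed
  have "\<bar>soft_ball c \<delta> k y z - soft_ball c \<delta> k y z'\<bar> \<le> 2 / \<delta> * dist z z'" for z z'
  proof -
    have "\<bar>(\<rho> k y - dist y z) - (\<rho> k y - dist y z')\<bar> \<le> 2 * dist z z'"
      using abs_dist_diff_le[of z y z'] zero_le_dist[of z z'] by (simp add: dist_commute[of y])
    then have "\<bar>(\<rho> k y - dist y z) - (\<rho> k y - dist y z')\<bar> / \<delta> \<le> 2 * dist z z' / \<delta>"
      using assms by (intro divide_right_mono) auto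
    then show ?thesis unfolding soft_ball_def using order_trans[OF *] by simp
  qed
  then show "(2 / \<delta>)-lipschitz_on UNIV (soft_ball c \<delta> k y)"
    using assms by (intro lipschitz_onI) (auto simp: dist_real_def)
  have "\<bar>soft_ball c \<delta> k y z - soft_ball c \<delta> k y' z\<bar> \<le> 2 / \<delta> * dist y y'" for y y'
  proof -
    have "\<bar>\<rho> k y - \<rho> k y'\<bar> \<le> dist y y'"
      using lipschitz_onD[OF radius_lipschitz[OF assms(2)], of y y'] by (simp add: dist_real_def)
    then have "\<bar>(\<rho> k y - dist y z) - (\<rho> k y' - dist y' z)\<bar> \<le> 2 * dist y y'"
      using abs_dist_diff_le[of y z y'] unfolding dist_commute[of z y'] by linarith
    then have "\<bar>(\<rho> k y - dist y z) - (\<rho> k y' - dist y' z)\<bar> / \<delta> \<le> 2 * dist y y' / \<delta>"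
      using assms by (intro divide_right_mono) auto
    then show ?thesis unfolding soft_ball_def using order_trans[OF *] by simp
  qed
  then show "(2 / \<delta>)-lipschitz_on UNIV (\<lambda>y. soft_ball c \<delta> k y z)"
    using assms by (intro lipschitz_onI) (auto simp: dist_real_def)
qed

lemma soft_ball_sandwich:
  assumes "\<delta> > 0"
  shows "soft_ball 0 \<delta> k y z \<le> hit k y z" "hit k y z \<le> soft_ball 1 \<delta> k y z"
  using assms by (auto simp: soft_ball_def indicator_def divide_le_0_iff)

lemma soft_ball_measurable [measurable (raw)]:
  assumes "k \<ge> 1" "f \<in> measurable N \<mu>" "g \<in> measurable N \<mu>"
  shows "(\<lambda>x. soft_ball c \<delta> k (f x) (g x)) \<in> borel_measurable N"
proof -
  have "(\<lambda>x. \<rho> k (f x)) \<in> borel_measurable N"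
    using measurable_compose[OF assms(2) radius_measurable[OF assms(1)]] .
  moreover have "(\<lambda>x. dist (f x) (g x)) \<in> borel_measurable N"
    using assms by (intro borel_measurable_dist) (auto simp: measurable_cong_sets[OF refl sets_eq])
  ultimately show ?thesis unfolding soft_ball_def ramp_def by measurable
qed

lemma hit_measurable [measurable (raw)]:
  assumes "k \<ge> 1" "f \<in> measurable N \<mu>" "g \<in> measurable N \<mu>"
  shows "(\<lambda>x. hit k (f x) (g x)) \<in> borel_measurable N"
proof -
  have [measurable]: "(\<lambda>x. \<rho> k (f x)) \<in> borel_measurable N"
    using measurable_compose[OF assms(2) radius_measurable[OF assms(1)]] .
  have [measurable]: "(\<lambda>x. dist (f x) (g x)) \<in> borel_measurable N"
    using assms by (intro borel_measurable_dist) (auto simp: measurable_cong_sets[OF refl sets_eq])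
  have "(\<lambda>x. hit k (f x) (g x)) = (\<lambda>x. if dist (f x) (g x) < \<rho> k (f x) then 1 else 0)"
    by (auto simp: indicator_def)
  then show ?thesis by simp
qed

text \<open>The thin annuli bound for an annulus of width \<open>2\<delta>\<close>.\<close>
definition annulus_bound :: "real \<Rightarrow> real" where
  "annulus_bound \<delta> = C\<^sub>A * (2 * \<delta>) powr \<alpha>\<^sub>0"

lemma annulus_bound_nonneg: "annulus_bound \<delta> \<ge> 0"
  using thin_annuli(3) by (simp add: annulus_bound_def)

text \<open>
  The condition \<open>3\<delta> \<le> r\<close> guarantees that the width \<open>2\<delta>\<close> of the annulus does not exceed its inner
  radius \<open>r - \<delta>\<close>, as the thin annuli property demands.
\<close>
lemma soft_ball_gap:
  assumes \<delta>: "\<delta> > 0" and k: "k \<ge> 1" and small: "\<rho> k y \<le> \<rho>\<^sub>0" and big: "3 * \<delta> \<le> \<rho> k y"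
  shows "(LINT z|\<mu>. soft_ball 1 \<delta> k y z - soft_ball 0 \<delta> k y z) \<le> annulus_bound \<delta>"
proof -
  let ?A = "ball y ((\<rho> k y - \<delta>) + 2 * \<delta>) - ball y (\<rho> k y - \<delta>)"
  have "(LINT z|\<mu>. soft_ball 1 \<delta> k y z - soft_ball 0 \<delta> k y z) \<le> (LINT z|\<mu>. indicator ?A z)"
  proof (rule integral_mono)
    show "integrable \<mu> (\<lambda>z. soft_ball 1 \<delta> k y z - soft_ball 0 \<delta> k y z)"
    proof (rule integrable_bounded)
      show "(\<lambda>z. soft_ball 1 \<delta> k y z - soft_ball 0 \<delta> k y z) \<in> borel_measurable \<mu>"
        using k by measurable
      show "norm (soft_ball 1 \<delta> k y z - soft_ball 0 \<delta> k y z) \<le> 1" for z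
        using soft_ball_bounds[of 1 \<delta> k y z] soft_ball_bounds[of 0 \<delta> k y z] unfolding real_norm_def by linarith
    qed
    show "integrable \<mu> (\<lambda>z. indicator ?A z :: real)" by (simp add: emeasure_eq_measure)
    fix z
    show "soft_ball 1 \<delta> k y z - soft_ball 0 \<delta> k y z \<le> indicator ?A z"
    proof (cases "z \<in> ?A")
      case True
      then show ?thesis using soft_ball_bounds[of 1 \<delta> k y z] soft_ball_bounds[of 0 \<delta> k y z] by (simp del: soft_ball_bounds)
    next
      case False
      then consider "dist y z < \<rho> k y - \<delta>" | "\<rho> k y + \<delta> \<le> dist y z" by auto
      then have "soft_ball 1 \<delta> k y z = soft_ball 0 \<delta> k y z"
      proof cases
        case 1
        then have "(\<rho> k y - dist y z) / \<delta> \<ge> 1" using \<delta> by (simp add: divide_simps)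
        then show ?thesis by (simp add: soft_ball_def)
      next
        case 2
        then have "(\<rho> k y - dist y z) / \<delta> \<le> -1" using \<delta> by (simp add: divide_simps)
        then show ?thesis by (simp add: soft_ball_def)
      qed
      then show ?thesis by simp
    qed
  qed
  also have "\<dots> = measure \<mu> ?A" by simp
  also have "\<dots> \<le> annulus_bound \<delta>"
    unfolding annulus_bound_def by (rule thin_annuli(4)) (use \<delta> small big in auto)
  finally show ?thesis .
qed

text \<open>
  The measure of \<open>B(y, r\<^sub>k(y) + \<epsilon>)\<close> is at least \<open>M\<^sub>k\<close> for every \<open>\<epsilon> > 0\<close>, and exceeds that of
  \<open>B(y, r\<^sub>k(y))\<close> by at most \<open>O(\<epsilon>\<^sup>\<alpha>)\<close>. The thin annuli property needs a positive radius,
  which the Frostman property provides.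
\<close>
lemma measure_ball_radius:
  assumes k: "k \<ge> 1" and small: "\<rho> k y \<le> \<rho>\<^sub>0"
  shows "measure \<mu> (ball y (\<rho> k y)) = M k"
proof (rule antisym[OF measure_ball_radius_le[OF k]])
  have pos: "\<rho> k y > 0"
  proof (rule ccontr)
    assume "\<not> ?thesis"
    then have r0: "\<rho> k y = 0" using radius_nonneg[OF k, of y] by simp
    define r where "r = (M k / (2 * C\<^sub>F)) powr (1 / s\<^sub>0)"
    have r: "r > 0" using M_pos[OF k] frostman by (simp add: r_def)
    have "M k \<le> measure \<mu> (ball y r)" using r r0 by (intro radius_less[OF k]) simp
    also have "\<dots> \<le> C\<^sub>F * r powr s\<^sub>0" by (rule frostman(3)[OF r])
    also have "\<dots> = M k / 2" using M_pos[OF k] frostman by (simp add: r_def powr_powr)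
    finally show False using M_pos[OF k] by simp
  qed
  have "M k - measure \<mu> (ball y (\<rho> k y)) \<le> C\<^sub>A * \<epsilon> powr \<alpha>\<^sub>0" if "\<epsilon> \<in> {0<..<\<rho> k y}" for \<epsilon>
  proof -
    have "M k \<le> measure \<mu> (ball y (\<rho> k y + \<epsilon>))" using that by (intro radius_less[OF k]) simp
    also have "\<dots> = measure \<mu> (ball y (\<rho> k y)) + measure \<mu> (ball y (\<rho> k y + \<epsilon>) - ball y (\<rho> k y))"
      using that by (subst finite_measure_Diff) (auto intro!: subset_ball)
    finally show ?thesis using thin_annuli(4)[of \<epsilon> "\<rho> k y" y] that small by simp
  qed
  then have "eventually (\<lambda>\<epsilon>. M k - measure \<mu> (ball y (\<rho> k y)) \<le> C\<^sub>A * \<epsilon> powr \<alpha>\<^sub>0) (at_right 0)"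
    using pos eventually_at_right_less[of 0] unfolding eventually_at_right_field by (intro exI[of _ "\<rho> k y"]) auto
  moreover have "((\<lambda>\<epsilon>. C\<^sub>A * \<epsilon> powr \<alpha>\<^sub>0) \<longlongrightarrow> 0) (at_right 0)"
    using thin_annuli by real_asymp
  ultimately have "M k - measure \<mu> (ball y (\<rho> k y)) \<le> 0"
    by (intro tendsto_lowerbound[where F = "at_right (0::real)"]) auto
  then show "M k \<le> measure \<mu> (ball y (\<rho> k y))" by simp
qed

lemma radius_ge_of_frostman:
  assumes "k \<ge> 1" "r > 0" "C\<^sub>F * r powr s\<^sub>0 < M k"
  shows "r \<le> \<rho> k y"
  using frostman(3)[OF assms(2), of y] assms by (intro radius_gt) auto

end

context decorrelating_system
begin

section \<open>Growth of the variance\<close>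
lemma decorrelation_real:
  fixes f g :: "'a \<Rightarrow> real"
  assumes f: "\<And>x. 0 \<le> f x \<and> f x \<le> 1" "L-lipschitz_on UNIV f"
    and g: "\<And>x. 0 \<le> g x \<and> g x \<le> 1" "L-lipschitz_on UNIV g"
  shows "\<bar>(LINT x|\<mu>. f x * g ((T ^^ j) x)) - (LINT x|\<mu>. f x) * (LINT x|\<mu>. g x)\<bar>
    \<le> (1 + 2 * L) * (D * (1 + real j) powr d) * exp (- \<tau> * real j)"
proof -
  have [measurable]: "g \<in> borel_measurable \<mu>"
    using borel_measurable_continuous_onI[OF lipschitz_on_continuous_on[OF g(2)]]
    by (simp add: measurable_cong_sets[OF sets_eq refl])
  have c: "L-lipschitz_on UNIV (\<lambda>x. complex_of_real (f x))" "L-lipschitz_on UNIV (\<lambda>x. complex_of_real (g x))"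
    using f(2) g(2) unfolding lipschitz_on_def by simp_all
  have b: "cmod (complex_of_real (f x)) \<le> 1" "cmod (complex_of_real (g x)) \<le> 1" for x
    using f(1)[of x] g(1)[of x] by auto
  have "cmod (Cov \<mu> (\<lambda>x. complex_of_real (f x)) (\<lambda>x. \<Prod>k=j..j. complex_of_real (g ((T ^^ k) x))))
      \<le> (1 + L + real (j + 1 - j) * L) * (D * (1 + real j) powr d) * exp (- \<tau> * real j)"
    by (rule decorrelation[where h = "\<lambda>_ x. complex_of_real (g x)"]) (use b c in auto)
  moreover have "Cov \<mu> (\<lambda>x. complex_of_real (f x)) (\<lambda>x. \<Prod>k=j..j. complex_of_real (g ((T ^^ k) x)))
      = of_real ((LINT x|\<mu>. f x * g ((T ^^ j) x)) - (LINT x|\<mu>. f x) * (LINT x|\<mu>. g x))"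
    using integral_iterate[of g j] by (simp add: Cov_def flip: of_real_mult)
  ultimately show ?thesis by (simp add: add.assoc del: of_real_diff of_real_mult)
qed

end

context invariant_system
begin

lemma Var_eq:
  assumes [measurable]: "f \<in> borel_measurable \<mu>" and B: "\<And>x. \<bar>f x\<bar> \<le> B"
  shows "Var \<mu> f = (LINT x|\<mu>. (f x - (LINT x|\<mu>. f x))\<^sup>2)"
proof -
  define E where "E = (LINT x|\<mu>. f x)"
  have i1: "integrable \<mu> f" using B by (intro integrable_bounded[of _ B]) auto
  have i2: "integrable \<mu> (\<lambda>x. f x * f x)"
  proof (rule integrable_bounded)
    show "norm (f x * f x) \<le> B * B" for x
      using mult_mono'[OF B[of x] B[of x]] by (simp add: abs_mult)
  qed simp
  have "(LINT x|\<mu>. (f x - E)\<^sup>2) = (LINT x|\<mu>. f x * f x - 2 * E * f x + E * E)"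
    by (intro Bochner_Integration.integral_cong refl) (simp add: power2_eq_square algebra_simps)
  also have "\<dots> = (LINT x|\<mu>. f x * f x) - 2 * E * E + E * E"
    using i1 i2 by (simp add: E_def prob_space[simplified])
  finally show ?thesis by (simp add: Var_def Cov_def E_def)
qed

lemma Var_nonneg:
  assumes "f \<in> borel_measurable \<mu>" "\<And>x. \<bar>f x\<bar> \<le> B"
  shows "Var \<mu> f \<ge> 0"
  unfolding Var_eq[OF assms] by (intro integral_nonneg_AE) auto

text \<open>
  From \<open>(u + v)\<^sup>2 \<ge> v\<^sup>2/2 - u\<^sup>2\<close>. It discards the initial terms of the sum of hits, for which
  \<open>M\<^sub>k\<close> may be too large compared with the window of lags.
\<close>
lemma Var_add_lower:
  assumes [measurable]: "f \<in> borel_measurable \<mu>" "g \<in> borel_measurable \<mu>"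
    and f: "\<And>x. \<bar>f x\<bar> \<le> B" and g: "\<And>x. \<bar>g x\<bar> \<le> B'"
  shows "Var \<mu> (\<lambda>x. f x + g x) \<ge> Var \<mu> g / 2 - B\<^sup>2"
proof -
  define E where "E = (LINT x|\<mu>. f x)"
  define E' where "E' = (LINT x|\<mu>. g x)"
  have i1: "integrable \<mu> f" "integrable \<mu> g"
    using integrable_bounded[of f B, OF _ f[folded real_norm_def]]
      integrable_bounded[of g B', OF _ g[folded real_norm_def]] by auto
  have EB: "\<bar>E\<bar> \<le> B" "\<bar>E'\<bar> \<le> B'"
    unfolding E_def E'_def using norm_integral_le[of f B, OF _ f[folded real_norm_def]]
      norm_integral_le[of g B', OF _ g[folded real_norm_def]] by auto
  have fg: "\<bar>f x + g x\<bar> \<le> B + B'" for x using f[of x] g[of x] by linarith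
  have sq: "(h x)\<^sup>2 \<le> C\<^sup>2" if "\<And>x. \<bar>h x\<bar> \<le> C" for h :: "'a \<Rightarrow> real" and x C
    using that[of x] by (metis abs_ge_zero power2_abs power_mono)
  have sq_int: "integrable \<mu> (\<lambda>x. (h x)\<^sup>2)" if [measurable]: "h \<in> borel_measurable \<mu>" and h: "\<And>x. \<bar>h x\<bar> \<le> C"
    for h :: "'a \<Rightarrow> real" and C
    by (rule integrable_bounded[of _ "C\<^sup>2"]) (use sq[OF h] in auto)
  have cf: "\<bar>f x - E\<bar> \<le> 2 * B" and cg: "\<bar>g x - E'\<bar> \<le> 2 * B'"
    and cfg: "\<bar>f x + g x - (E + E')\<bar> \<le> 2 * B + 2 * B'" for x
    using f[of x] g[of x] EB by linarith+
  have i2: "integrable \<mu> (\<lambda>x. (f x - E)\<^sup>2)" "integrable \<mu> (\<lambda>x. (g x - E')\<^sup>2)"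
    "integrable \<mu> (\<lambda>x. (f x + g x - (E + E'))\<^sup>2)"
    by (rule sq_int[OF _ cf], simp, rule sq_int[OF _ cg], simp, rule sq_int[OF _ cfg], simp)
  have "Var \<mu> f \<le> (LINT x|\<mu>. f x * f x)" by (simp add: Var_def Cov_def)
  also have "\<dots> \<le> B\<^sup>2"
  proof -
    have "norm (f x * f x) \<le> B\<^sup>2" for x
    proof -
      have "(f x)\<^sup>2 \<le> B\<^sup>2" by (rule sq) (rule f)
      then show ?thesis by (simp add: power2_eq_square)
    qed
    from norm_integral_le[OF _ this] show ?thesis by simp
  qed
  finally have VB: "Var \<mu> f \<le> B\<^sup>2" .
  have "Var \<mu> g / 2 - Var \<mu> f = (LINT x|\<mu>. (g x - E')\<^sup>2 / 2 - (f x - E)\<^sup>2)"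
    unfolding Var_eq[OF assms(1) f] Var_eq[OF assms(2) g] E_def[symmetric] E'_def[symmetric] using i2 by simp
  also have "\<dots> \<le> (LINT x|\<mu>. (f x + g x - (E + E'))\<^sup>2)"
  proof (rule integral_mono)
    fix x
    have aux: "v\<^sup>2 / 2 - u\<^sup>2 \<le> (u + v)\<^sup>2" for u v :: real
      using zero_le_power2[of "2 * u + v"] by (simp add: power2_eq_square algebra_simps)
    show "(g x - E')\<^sup>2 / 2 - (f x - E)\<^sup>2 \<le> (f x + g x - (E + E'))\<^sup>2"
      using aux[of "g x - E'" "f x - E"] by (simp add: algebra_simps)
  qed (use i2 in auto)
  also have "\<dots> = Var \<mu> (\<lambda>x. f x + g x)"
    by (subst Var_eq[of _ "B + B'"]) (use fg i1 in \<open>auto simp: E_def E'_def\<close>)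
  finally show ?thesis using VB by linarith
qed

lemma Var_sum:
  fixes X :: "nat \<Rightarrow> 'a \<Rightarrow> real"
  assumes "finite I" "\<And>k. k \<in> I \<Longrightarrow> X k \<in> borel_measurable \<mu>" "\<And>k x. k \<in> I \<Longrightarrow> \<bar>X k x\<bar> \<le> 1"
  shows "Var \<mu> (\<lambda>x. \<Sum>k\<in>I. X k x) = (\<Sum>k\<in>I. \<Sum>l\<in>I. Cov \<mu> (X k) (X l))"
proof -
  have i1: "integrable \<mu> (X k)" if "k \<in> I" for k
    using assms that by (intro integrable_bounded[of _ 1]) auto
  have i2: "integrable \<mu> (\<lambda>x. X k x * X l x)" if "k \<in> I" "l \<in> I" for k l
    using assms that by (intro integrable_bounded[of _ 1]) (auto simp: abs_mult mult_le_one)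
  have "Var \<mu> (\<lambda>x. \<Sum>k\<in>I. X k x) = (LINT x|\<mu>. (\<Sum>k\<in>I. \<Sum>l\<in>I. X k x * X l x))
      - (\<Sum>k\<in>I. LINT x|\<mu>. X k x) * (\<Sum>l\<in>I. LINT x|\<mu>. X l x)"
    using i1 by (simp add: Var_def Cov_def sum_product)
  also have "(LINT x|\<mu>. (\<Sum>k\<in>I. \<Sum>l\<in>I. X k x * X l x)) = (\<Sum>k\<in>I. \<Sum>l\<in>I. LINT x|\<mu>. X k x * X l x)"
    using i2 by simp
  finally show ?thesis by (simp add: Cov_def sum_product sum_subtractf)
qed

end

context shrinking_targets
begin

lemma hit_integral:
  assumes "k \<ge> 1" "\<rho> k y \<le> \<rho>\<^sub>0"
  shows "(LINT z|\<mu>. hit k y z) = M k"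
  using measure_ball_radius[OF assms] by simp

lemma soft_ball_integral_ge:
  assumes \<delta>: "\<delta> > 0" and k: "k \<ge> 1" and small: "\<rho> k y \<le> \<rho>\<^sub>0" and big: "3 * \<delta> \<le> \<rho> k y"
  shows "(LINT z|\<mu>. soft_ball 0 \<delta> k y z) \<ge> M k - annulus_bound \<delta>"
proof -
  have i: "integrable \<mu> (soft_ball c \<delta> k y)" for c
  proof (rule integrable_bounded[of _ 1])
    show "soft_ball c \<delta> k y \<in> borel_measurable \<mu>" using k by measurable
  qed simp
  have "M k \<le> (LINT z|\<mu>. soft_ball 1 \<delta> k y z)"
    unfolding hit_integral[OF k small, symmetric]
    by (rule integral_mono) (use i soft_ball_sandwich[OF \<delta>] in \<open>auto simp: emeasure_eq_measure\<close>)
  then show ?thesis using soft_ball_gap[OF assms] i by simp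
qed

text \<open>
  Only a lower bound is wanted, so the indicators may be replaced by the soft balls below them
  inside the correlation; their integrals are still within the annulus bound of \<open>M\<^sub>k\<close> and \<open>M\<^sub>l\<close>.
\<close>
lemma hit_correlation_lower:
  assumes \<delta>: "\<delta> > 0" and k: "k \<ge> 1" "\<rho> k y \<le> \<rho>\<^sub>0" "3 * \<delta> \<le> \<rho> k y"
    and l: "l \<ge> 1" "\<rho> l y \<le> \<rho>\<^sub>0" "3 * \<delta> \<le> \<rho> l y"
  shows "(LINT x|\<mu>. hit k y x * hit l y ((T ^^ j) x)) - M k * M l
    \<ge> - (2 * annulus_bound \<delta> + (1 + 4 / \<delta>) * (D * (1 + real j) powr d) * exp (- \<tau> * real j))"
proof -
  let ?f = "soft_ball 0 \<delta> k y" and ?g = "soft_ball 0 \<delta> l y"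
  have [measurable]: "?f \<in> borel_measurable \<mu>" "?g \<in> borel_measurable \<mu>"
    using k l by measurable
  have [measurable]: "hit k y \<in> borel_measurable \<mu>" "hit l y \<in> borel_measurable \<mu>" by measurable
  have f1: "(LINT x|\<mu>. ?f x) \<le> 1" "0 \<le> (LINT x|\<mu>. ?f x)"
    using norm_integral_le[of ?f 1] by (auto intro: integral_nonneg_AE)
  have "(LINT x|\<mu>. ?f x * ?g ((T ^^ j) x)) \<le> (LINT x|\<mu>. hit k y x * hit l y ((T ^^ j) x))"
  proof (rule integral_mono)
    show "integrable \<mu> (\<lambda>x. ?f x * ?g ((T ^^ j) x))"
      by (rule integrable_bounded[of _ 1]) (auto simp: abs_mult mult_le_one)
    show "integrable \<mu> (\<lambda>x. hit k y x * hit l y ((T ^^ j) x))"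
      by (rule integrable_bounded[of _ 1]) (auto simp: abs_mult mult_le_one)
  qed (intro mult_mono soft_ball_sandwich \<delta>, auto)
  moreover have "\<bar>(LINT x|\<mu>. ?f x * ?g ((T ^^ j) x)) - (LINT x|\<mu>. ?f x) * (LINT x|\<mu>. ?g x)\<bar>
      \<le> (1 + 2 * (2 / \<delta>)) * (D * (1 + real j) powr d) * exp (- \<tau> * real j)"
    by (rule decorrelation_real) (use soft_ball_lipschitz[OF \<delta>] k l in auto)
  moreover have "(LINT x|\<mu>. ?f x) * (LINT x|\<mu>. ?g x) - M k * M l \<ge> - (2 * annulus_bound \<delta>)"
  proof -
    have a: "(LINT x|\<mu>. ?g x) - M l \<ge> - annulus_bound \<delta>" "(LINT x|\<mu>. ?f x) - M k \<ge> - annulus_bound \<delta>"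
      using soft_ball_integral_ge[OF \<delta> k] soft_ball_integral_ge[OF \<delta> l] by auto
    have e: "annulus_bound \<delta> \<ge> 0" by (rule annulus_bound_nonneg)
    have "(LINT x|\<mu>. ?f x) * ((LINT x|\<mu>. ?g x) - M l) \<ge> (LINT x|\<mu>. ?f x) * (- annulus_bound \<delta>)"
      using a f1 by (intro mult_left_mono)
    moreover have "(LINT x|\<mu>. ?f x) * annulus_bound \<delta> \<le> 1 * annulus_bound \<delta>"
      using f1 e by (intro mult_right_mono)
    moreover have "((LINT x|\<mu>. ?f x) - M k) * M l \<ge> (- annulus_bound \<delta>) * M l"
      using a M_pos[OF l(1)] by (intro mult_right_mono) auto
    moreover have "annulus_bound \<delta> * M l \<le> annulus_bound \<delta> * 1"
      using M_le_1[OF l(1)] e by (intro mult_left_mono)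
    ultimately show ?thesis by (simp add: algebra_simps)
  qed
  ultimately show ?thesis by simp
qed

text \<open>
  Write the variance as the sum of all covariances. The diagonal contributes \<open>M\<^sub>k - M\<^sub>k\<^sup>2\<close>. A pair
  with lag at most \<open>W\<close> contributes at least \<open>-M\<^sub>k M\<^sub>l \<ge> -M\<^sub>m M\<^sub>k\<close>, and every row has at most
  \<open>2W + 1\<close> of these, which uses up at most half of the diagonal. All other pairs contribute
  at least \<open>-e\<close>.
\<close>
lemma s_sq_lower:
  assumes \<delta>: "\<delta> > 0" and mn: "1 \<le> m" "m \<le> n"
    and small: "\<And>k. k \<in> {m..n} \<Longrightarrow> \<rho> k y \<le> \<rho>\<^sub>0" and big: "\<And>k. k \<in> {m..n} \<Longrightarrow> 3 * \<delta> \<le> \<rho> k y"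
    and W: "(2 * real W + 1) * M m \<le> 1 / 2"
    and e: "e = 2 * annulus_bound \<delta> + (1 + 4 / \<delta>) * (D * (1 + real n) powr d) * exp (- \<tau> * real W)"
  shows "s_sq \<mu> T M n y \<ge> ((\<Sum>k=m..n. M k) / 2 - (real n + 1)\<^sup>2 * e) / 2 - (real m)\<^sup>2"
proof -
  define X where "X k x = (hit k y ((T ^^ k) x) :: real)" for k x
  have X_meas [measurable]: "X k \<in> borel_measurable \<mu>" for k
    unfolding X_def by measurable
  have X01: "0 \<le> X k x" "X k x \<le> 1" for k x by (auto simp: X_def indicator_def)
  have e0: "e \<ge> 0" unfolding e using annulus_bound_nonneg \<delta> D_nonneg by simp
  have EX: "(LINT x|\<mu>. X k x) = M k" if "k \<in> {m..n}" for k
    unfolding X_def using integral_iterate[of "hit k y" k] hit_integral[OF _ small[OF that]] that mn by auto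
  have XX: "(LINT x|\<mu>. X k x * X l x) = (LINT x|\<mu>. hit k y x * hit l y ((T ^^ (l - k)) x))" if "k \<le> l" for k l
  proof -
    have "(T ^^ l) x = (T ^^ (l - k)) ((T ^^ k) x)" for x
      using that funpow_add[of "l - k" k T] by simp
    then show ?thesis unfolding X_def
      using integral_iterate[of "\<lambda>x. hit k y x * hit l y ((T ^^ (l - k)) x)" k] by simp
  qed
  have far: "Cov \<mu> (X k) (X l) \<ge> - e" if kl: "k \<in> {m..n}" "l \<in> {m..n}" "k + W < l" for k l
  proof -
    have "- (2 * annulus_bound \<delta> + (1 + 4 / \<delta>) * (D * (1 + real (l - k)) powr d) * exp (- \<tau> * real (l - k)))
        \<le> (LINT x|\<mu>. hit k y x * hit l y ((T ^^ (l - k)) x)) - M k * M l"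
      by (rule hit_correlation_lower) (use \<delta> kl small big mn in auto)
    also have "\<dots> = Cov \<mu> (X k) (X l)" using kl by (simp add: Cov_def XX EX)
    moreover have "(1 + 4 / \<delta>) * (D * (1 + real (l - k)) powr d) * exp (- \<tau> * real (l - k))
        \<le> (1 + 4 / \<delta>) * (D * (1 + real n) powr d) * exp (- \<tau> * real W)"
      using kl \<delta> D_nonneg d_nonneg \<tau>_pos by (intro mult_mono mult_left_mono powr_mono2) auto
    ultimately show ?thesis unfolding e by linarith
  qed
  have sym: "Cov \<mu> (X k) (X l) = Cov \<mu> (X l) (X k)" for k l by (simp add: Cov_def mult.commute)
  have cov: "Cov \<mu> (X k) (X l) \<ge> (if k = l then M k else 0)
      - (if l \<in> {k - W..k + W} then M m * M k else 0) - e" if kl: "k \<in> {m..n}" "l \<in> {m..n}" for k l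
  proof -
    have M: "0 < M k" "0 < M l" "M k \<le> M m" "M l \<le> M m"
      using kl mn M_pos M_antimono by auto
    consider "k = l" | "k \<noteq> l" "l \<in> {k - W..k + W}" | "k + W < l" | "l + W < k"
      by fastforce
    then show ?thesis
    proof cases
      case 1
      have "(\<lambda>x. X k x * X k x) = X k" by (auto simp: X_def indicator_def)
      then have "Cov \<mu> (X k) (X l) = M k - M k * M k" using 1 kl by (simp add: Cov_def EX)
      moreover have "M k * M k \<le> M m * M k" using M by (intro mult_right_mono) auto
      ultimately show ?thesis using 1 e0 by simp
    next
      case 2
      have "(LINT x|\<mu>. X k x * X l x) \<ge> 0" using X01 by (intro integral_nonneg_AE) auto
      then have "Cov \<mu> (X k) (X l) \<ge> - (M k * M l)" using kl by (simp add: Cov_def EX)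
      moreover have "M k * M l \<le> M m * M k" using M by (simp add: mult.commute mult_left_mono)
      ultimately show ?thesis using 2 e0 by simp
    next
      case 3
      then show ?thesis using far[OF kl 3] by auto
    next
      case 4
      then show ?thesis using far[OF kl(2,1) 4] sym[of k l] by auto
    qed
  qed
  have row: "(\<Sum>l\<in>{m..n}. Cov \<mu> (X k) (X l)) \<ge> M k / 2 - (real n + 1) * e" if k: "k \<in> {m..n}" for k
  proof -
    have Mk: "M k > 0" and Mm: "M m > 0" using k mn M_pos by auto
    have "(\<Sum>l\<in>{m..n}. (if k = l then M k else 0) - (if l \<in> {k - W..k + W} then M m * M k else 0) - e)
        \<le> (\<Sum>l\<in>{m..n}. Cov \<mu> (X k) (X l))"
      by (intro sum_mono cov k)
    moreover have "(\<Sum>l\<in>{m..n}. (if k = l then M k else 0)) = M k" using k by simp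
    moreover have "(\<Sum>l\<in>{m..n}. (if l \<in> {k - W..k + W} then M m * M k else 0)) \<le> M k / 2"
    proof -
      have "(\<Sum>l\<in>{m..n}. (if l \<in> {k - W..k + W} then M m * M k else 0))
          = real (card ({m..n} \<inter> {k - W..k + W})) * (M m * M k)"
        by (subst sum.inter_restrict[symmetric]) auto
      also have "\<dots> \<le> (2 * real W + 1) * (M m * M k)"
      proof (intro mult_right_mono)
        have "card ({m..n} \<inter> {k - W..k + W}) \<le> card {k - W..k + W}" by (intro card_mono) auto
        also have "\<dots> \<le> 2 * W + 1" by simp
        finally have "real (card ({m..n} \<inter> {k - W..k + W})) \<le> real (2 * W + 1)" by (rule of_nat_mono)
        then show "real (card ({m..n} \<inter> {k - W..k + W})) \<le> 2 * real W + 1" by simp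
      qed (use Mk Mm in simp)
      also have "\<dots> = ((2 * real W + 1) * M m) * M k" by simp
      also have "\<dots> \<le> 1 / 2 * M k" using W Mk by (intro mult_right_mono) auto
      finally show ?thesis by simp
    qed
    moreover have "(\<Sum>l\<in>{m..n}. e) \<le> (real n + 1) * e" using e0 by (simp add: mult_right_mono)
    ultimately show ?thesis by (simp add: sum_subtractf)
  qed
  have "(\<Sum>k\<in>{m..n}. M k / 2 - (real n + 1) * e) \<le> (\<Sum>k\<in>{m..n}. \<Sum>l\<in>{m..n}. Cov \<mu> (X k) (X l))"
    by (intro sum_mono row)
  also have "\<dots> = Var \<mu> (\<lambda>x. \<Sum>k\<in>{m..n}. X k x)"
    using X01 by (intro Var_sum[symmetric]) auto
  finally have V: "(\<Sum>k\<in>{m..n}. M k / 2 - (real n + 1) * e) \<le> Var \<mu> (\<lambda>x. \<Sum>k\<in>{m..n}. X k x)" .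
  have "real (Suc n - m) * ((real n + 1) * e) \<le> (real n + 1) * ((real n + 1) * e)"
    using e0 by (intro mult_right_mono) auto
  moreover have "(\<Sum>k\<in>{m..n}. M k / 2 - (real n + 1) * e) = (\<Sum>k=m..n. M k) / 2 - real (Suc n - m) * ((real n + 1) * e)"
    by (simp only: sum_subtractf sum_divide_distrib sum_constant card_atLeastAtMost)
  ultimately have V': "(\<Sum>k=m..n. M k) / 2 - (real n + 1)\<^sup>2 * e \<le> Var \<mu> (\<lambda>x. \<Sum>k\<in>{m..n}. X k x)"
    using V unfolding power2_eq_square mult.assoc by linarith
  have "(\<lambda>x. \<Sum>k=1..n. hit k y ((T ^^ k) x)) = (\<lambda>x. (\<Sum>k\<in>{1..<m}. X k x) + (\<Sum>k\<in>{m..n}. X k x))"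
  proof
    fix x
    have "{1..n} = {1..<m} \<union> {m..n}" using mn by auto
    then show "(\<Sum>k=1..n. hit k y ((T ^^ k) x)) = (\<Sum>k\<in>{1..<m}. X k x) + (\<Sum>k\<in>{m..n}. X k x)"
      unfolding X_def by (simp add: sum.union_disjoint[symmetric] ivl_disj_int)
  qed
  then have "s_sq \<mu> T M n y = Var \<mu> (\<lambda>x. (\<Sum>k\<in>{1..<m}. X k x) + (\<Sum>k\<in>{m..n}. X k x))"
    unfolding s_sq_def by simp
  moreover have "Var \<mu> (\<lambda>x. (\<Sum>k\<in>{1..<m}. X k x) + (\<Sum>k\<in>{m..n}. X k x))
      \<ge> Var \<mu> (\<lambda>x. \<Sum>k\<in>{m..n}. X k x) / 2 - (real m)\<^sup>2"
  proof (rule Var_add_lower)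
    have s: "\<bar>\<Sum>k\<in>I. X k x\<bar> \<le> real (card I)" for I x
    proof -
      have "(\<Sum>k\<in>I. X k x) \<le> (\<Sum>k\<in>I. 1)" using X01 by (intro sum_mono)
      moreover have "0 \<le> (\<Sum>k\<in>I. X k x)" using X01 by (intro sum_nonneg)
      ultimately show ?thesis by simp
    qed
    show "\<bar>\<Sum>k\<in>{1..<m}. X k x\<bar> \<le> real m" for x
      using s[of x "{1..<m}"] by simp
    show "\<bar>\<Sum>k\<in>{m..n}. X k x\<bar> \<le> real (card {m..n})" for x by (rule s)
  qed auto
  moreover have "((\<Sum>k=m..n. M k) / 2 - (real n + 1)\<^sup>2 * e) / 2 \<le> Var \<mu> (\<lambda>x. \<Sum>k\<in>{m..n}. X k x) / 2"
    using V' by (rule divide_right_mono) simp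
  ultimately show ?thesis by (smt (verit))
qed

text \<open>
  The exponent \<open>q\<close> of the smoothing width is so large that the width is below the radii
  (\<open>q s\<^sub>0 > \<gamma>\<close>) and that even \<open>n\<^sup>2\<close> annuli have small total measure (\<open>q \<alpha>\<^sub>0 > 3\<close>).
  The burn-in is a power of \<open>n\<close>, so that \<open>e\<^sup>-\<^sup>\<tau>\<^sup>m\<close> beats every polynomial, but a power
  smaller than the \<open>n\<^sup>(\<^sup>1\<^sup>-\<^sup>\<gamma>\<^sup>)\<^sup>/\<^sup>2\<close> of the standard deviation.
\<close>
definition q :: real where "q = \<gamma> / s\<^sub>0 + 3 / \<alpha>\<^sub>0 + 1"
definition burn_in :: "nat \<Rightarrow> nat" where "burn_in n = nat \<lceil>real n powr ((1 - \<gamma>) / 4)\<rceil>"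
definition width :: "nat \<Rightarrow> real" where "width n = real n powr (- q)"

lemma q: "q * s\<^sub>0 > \<gamma>" "q * \<alpha>\<^sub>0 > 3" "q > 0"
proof -
  have "q * s\<^sub>0 = \<gamma> + (3 / \<alpha>\<^sub>0 + 1) * s\<^sub>0" using frostman(1) by (simp add: q_def field_simps)
  moreover have "(3 / \<alpha>\<^sub>0 + 1) * s\<^sub>0 > 0" using frostman(1) thin_annuli(1) by (simp add: add_pos_pos)
  ultimately show "q * s\<^sub>0 > \<gamma>" by linarith
  have "q * \<alpha>\<^sub>0 = 3 + (\<gamma> / s\<^sub>0 + 1) * \<alpha>\<^sub>0" using thin_annuli(1) by (simp add: q_def field_simps)
  moreover have "(\<gamma> / s\<^sub>0 + 1) * \<alpha>\<^sub>0 > 0" using frostman(1) thin_annuli(1) exponents by (simp add: add_pos_pos)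
  ultimately show "q * \<alpha>\<^sub>0 > 3" by linarith
  show "q > 0" using frostman(1) thin_annuli(1) exponents by (simp add: q_def add_pos_pos)
qed

lemma burn_in_bounds: "real n powr ((1 - \<gamma>) / 4) \<le> real (burn_in n)" "real (burn_in n) \<le> real n powr ((1 - \<gamma>) / 4) + 1"
proof -
  have "real n powr ((1 - \<gamma>) / 4) \<ge> 0" by simp
  then show "real n powr ((1 - \<gamma>) / 4) \<le> real (burn_in n)" "real (burn_in n) \<le> real n powr ((1 - \<gamma>) / 4) + 1"
    unfolding burn_in_def by linarith+
qed

lemma eventually_burn_in: "eventually (\<lambda>n. k \<le> burn_in n \<and> burn_in n \<le> n) sequentially"
proof -
  have "eventually (\<lambda>n. real k \<le> real n powr ((1 - \<gamma>) / 4)) sequentially"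
    using exponents by real_asymp
  moreover have "eventually (\<lambda>n. real n powr ((1 - \<gamma>) / 4) + 1 \<le> real n) sequentially"
    using exponents by real_asymp
  ultimately show ?thesis
  proof eventually_elim
    case (elim n)
    then show ?case using burn_in_bounds[of n] by linarith
  qed
qed

lemma width_pos: "n \<ge> 1 \<Longrightarrow> width n > 0"
  by (simp add: width_def)

lemma eventually_width_le_radius: "eventually (\<lambda>n. \<forall>y. \<forall>k\<in>{1..n}. 3 * width n \<le> \<rho> k y) sequentially"
proof -
  have "eventually (\<lambda>n. C\<^sub>F * 3 powr s\<^sub>0 * real n powr (- (q * s\<^sub>0)) < inverse C\<^sub>M * real n powr (- \<gamma>)) sequentially"
    using q(1) exponents frostman(2) by real_asymp
  then show ?thesis
    using eventually_ge_at_top[of 1]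
  proof eventually_elim
    case (elim n)
    have "C\<^sub>F * (3 * width n) powr s\<^sub>0 = C\<^sub>F * 3 powr s\<^sub>0 * real n powr (- (q * s\<^sub>0))"
      by (simp add: width_def powr_mult powr_powr)
    also have "\<dots> < inverse C\<^sub>M * real n powr (- \<gamma>)" by (rule elim)
    also have "\<dots> \<le> M n" by (rule M_lower) (use elim in simp)
    finally have *: "C\<^sub>F * (3 * width n) powr s\<^sub>0 < M n" .
    show ?case
    proof (intro allI ballI)
      fix y k assume k: "k \<in> {1..n}"
      then have "M n \<le> M k" by (intro M_antimono) auto
      then show "3 * width n \<le> \<rho> k y"
        using k * elim width_pos by (intro radius_ge_of_frostman) auto
    qed
  qed
qed

text \<open>
  In the bound \<open>s_sq_lower\<close> take the window \<open>W \<approx> K log n\<close>. For \<open>K\<close> large the error \<open>e\<close> is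
  \<open>o(n\<^sup>-\<^sup>2)\<close>; on the other hand \<open>W M\<^sub>m\<close> tends to 0 because \<open>log m\<close> is comparable to \<open>log n\<close> and
  \<open>M\<^sub>m = O((log m)\<^sup>-\<^sup>\<upsilon>)\<close> with \<open>\<upsilon> > 1\<close>. What remains is of the order of \<open>n M\<^sub>n \<ge> const n\<^sup>1\<^sup>-\<^sup>\<gamma>\<close>.
\<close>
lemma s_sq_growth:
  assumes "k\<^sub>0 \<ge> 1"
  shows "\<exists>c>0. eventually (\<lambda>n. \<forall>y. small_radii k\<^sub>0 y \<longrightarrow> c * real n powr (1 - \<gamma>) \<le> s_sq \<mu> T M n y) sequentially"
proof -
  \<comment> \<open>Then \<open>exp (- \<tau> K ln n)\<close> is \<open>n\<close> to the power \<open>- (q + d + 3)\<close>, which absorbs the Lipschitz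
    constant \<open>n powr q\<close>, the factor \<open>n powr d\<close> and the number \<open>n\<^sup>2\<close> of pairs.\<close>
  define K where "K = (q + d + 3) / \<tau>"
  define W where "W n = nat \<lceil>K * ln (real n)\<rceil>" for n :: nat
  define e where "e n = 2 * annulus_bound (width n) + (1 + 4 / width n) * (D * (1 + real n) powr d) * exp (- \<tau> * real (W n))" for n
  have K: "K > 0" using q(3) d_nonneg \<tau>_pos by (simp add: K_def)
  have W: "K * ln (real n) \<le> real (W n)" "real (W n) \<le> K * ln (real n) + 1" if "n \<ge> 1" for n
  proof -
    have "0 \<le> K * ln (real n)" using K that by simp
    then show "K * ln (real n) \<le> real (W n)" "real (W n) \<le> K * ln (real n) + 1" unfolding W_def by linarith+
  qed
  define \<beta> where "\<beta> = (1 - \<gamma>) / 4"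
  have \<beta>: "0 < \<beta>" "4 * \<beta> = 1 - \<gamma>" using exponents by (auto simp: \<beta>_def)
  have "(\<lambda>n. (2 * (K * ln (real n) + 1) + 1) * (C\<^sub>M * (\<beta> * ln (real n)) powr (- \<upsilon>))) \<longlonglongrightarrow> 0"
    using K \<beta> exponents by real_asymp
  then have ev1: "eventually (\<lambda>n. (2 * (K * ln (real n) + 1) + 1) * (C\<^sub>M * (\<beta> * ln (real n)) powr (- \<upsilon>)) < 1/2) sequentially"
    by (rule order_tendstoD) simp
  have "(\<lambda>n. (real n + 1)^2 * (2 * (C\<^sub>A * (2 powr \<alpha>\<^sub>0 * real n powr (- (q * \<alpha>\<^sub>0))))
          + (1 + 4 * real n powr q) * (D * (1 + real n) powr d) * real n powr (- (q + d + 3)))) \<longlonglongrightarrow> 0"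
    using q d_nonneg by real_asymp
  then have ev2: "eventually (\<lambda>n. (real n + 1)^2 * (2 * (C\<^sub>A * (2 powr \<alpha>\<^sub>0 * real n powr (- (q * \<alpha>\<^sub>0))))
          + (1 + 4 * real n powr q) * (D * (1 + real n) powr d) * real n powr (- (q + d + 3))) < 1) sequentially"
    by (rule order_tendstoD) simp
  define c where "c = inverse C\<^sub>M / 8"
  have c: "c > 0" "inverse C\<^sub>M = 8 * c" using exponents by (auto simp: c_def)
  have \<gamma>_eq: "\<gamma> = 1 - 4 * \<beta>" using \<beta> by simp
  have \<beta>1: "\<beta> < 1/4" using exponents by (simp add: \<beta>_def)
  have ev3: "eventually (\<lambda>n. c * real n powr (1 - \<gamma>)
      \<le> (((real n - (real n powr \<beta> + 1)) * (8 * c * real n powr (- \<gamma>))) / 2 - 1) / 2 - (real n powr \<beta> + 1)\<^sup>2) sequentially"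
    unfolding \<gamma>_eq using \<beta>(1) \<beta>1 c(1) by real_asymp
  show ?thesis
  proof (intro exI[of _ c] conjI c(1))
    show "eventually (\<lambda>n. \<forall>y. small_radii k\<^sub>0 y \<longrightarrow> c * real n powr (1 - \<gamma>) \<le> s_sq \<mu> T M n y) sequentially"
      using ev1 ev2 ev3 eventually_burn_in[of "max 2 k\<^sub>0"] eventually_width_le_radius eventually_ge_at_top[of 2]
    proof eventually_elim
      case (elim n)
      define m where "m = burn_in n"
      have m: "2 \<le> m" "k\<^sub>0 \<le> m" "m \<le> n" using elim by (auto simp: m_def)
      have m\<beta>: "real n powr \<beta> \<le> real m" "real m \<le> real n powr \<beta> + 1"
        using burn_in_bounds[of n] by (auto simp: m_def \<beta>_def)
      have "\<beta> * ln (real n) = ln (real n powr \<beta>)" using elim by (simp add: ln_powr)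
      also have "\<dots> \<le> ln (real m)"
        by (rule iffD2[OF ln_le_cancel_iff]) (use m\<beta> m elim in auto)
      finally have lnm: "\<beta> * ln (real n) \<le> ln (real m)" .
      have "M m \<le> C\<^sub>M * ln (real m) powr (- \<upsilon>)" using M_upper m by simp
      also have "\<dots> \<le> C\<^sub>M * (\<beta> * ln (real n)) powr (- \<upsilon>)"
        using lnm \<beta> elim exponents by (intro mult_left_mono powr_mono2') auto
      finally have Mm: "M m \<le> C\<^sub>M * (\<beta> * ln (real n)) powr (- \<upsilon>)" .
      have "(2 * real (W n) + 1) * M m \<le> (2 * (K * ln (real n) + 1) + 1) * (C\<^sub>M * (\<beta> * ln (real n)) powr (- \<upsilon>))"
        using Mm W[of n] elim m M_pos[of m] by (intro mult_mono) auto
      then have W2: "(2 * real (W n) + 1) * M m \<le> 1 / 2" using elim by linarith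
      have "exp (- \<tau> * real (W n)) \<le> exp (- (q + d + 3) * ln (real n))"
        using W(1)[of n] elim \<tau>_pos by (simp add: K_def field_simps)
      also have "\<dots> = real n powr (- (q + d + 3))" using elim by (simp add: powr_def)
      finally have E: "exp (- \<tau> * real (W n)) \<le> real n powr (- (q + d + 3))" .
      have "annulus_bound (width n) = C\<^sub>A * (2 powr \<alpha>\<^sub>0 * real n powr (- (q * \<alpha>\<^sub>0)))"
        by (simp add: annulus_bound_def width_def powr_mult powr_powr)
      moreover have "4 / width n = 4 * real n powr q" using elim by (simp add: width_def powr_minus_divide)
      moreover have "(1 + 4 * real n powr q) * (D * (1 + real n) powr d) * exp (- \<tau> * real (W n))
          \<le> (1 + 4 * real n powr q) * (D * (1 + real n) powr d) * real n powr (- (q + d + 3))"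
        by (intro mult_left_mono E) (use D_nonneg in simp)
      ultimately have "(real n + 1)\<^sup>2 * e n \<le> (real n + 1)^2 * (2 * (C\<^sub>A * (2 powr \<alpha>\<^sub>0 * real n powr (- (q * \<alpha>\<^sub>0))))
          + (1 + 4 * real n powr q) * (D * (1 + real n) powr d) * real n powr (- (q + d + 3)))"
        unfolding e_def by (intro mult_left_mono add_mono) auto
      then have e1: "(real n + 1)\<^sup>2 * e n \<le> 1" using elim by linarith
      have "(real n - (real n powr \<beta> + 1)) * (8 * c * real n powr (- \<gamma>)) \<le> (real n + 1 - real m) * M n"
      proof -
        have "(real n - (real n powr \<beta> + 1)) * (8 * c * real n powr (- \<gamma>)) \<le> (real n + 1 - real m) * (8 * c * real n powr (- \<gamma>))"
          using m\<beta> c by (intro mult_right_mono) auto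
        also have "\<dots> \<le> (real n + 1 - real m) * M n"
          using M_lower[of n] elim m c by (intro mult_left_mono) auto
        finally show ?thesis .
      qed
      also have "\<dots> = (\<Sum>k=m..n. M n)" using m by (simp add: of_nat_diff)
      also have "\<dots> \<le> (\<Sum>k=m..n. M k)" using m by (intro sum_mono M_antimono) auto
      finally have S: "(real n - (real n powr \<beta> + 1)) * (8 * c * real n powr (- \<gamma>)) \<le> (\<Sum>k=m..n. M k)" .
      have m2: "(real m)\<^sup>2 \<le> (real n powr \<beta> + 1)\<^sup>2" using m\<beta> by (intro power_mono) auto
      show ?case
      proof (intro allI impI)
        fix y assume y: "small_radii k\<^sub>0 y"
        have "((\<Sum>k=m..n. M k) / 2 - (real n + 1)\<^sup>2 * e n) / 2 - (real m)\<^sup>2 \<le> s_sq \<mu> T M n y"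
          by (rule s_sq_lower[where \<delta> = "width n" and W = "W n"])
            (use m elim width_pos[of n] y W2 in \<open>auto simp: small_radii_def e_def\<close>)
        moreover have "(((real n - (real n powr \<beta> + 1)) * (8 * c * real n powr (- \<gamma>))) / 2 - 1) / 2 - (real n powr \<beta> + 1)\<^sup>2
            \<le> ((\<Sum>k=m..n. M k) / 2 - (real n + 1)\<^sup>2 * e n) / 2 - (real m)\<^sup>2"
          using S e1 m2 by (intro diff_mono divide_right_mono) auto
        ultimately show "c * real n powr (1 - \<gamma>) \<le> s_sq \<mu> T M n y" using elim by linarith
      qed
    qed
  qed
qed

end

section \<open>Comparison of characteristic functions\<close>
lemma iexp_diff_le: "cmod (iexp a - iexp b) \<le> \<bar>a - b\<bar>"
proof -
  have "iexp a = iexp b * iexp (a - b)" by (simp add: exp_add[symmetric] algebra_simps)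
  then have "iexp a - iexp b = iexp b * (iexp (a - b) - 1)" by (simp add: algebra_simps)
  then have "cmod (iexp a - iexp b) = cmod (iexp (a - b) - 1)" by (simp add: norm_mult)
  then show ?thesis using iexp_approx1[of "a - b" 0] by simp
qed

lemma iexp_sum_prod: "finite I \<Longrightarrow> iexp (\<theta> * (\<Sum>k\<in>I. f k)) = (\<Prod>k\<in>I. iexp (\<theta> * f k))"
  by (simp add: sum_distrib_left exp_sum)

context shrinking_targets
begin

text \<open>The bound of \<open>decoupling\<close>, made uniform over all blocks of times within \<open>m, \<dots>, n\<close>.\<close>
definition decoupling_error :: "nat \<Rightarrow> nat \<Rightarrow> real \<Rightarrow> real \<Rightarrow> real \<Rightarrow> real" where
  "decoupling_error m n L \<eta> J = 4 * \<eta> * (real n * L)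
     + J * ((1 + (1 + J) / \<eta> + real n * L) * (D * (1 + real n) powr d) * exp (- \<tau> * real m))"

lemma decoupling_uniform:
  fixes F :: "'a set" and h :: "nat \<Rightarrow> 'a \<Rightarrow> 'a \<Rightarrow> complex"
  assumes F: "finite F" and net: "\<And>x. \<exists>w\<in>F. dist x w < \<eta>" and \<eta>: "\<eta> > 0"
    and ab: "1 \<le> m" "m \<le> a" "a \<le> b" "b \<le> n"
    and h1: "\<And>k y z. k \<in> {a..b} \<Longrightarrow> cmod (h k y z) \<le> 1"
    and hy: "\<And>k z. k \<in> {a..b} \<Longrightarrow> L-lipschitz_on UNIV (\<lambda>y. h k y z)"
    and hz: "\<And>k y. k \<in> {a..b} \<Longrightarrow> L-lipschitz_on UNIV (h k y)"
  shows "cmod ((LINT x|\<mu>. (\<Prod>k=a..b. h k x ((T ^^ k) x)))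
             - (LINT y|\<mu>. LINT x|\<mu>. (\<Prod>k=a..b. h k y ((T ^^ k) x)))) \<le> decoupling_error m n L \<eta> (real (card F))"
proof -
  have L: "L \<ge> 0" using hz[of a] ab lipschitz_on_nonneg by auto
  have c: "real (b + 1 - a) * L \<le> real n * L" using ab L by (intro mult_right_mono) auto
  have "4 * \<eta> * (real (b + 1 - a) * L)
      + real (card F) * ((1 + (1 + real (card F)) / \<eta> + real (b + 1 - a) * L)
          * (D * (1 + real b) powr d) * exp (- \<tau> * real a)) \<le> decoupling_error m n L \<eta> (real (card F))"
    unfolding decoupling_error_def using c ab \<eta> D_nonneg d_nonneg \<tau>_pos L
    by (intro add_mono mult_mono mult_left_mono powr_mono2) (auto intro!: add_nonneg_nonneg mult_nonneg_nonneg divide_nonneg_nonneg)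
  then show ?thesis
    by (rule order_trans[OF decoupling[where h = h, OF F net \<eta> ab(3)], rotated -1]) (use h1 hy hz in auto)
qed

text \<open>
  The annulus bound controls the gap for a fixed centre; decoupling, applied to each of the two soft balls
  as a block of length 1, transfers it to the centre \<open>x\<close>.
\<close>
lemma soft_ball_gap_diagonal:
  fixes F :: "'a set"
  assumes F: "finite F" and net: "\<And>x. \<exists>w\<in>F. dist x w < \<eta>" and \<eta>: "\<eta> > 0"
    and k: "1 \<le> m" "m \<le> k" "k \<le> n" and \<delta>: "\<delta> > 0"
    and small: "AE y in \<mu>. \<rho> k y \<le> \<rho>\<^sub>0" and big: "\<And>y. 3 * \<delta> \<le> \<rho> k y"
  shows "(LINT x|\<mu>. soft_ball 1 \<delta> k x ((T ^^ k) x) - soft_ball 0 \<delta> k x ((T ^^ k) x))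
    \<le> annulus_bound \<delta> + 2 * decoupling_error m n (2 / \<delta>) \<eta> (real (card F))"
proof -
  have k1: "k \<ge> 1" using k by simp
  have m1: "(\<lambda>x. soft_ball c \<delta> k x ((T ^^ k) x)) \<in> borel_measurable \<mu>" for c using k1 by measurable
  have m2: "(\<lambda>x. soft_ball c \<delta> k y ((T ^^ k) x)) \<in> borel_measurable \<mu>" for c y using k1 by measurable
  have m3: "(\<lambda>x. soft_ball c \<delta> k y x) \<in> borel_measurable \<mu>" for c y using k1 by measurable
  have m4: "(\<lambda>y. LINT x|\<mu>. soft_ball c \<delta> k y ((T ^^ k) x)) \<in> borel_measurable \<mu>" for c
    by (rule integral_pair_measurable) (use k1 in measurable)
  have i: "integrable \<mu> (\<lambda>x. soft_ball c \<delta> k x ((T ^^ k) x))" "integrable \<mu> (\<lambda>x. soft_ball c \<delta> k y ((T ^^ k) x))"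
    "integrable \<mu> (\<lambda>x. soft_ball c \<delta> k y x)" "integrable \<mu> (\<lambda>y. LINT x|\<mu>. soft_ball c \<delta> k y ((T ^^ k) x))" for c y
    using m1 m2 m3 m4 by (auto intro!: integrable_bounded[of _ 1] norm_integral_le[unfolded real_norm_def])
  have it: "(LINT x|\<mu>. soft_ball c \<delta> k y ((T ^^ k) x)) = (LINT x|\<mu>. soft_ball c \<delta> k y x)" for c y
    by (rule integral_iterate[OF m3])
  have d: "\<bar>(LINT x|\<mu>. soft_ball c \<delta> k x ((T ^^ k) x)) - (LINT y|\<mu>. LINT x|\<mu>. soft_ball c \<delta> k y ((T ^^ k) x))\<bar>
      \<le> decoupling_error m n (2 / \<delta>) \<eta> (real (card F))" for c
  proof -
    have "cmod ((LINT x|\<mu>. (\<Prod>k=k..k. complex_of_real (soft_ball c \<delta> k x ((T ^^ k) x))))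
             - (LINT y|\<mu>. LINT x|\<mu>. (\<Prod>k=k..k. complex_of_real (soft_ball c \<delta> k y ((T ^^ k) x)))))
        \<le> decoupling_error m n (2 / \<delta>) \<eta> (real (card F))"
    proof (rule decoupling_uniform[OF F net \<eta> k(1,2) _ k(3)])
      show "(2 / \<delta>)-lipschitz_on UNIV (\<lambda>y. complex_of_real (soft_ball c \<delta> j y z))" if "j \<in> {k..k}" for j z
        using soft_ball_lipschitz(2)[OF \<delta> k1, of c z] that unfolding lipschitz_on_def by simp
      show "(2 / \<delta>)-lipschitz_on UNIV (\<lambda>z. complex_of_real (soft_ball c \<delta> j y z))" if "j \<in> {k..k}" for j y
        using soft_ball_lipschitz(1)[OF \<delta> k1, of c y] that unfolding lipschitz_on_def by simp
    qed auto
    then show ?thesis by (simp del: of_real_diff add: of_real_diff[symmetric])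
  qed
  have "(LINT y|\<mu>. LINT x|\<mu>. soft_ball 1 \<delta> k y ((T ^^ k) x)) - (LINT y|\<mu>. LINT x|\<mu>. soft_ball 0 \<delta> k y ((T ^^ k) x))
      = (LINT y|\<mu>. (LINT x|\<mu>. soft_ball 1 \<delta> k y x - soft_ball 0 \<delta> k y x))"
    using i(3) i(4)[unfolded it] by (simp add: it)
  also have "\<dots> \<le> (LINT y|\<mu>. annulus_bound \<delta>)"
  proof (rule integral_mono_AE)
    show "AE y in \<mu>. (LINT x|\<mu>. soft_ball 1 \<delta> k y x - soft_ball 0 \<delta> k y x) \<le> annulus_bound \<delta>"
      using small by eventually_elim (rule soft_ball_gap[OF \<delta> k1 _ big])
    show "integrable \<mu> (\<lambda>y. LINT x|\<mu>. soft_ball 1 \<delta> k y x - soft_ball 0 \<delta> k y x)"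
      using i(3) i(4)[unfolded it] by simp
  qed simp
  finally have "(LINT y|\<mu>. LINT x|\<mu>. soft_ball 1 \<delta> k y ((T ^^ k) x))
      - (LINT y|\<mu>. LINT x|\<mu>. soft_ball 0 \<delta> k y ((T ^^ k) x)) \<le> annulus_bound \<delta>"
    by (simp add: prob_space[simplified])
  moreover have "(LINT x|\<mu>. soft_ball 1 \<delta> k x ((T ^^ k) x) - soft_ball 0 \<delta> k x ((T ^^ k) x))
      = (LINT x|\<mu>. soft_ball 1 \<delta> k x ((T ^^ k) x)) - (LINT x|\<mu>. soft_ball 0 \<delta> k x ((T ^^ k) x))"
    using i by simp
  ultimately show ?thesis using d[of 0] d[of 1] by linarith
qed

text \<open>
  Indicators are not Lipschitz, so they are replaced by soft balls on the diagonal, the decoupling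
  is carried out, and the indicators are restored in the double integral.
\<close>
lemma characteristic_decoupling:
  fixes F :: "'a set"
  assumes F: "finite F" and net: "\<And>x. \<exists>w\<in>F. dist x w < \<eta>" and \<eta>: "\<eta> > 0"
    and mn: "1 \<le> m" "m \<le> n" and \<delta>: "\<delta> > 0" and \<theta>: "\<bar>\<theta>\<bar> \<le> 1"
    and small: "AE y in \<mu>. \<forall>k\<in>{m..n}. \<rho> k y \<le> \<rho>\<^sub>0" and big: "\<And>y k. k \<in> {m..n} \<Longrightarrow> 3 * \<delta> \<le> \<rho> k y"
  shows "cmod ((LINT x|\<mu>. iexp (\<theta> * (\<Sum>k=m..n. hit k x ((T ^^ k) x))))
             - (LINT y|\<mu>. LINT x|\<mu>. iexp (\<theta> * (\<Sum>k=m..n. hit k y ((T ^^ k) x)))))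
    \<le> 2 * real n * annulus_bound \<delta> + (2 * real n + 1) * decoupling_error m n (2 / \<delta>) \<eta> (real (card F))"
proof -
  let ?err = "decoupling_error m n (2 / \<delta>) \<eta> (real (card F))"
  have err0: "?err \<ge> 0" unfolding decoupling_error_def using \<eta> \<delta> D_nonneg by simp
  define S where "S y x = (\<Sum>k=m..n. hit k y ((T ^^ k) x) :: real)" for y x
  define R where "R y x = (\<Sum>k=m..n. soft_ball 0 \<delta> k y ((T ^^ k) x))" for y x
  define G where "G k y x = soft_ball 1 \<delta> k y ((T ^^ k) x) - soft_ball 0 \<delta> k y ((T ^^ k) x)" for k y x
  have k1: "k \<ge> 1" if "k \<in> {m..n}" for k using that mn by simp
  have S_pair [measurable]: "(\<lambda>p. S (f p) (g p)) \<in> borel_measurable N"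
    if [measurable]: "f \<in> measurable N \<mu>" "g \<in> measurable N \<mu>" for f g and N :: "'c measure"
    unfolding S_def by (intro borel_measurable_sum hit_measurable) (use k1 in auto)
  have R_pair [measurable]: "(\<lambda>p. R (f p) (g p)) \<in> borel_measurable N"
    if [measurable]: "f \<in> measurable N \<mu>" "g \<in> measurable N \<mu>" for f g and N :: "'c measure"
    unfolding R_def by (intro borel_measurable_sum soft_ball_measurable) (use k1 in auto)
  have G_pair: "(\<lambda>p. G k (f p) (g p)) \<in> borel_measurable N"
    if "k \<in> {m..n}" and [measurable]: "f \<in> measurable N \<mu>" "g \<in> measurable N \<mu>" for f g k and N :: "'c measure"
    unfolding G_def by (intro borel_measurable_diff soft_ball_measurable) (use k1 that in auto)
  have G_diag: "(\<lambda>x. G k x x) \<in> borel_measurable \<mu>" if "k \<in> {m..n}" for k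
    by (rule G_pair[OF that]) auto
  have G_row: "(\<lambda>x. G k y x) \<in> borel_measurable \<mu>" if "k \<in> {m..n}" for k y
    by (rule G_pair[OF that]) auto
  have G01: "0 \<le> G k y x" "\<bar>G k y x\<bar> \<le> 1" for k y x
    using soft_ball_sandwich[OF \<delta>, where k = k and y = y and z = "(T ^^ k) x"] soft_ball_bounds[of 1 \<delta> k y "(T ^^ k) x"]
      soft_ball_bounds[of 0 \<delta> k y "(T ^^ k) x"] unfolding G_def by linarith+
  have iexpS: "cmod (iexp (\<theta> * S y x) - iexp (\<theta> * R y x)) \<le> (\<Sum>k=m..n. G k y x)" for y x
  proof -
    have "cmod (iexp (\<theta> * S y x) - iexp (\<theta> * R y x)) \<le> \<bar>\<theta> * S y x - \<theta> * R y x\<bar>" by (rule iexp_diff_le)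
    also have "\<dots> = \<bar>\<theta>\<bar> * \<bar>S y x - R y x\<bar>" by (simp add: abs_mult right_diff_distrib[symmetric])
    also have "\<dots> \<le> 1 * \<bar>S y x - R y x\<bar>" using \<theta> by (intro mult_right_mono) auto
    also have "\<dots> \<le> (\<Sum>k=m..n. \<bar>hit k y ((T ^^ k) x) - soft_ball 0 \<delta> k y ((T ^^ k) x)\<bar>)"
      unfolding S_def R_def sum_subtractf[symmetric] by (simp add: sum_abs)
    also have "\<dots> \<le> (\<Sum>k=m..n. G k y x)"
    proof (rule sum_mono)
      fix k
      show "\<bar>hit k y ((T ^^ k) x) - soft_ball 0 \<delta> k y ((T ^^ k) x)\<bar> \<le> G k y x"
        using soft_ball_sandwich[OF \<delta>, where k = k and y = y and z = "(T ^^ k) x"] unfolding G_def by linarith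
    qed
    finally show ?thesis .
  qed
  have int_iexp: "integrable \<mu> (\<lambda>x. iexp (\<theta> * f x))" if [measurable]: "f \<in> borel_measurable \<mu>" for f
    by (rule integrable_bounded[of _ 1]) auto
  have a: "cmod ((LINT x|\<mu>. iexp (\<theta> * S x x)) - (LINT x|\<mu>. iexp (\<theta> * R x x)))
      \<le> real n * (annulus_bound \<delta> + 2 * ?err)"
  proof -
    have "cmod ((LINT x|\<mu>. iexp (\<theta> * S x x)) - (LINT x|\<mu>. iexp (\<theta> * R x x)))
        = cmod (LINT x|\<mu>. iexp (\<theta> * S x x) - iexp (\<theta> * R x x))"
      using int_iexp[of "\<lambda>x. S x x"] int_iexp[of "\<lambda>x. R x x"] by simp
    also have "\<dots> \<le> (LINT x|\<mu>. cmod (iexp (\<theta> * S x x) - iexp (\<theta> * R x x)))" by (rule integral_norm_bound)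
    also have "\<dots> \<le> (LINT x|\<mu>. (\<Sum>k=m..n. G k x x))"
    proof (rule integral_mono)
      show "integrable \<mu> (\<lambda>x. cmod (iexp (\<theta> * S x x) - iexp (\<theta> * R x x)))"
        using int_iexp[of "\<lambda>x. S x x"] int_iexp[of "\<lambda>x. R x x"] by auto
      show "integrable \<mu> (\<lambda>x. \<Sum>k=m..n. G k x x)"
        using G_diag G01 by (intro Bochner_Integration.integrable_sum integrable_bounded[of _ 1]) auto
    qed (rule iexpS)
    also have "\<dots> = (\<Sum>k=m..n. LINT x|\<mu>. G k x x)"
      using G_diag G01 by (intro Bochner_Integration.integral_sum integrable_bounded[of _ 1]) auto
    also have "\<dots> \<le> (\<Sum>k=m..n. annulus_bound \<delta> + 2 * ?err)"
    proof (rule sum_mono)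
      fix k assume k: "k \<in> {m..n}"
      have "AE y in \<mu>. \<rho> k y \<le> \<rho>\<^sub>0" using small k by auto
      then show "(LINT x|\<mu>. G k x x) \<le> annulus_bound \<delta> + 2 * ?err"
        unfolding G_def by (intro soft_ball_gap_diagonal[OF F net \<eta> mn(1)]) (use k big \<delta> in auto)
    qed
    also have "\<dots> \<le> real n * (annulus_bound \<delta> + 2 * ?err)"
      using mn err0 annulus_bound_nonneg by (simp add: mult_right_mono)
    finally show ?thesis .
  qed
  have b: "cmod ((LINT x|\<mu>. iexp (\<theta> * R x x)) - (LINT y|\<mu>. LINT x|\<mu>. iexp (\<theta> * R y x))) \<le> ?err"
  proof -
    have lip: "(2 / \<delta>)-lipschitz_on UNIV (\<lambda>y. iexp (\<theta> * f y))" if f: "(2 / \<delta>)-lipschitz_on UNIV f" for f :: "'a \<Rightarrow> real"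
    proof (rule lipschitz_onI)
      fix y y'
      have "dist (iexp (\<theta> * f y)) (iexp (\<theta> * f y')) \<le> \<bar>\<theta> * f y - \<theta> * f y'\<bar>"
        unfolding dist_norm by (rule iexp_diff_le)
      also have "\<dots> = \<bar>\<theta>\<bar> * \<bar>f y - f y'\<bar>" by (simp add: abs_mult right_diff_distrib[symmetric])
      also have "\<dots> \<le> 1 * (2 / \<delta> * dist y y')"
        using lipschitz_onD[OF f, of y y'] \<theta> by (intro mult_mono) (auto simp: dist_real_def)
      finally show "dist (iexp (\<theta> * f y)) (iexp (\<theta> * f y')) \<le> 2 / \<delta> * dist y y'" by simp
    qed (use \<delta> in simp)
    show ?thesis
      unfolding R_def iexp_sum_prod[OF finite_atLeastAtMost]
    proof (rule decoupling_uniform[OF F net \<eta> mn(1) order_refl mn(2) order_refl])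
      fix k y assume k: "k \<in> {m..n}"
      show "(2 / \<delta>)-lipschitz_on UNIV (\<lambda>x. iexp (\<theta> * soft_ball 0 \<delta> k x y))"
        by (rule lip[OF soft_ball_lipschitz(2)[OF \<delta> k1[OF k]]])
      show "(2 / \<delta>)-lipschitz_on UNIV (\<lambda>x. iexp (\<theta> * soft_ball 0 \<delta> k y x))"
        by (rule lip[OF soft_ball_lipschitz(1)[OF \<delta> k1[OF k]]])
    qed simp
  qed
  have c: "cmod ((LINT y|\<mu>. LINT x|\<mu>. iexp (\<theta> * R y x)) - (LINT y|\<mu>. LINT x|\<mu>. iexp (\<theta> * S y x)))
      \<le> real n * annulus_bound \<delta>"
  proof -
    have mR: "(\<lambda>y. LINT x|\<mu>. iexp (\<theta> * R y x)) \<in> borel_measurable \<mu>"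
      by (rule integral_pair_measurable) measurable
    have mS: "(\<lambda>y. LINT x|\<mu>. iexp (\<theta> * S y x)) \<in> borel_measurable \<mu>"
      by (rule integral_pair_measurable) measurable
    have "(LINT y|\<mu>. LINT x|\<mu>. iexp (\<theta> * R y x)) - (LINT y|\<mu>. LINT x|\<mu>. iexp (\<theta> * S y x))
        = (LINT y|\<mu>. (LINT x|\<mu>. iexp (\<theta> * R y x)) - (LINT x|\<mu>. iexp (\<theta> * S y x)))"
      by (intro Bochner_Integration.integral_diff[symmetric] integrable_bounded[of _ 1] mR mS norm_integral_le) auto
    also have "cmod \<dots> \<le> real n * annulus_bound \<delta>"
    proof (rule norm_integral_le_AE)
      show "AE y in \<mu>. cmod ((LINT x|\<mu>. iexp (\<theta> * R y x)) - (LINT x|\<mu>. iexp (\<theta> * S y x))) \<le> real n * annulus_bound \<delta>"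
        using small
      proof eventually_elim
        case (elim y)
        have "cmod ((LINT x|\<mu>. iexp (\<theta> * R y x)) - (LINT x|\<mu>. iexp (\<theta> * S y x)))
            = cmod (LINT x|\<mu>. iexp (\<theta> * S y x) - iexp (\<theta> * R y x))"
          using int_iexp[of "\<lambda>x. S y x"] int_iexp[of "\<lambda>x. R y x"] by (simp add: norm_minus_commute)
        also have "\<dots> \<le> (LINT x|\<mu>. cmod (iexp (\<theta> * S y x) - iexp (\<theta> * R y x)))" by (rule integral_norm_bound)
        also have "\<dots> \<le> (LINT x|\<mu>. (\<Sum>k=m..n. G k y x))"
        proof (rule integral_mono)
          show "integrable \<mu> (\<lambda>x. cmod (iexp (\<theta> * S y x) - iexp (\<theta> * R y x)))"
            using int_iexp[of "\<lambda>x. S y x"] int_iexp[of "\<lambda>x. R y x"] by auto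
          show "integrable \<mu> (\<lambda>x. \<Sum>k=m..n. G k y x)"
            using G_row G01 by (intro Bochner_Integration.integrable_sum integrable_bounded[of _ 1]) auto
        qed (rule iexpS)
        also have "\<dots> = (\<Sum>k=m..n. LINT x|\<mu>. G k y x)"
          using G_row G01 by (intro Bochner_Integration.integral_sum integrable_bounded[of _ 1]) auto
        also have "\<dots> \<le> (\<Sum>k=m..n. annulus_bound \<delta>)"
        proof (rule sum_mono)
          fix k assume k: "k \<in> {m..n}"
          have "(\<lambda>z. soft_ball 1 \<delta> k y z - soft_ball 0 \<delta> k y z) \<in> borel_measurable \<mu>"
            by (intro borel_measurable_diff soft_ball_measurable) (use k1[OF k] in auto)
          from integral_iterate[OF this, of k]
          have "(LINT x|\<mu>. G k y x) = (LINT z|\<mu>. soft_ball 1 \<delta> k y z - soft_ball 0 \<delta> k y z)"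
            unfolding G_def .
          also have "\<dots> \<le> annulus_bound \<delta>" by (rule soft_ball_gap) (use \<delta> k k1 elim big in auto)
          finally show "(LINT x|\<mu>. G k y x) \<le> annulus_bound \<delta>" .
        qed
        also have "\<dots> \<le> real n * annulus_bound \<delta>"
          using mn annulus_bound_nonneg by (simp add: mult_right_mono)
        finally show ?case .
      qed
    qed (intro borel_measurable_diff mR mS)
    finally show ?thesis .
  qed
  have "cmod ((LINT x|\<mu>. iexp (\<theta> * S x x)) - (LINT y|\<mu>. LINT x|\<mu>. iexp (\<theta> * S y x)))
      \<le> real n * (annulus_bound \<delta> + 2 * ?err) + ?err + real n * annulus_bound \<delta>"
    using norm_diff_triangle_le[OF norm_diff_triangle_le[OF a b] c] .
  also have "\<dots> = 2 * real n * annulus_bound \<delta> + (2 * real n + 1) * ?err" by (simp add: algebra_simps)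
  finally show ?thesis unfolding S_def .
qed

end

section \<open>The central limit theorem\<close>

text \<open>The distribution function of a point mass is continuous on both sides of the atom.\<close>
lemma (in prob_space) tendsto_in_prob_of_weak_conv_return:
  assumes [measurable]: "\<And>n. R n \<in> borel_measurable M"
    and conv: "weak_conv_m (\<lambda>n. distr M borel (R n)) (return borel c)" and \<epsilon>: "\<epsilon> > 0"
  shows "(\<lambda>n. prob {x\<in>space M. \<bar>R n x - c\<bar> \<ge> \<epsilon>}) \<longlonglongrightarrow> 0"
proof -
  have cdf_ret: "cdf (return borel c) = (\<lambda>x. if c \<le> x then 1 else 0)"
    by (auto simp: cdf_def measure_return fun_eq_iff)
  have cdf_distr: "cdf (distr M borel (R n)) a = prob {x\<in>space M. R n x \<le> a}" for n a
    by (auto simp: cdf_def measure_distr vimage_def intro!: arg_cong[where f = prob])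
  have lim: "(\<lambda>n. prob {x\<in>space M. R n x \<le> a}) \<longlonglongrightarrow> (if c \<le> a then 1 else 0)" if "a \<noteq> c" for a
  proof -
    have "eventually (\<lambda>x. (if c \<le> x then 1 else 0) = (if c \<le> a then 1 else (0::real))) (nhds a)"
    proof (cases "c < a")
      case True
      show ?thesis using eventually_nhds_in_open[of "{c<..}" a] True by (auto elim!: eventually_mono)
    next
      case False
      then show ?thesis using eventually_nhds_in_open[of "{..<c}" a] that by (auto elim!: eventually_mono)
    qed
    then have "isCont (\<lambda>x. if c \<le> x then 1 else (0::real)) a"
      by (subst isCont_cong) auto
    then show ?thesis
      using conv unfolding weak_conv_m_def weak_conv_def cdf_distr cdf_ret by blast
  qed
  have l1: "(\<lambda>n. prob {x\<in>space M. R n x \<le> c - \<epsilon>}) \<longlonglongrightarrow> 0" using lim[of "c - \<epsilon>"] \<epsilon> by simp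
  have l2: "(\<lambda>n. prob {x\<in>space M. R n x \<le> c + \<epsilon> / 2}) \<longlonglongrightarrow> 1" using lim[of "c + \<epsilon> / 2"] \<epsilon> by simp
  have "(\<lambda>n. prob {x\<in>space M. R n x \<le> c - \<epsilon>} + (1 - prob {x\<in>space M. R n x \<le> c + \<epsilon> / 2})) \<longlonglongrightarrow> 0 + (1 - 1)"
    by (intro tendsto_intros l1 l2)
  then have l3: "(\<lambda>n. prob {x\<in>space M. R n x \<le> c - \<epsilon>} + (1 - prob {x\<in>space M. R n x \<le> c + \<epsilon> / 2})) \<longlonglongrightarrow> 0" by simp
  show ?thesis
  proof (rule tendsto_sandwich[OF _ _ tendsto_const l3])
    show "eventually (\<lambda>n. prob {x\<in>space M. \<bar>R n x - c\<bar> \<ge> \<epsilon>}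
        \<le> prob {x\<in>space M. R n x \<le> c - \<epsilon>} + (1 - prob {x\<in>space M. R n x \<le> c + \<epsilon> / 2})) sequentially"
    proof (intro always_eventually allI)
      fix n
      have "prob {x\<in>space M. \<bar>R n x - c\<bar> \<ge> \<epsilon>}
          \<le> prob ({x\<in>space M. R n x \<le> c - \<epsilon>} \<union> (space M - {x\<in>space M. R n x \<le> c + \<epsilon> / 2}))"
        by (intro finite_measure_mono) (use \<epsilon> in auto)
      also have "\<dots> \<le> prob {x\<in>space M. R n x \<le> c - \<epsilon>} + prob (space M - {x\<in>space M. R n x \<le> c + \<epsilon> / 2})"
        by (intro measure_subadditive) (auto simp: emeasure_eq_measure)
      also have "prob (space M - {x\<in>space M. R n x \<le> c + \<epsilon> / 2}) = 1 - prob {x\<in>space M. R n x \<le> c + \<epsilon> / 2}"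
        by (rule prob_compl) auto
      finally show "prob {x\<in>space M. \<bar>R n x - c\<bar> \<ge> \<epsilon>}
        \<le> prob {x\<in>space M. R n x \<le> c - \<epsilon>} + (1 - prob {x\<in>space M. R n x \<le> c + \<epsilon> / 2})" .
    qed
  qed auto
qed

context shrinking_targets
begin

text \<open>
  The error of \<open>characteristic_decoupling\<close> along \<open>\<delta> = n\<^sup>-\<^sup>q\<close> and \<open>\<eta> = n\<^sup>-\<^sup>(\<^sup>q\<^sup>+\<^sup>3\<^sup>)\<close>: the
  terms without the exponential are negative powers of \<open>n\<close>, all others are polynomial times
  \<open>e\<^sup>-\<^sup>\<tau>\<^sup>m\<close> with \<open>m\<close> a power of \<open>n\<close>.
\<close>
lemma characteristic_decoupling_tendsto:
  assumes \<theta>: "eventually (\<lambda>n. \<bar>\<theta> n\<bar> \<le> 1) sequentially"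
  shows "(\<lambda>n. (LINT x|\<mu>. iexp (\<theta> n * (\<Sum>k=burn_in n..n. hit k x ((T ^^ k) x))))
             - (LINT y|\<mu>. LINT x|\<mu>. iexp (\<theta> n * (\<Sum>k=burn_in n..n. hit k y ((T ^^ k) x))))) \<longlonglongrightarrow> 0"
proof -
  obtain k\<^sub>0 where k0: "k\<^sub>0 \<ge> 1" "AE y in \<mu>. small_radii k\<^sub>0 y" using AE_small_radii by blast
  define \<beta> where "\<beta> = (1 - \<gamma>) / 4"
  have \<beta>: "\<beta> > 0" using exponents by (simp add: \<beta>_def)
  define Q where "Q = (q + 3) * q\<^sub>N"
  have Q: "Q \<ge> 0" using q(3) nets(3) by (simp add: Q_def)
  define B where "B n = 2 * real n * (C\<^sub>A * (2 powr \<alpha>\<^sub>0 * real n powr (- (q * \<alpha>\<^sub>0))))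
     + (2 * real n + 1) * (4 * real n powr (- (q + 3)) * (real n * (2 * real n powr q))
     + (C\<^sub>N * real n powr Q) * ((1 + (1 + C\<^sub>N * real n powr Q) * real n powr (q + 3) + real n * (2 * real n powr q))
          * (D * (1 + real n) powr d) * exp (- \<tau> * real n powr \<beta>)))" for n :: nat
  have B_lim: "B \<longlonglongrightarrow> 0"
    unfolding B_def using q Q d_nonneg \<tau>_pos \<beta> nets(2) by real_asymp
  show ?thesis
  proof (rule Lim_null_comparison[OF _ B_lim])
    show "eventually (\<lambda>n. cmod ((LINT x|\<mu>. iexp (\<theta> n * (\<Sum>k=burn_in n..n. hit k x ((T ^^ k) x))))
             - (LINT y|\<mu>. LINT x|\<mu>. iexp (\<theta> n * (\<Sum>k=burn_in n..n. hit k y ((T ^^ k) x))))) \<le> B n) sequentially"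
      using \<theta> eventually_burn_in[of k\<^sub>0] eventually_width_le_radius eventually_ge_at_top[of 1]
    proof eventually_elim
      case (elim n)
      define m where "m = burn_in n"
      have m: "1 \<le> m" "k\<^sub>0 \<le> m" "m \<le> n" using elim k0 by (auto simp: m_def)
      \<comment> \<open>The freezing error is of order \<open>\<eta> n\<^sup>2\<close> times the Lipschitz constant \<open>n powr q\<close>.\<close>
      define \<eta> where "\<eta> = real n powr (- (q + 3))"
      have \<eta>: "0 < \<eta>" "\<eta> \<le> 1"
      proof -
        show "0 < \<eta>" using elim by (simp add: \<eta>_def)
        have "real n powr (- (q + 3)) \<le> real n powr 0" using elim q by (intro powr_mono) auto
        then show "\<eta> \<le> 1" using elim by (simp add: \<eta>_def)
      qed
      obtain F :: "'a set" where F: "finite F" "real (card F) \<le> C\<^sub>N * \<eta> powr (- q\<^sub>N)" "\<And>x. \<exists>y\<in>F. dist x y < \<eta>"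
        using nets(1) \<eta> unfolding polynomial_nets_def by metis
      define J where "J = C\<^sub>N * real n powr Q"
      have J: "real (card F) \<le> J" using F(2) by (simp add: J_def \<eta>_def powr_powr Q_def algebra_simps)
      have w: "width n > 0" "2 / width n = 2 * real n powr q"
        using elim width_pos[of n] by (auto simp: width_def powr_minus_divide)
      have ann: "annulus_bound (width n) = C\<^sub>A * (2 powr \<alpha>\<^sub>0 * real n powr (- (q * \<alpha>\<^sub>0)))"
        by (simp add: annulus_bound_def width_def powr_mult powr_powr)
      have \<eta>_inv: "1 / \<eta> = real n powr (q + 3)"
        using powr_minus_divide[of "real n" "- (q + 3)"] by (simp add: \<eta>_def add.commute)
      have m\<beta>: "real n powr \<beta> \<le> real m" using burn_in_bounds[of n] by (simp add: m_def \<beta>_def)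
      have "decoupling_error m n (2 / width n) \<eta> (real (card F)) \<le> 4 * \<eta> * (real n * (2 / width n))
          + J * ((1 + (1 + J) * (1 / \<eta>) + real n * (2 / width n)) * (D * (1 + real n) powr d) * exp (- \<tau> * real n powr \<beta>))"
        unfolding decoupling_error_def divide_inverse
        using J \<eta> w(1) D_nonneg \<tau>_pos m\<beta>
        by (intro add_mono mult_mono order_refl) (auto intro!: add_nonneg_nonneg mult_nonneg_nonneg)
      then have err: "decoupling_error m n (2 / width n) \<eta> (real (card F)) \<le> 4 * real n powr (- (q + 3)) * (real n * (2 * real n powr q))
         + J * ((1 + (1 + J) * real n powr (q + 3) + real n * (2 * real n powr q))
          * (D * (1 + real n) powr d) * exp (- \<tau> * real n powr \<beta>))"
        unfolding w(2) \<eta>_inv \<eta>_def[symmetric] .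
      have "cmod ((LINT x|\<mu>. iexp (\<theta> n * (\<Sum>k=m..n. hit k x ((T ^^ k) x))))
             - (LINT y|\<mu>. LINT x|\<mu>. iexp (\<theta> n * (\<Sum>k=m..n. hit k y ((T ^^ k) x)))))
          \<le> 2 * real n * annulus_bound (width n) + (2 * real n + 1) * decoupling_error m n (2 / width n) \<eta> (real (card F))"
      proof (rule characteristic_decoupling[OF F(1,3) \<eta>(1) m(1,3) w(1)])
        show "AE y in \<mu>. \<forall>k\<in>{m..n}. \<rho> k y \<le> \<rho>\<^sub>0"
          using k0(2) by eventually_elim (use m in \<open>auto simp: small_radii_def\<close>)
        show "3 * width n \<le> \<rho> k y" if "k \<in> {m..n}" for y k using elim m that by simp
      qed (use elim in auto)
      also have "\<dots> \<le> B n"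
        unfolding B_def ann J_def[symmetric] by (intro add_left_mono mult_left_mono err) simp
      finally show ?case unfolding m_def .
    qed
  qed
qed

text \<open>The centred sum of hits for a centre \<open>y\<close> that is independent of the orbit of \<open>x\<close>.\<close>
definition quenched_sum :: "nat \<Rightarrow> 'a \<Rightarrow> 'a \<Rightarrow> real" where
  "quenched_sum n y x = (\<Sum>k=1..n. hit k y ((T ^^ k) x) - M k)"

lemma quenched_sum_measurable [measurable (raw)]:
  assumes [measurable]: "f \<in> measurable N \<mu>" "g \<in> measurable N \<mu>"
  shows "(\<lambda>x. quenched_sum n (f x) (g x)) \<in> borel_measurable N"
  unfolding quenched_sum_def by (intro borel_measurable_sum borel_measurable_diff hit_measurable) auto

lemma hit_diff_le: "\<bar>hit k y z - c\<bar> \<le> (1::real)" if "0 \<le> c" "c \<le> 1" for c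
  using that by (auto simp: indicator_def)

lemma quenched_sum_bound: "\<bar>quenched_sum n y x\<bar> \<le> real n"
proof -
  have "\<bar>quenched_sum n y x\<bar> \<le> (\<Sum>k=1..n. \<bar>hit k y ((T ^^ k) x) - M k\<bar>)" unfolding quenched_sum_def by (rule sum_abs)
  also have "\<dots> \<le> (\<Sum>k=1..n. 1)"
    using M_pos M_le_1 by (intro sum_mono hit_diff_le) (auto intro: less_imp_le)
  finally show ?thesis by simp
qed

lemma hit_sum_bound: "\<bar>\<Sum>k=1..n. hit k (y k) (z k) :: real\<bar> \<le> real n"
proof -
  have "\<bar>\<Sum>k=1..n. hit k (y k) (z k) :: real\<bar> \<le> (\<Sum>k=1..n. \<bar>hit k (y k) (z k) :: real\<bar>)" by (rule sum_abs)
  also have "\<dots> \<le> (\<Sum>k=1..n. 1)" by (intro sum_mono) auto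
  finally show ?thesis by simp
qed

lemma s_sq_eq_Var_quenched_sum: "s_sq \<mu> T M n y = Var \<mu> (quenched_sum n y)"
proof -
  let ?X = "\<lambda>x. \<Sum>k=1..n. hit k y ((T ^^ k) x) :: real"
  have X_meas: "?X \<in> borel_measurable \<mu>" by (intro borel_measurable_sum hit_measurable) auto
  have X_bd: "\<bar>?X x\<bar> \<le> real n" for x by (rule hit_sum_bound)
  have X_int: "integrable \<mu> ?X" by (rule integrable_bounded[OF X_meas]) (use X_bd in simp)
  have S_eq: "quenched_sum n y = (\<lambda>x. ?X x - (\<Sum>k=1..n. M k))" by (auto simp: quenched_sum_def sum_subtractf)
  have "(LINT x|\<mu>. quenched_sum n y x) = (LINT x|\<mu>. ?X x) - (\<Sum>k=1..n. M k)"
    unfolding S_eq by (subst Bochner_Integration.integral_diff[OF X_int]) (simp_all add: prob_space[simplified])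
  moreover have "quenched_sum n y \<in> borel_measurable \<mu>" by measurable
  ultimately show ?thesis
    unfolding s_sq_def Var_eq[OF X_meas X_bd] by (subst Var_eq[OF _ quenched_sum_bound]) (simp_all add: S_eq)
qed

lemma s_sq_measurable [measurable]: "s_sq \<mu> T M n \<in> borel_measurable \<mu>"
proof -
  have [measurable]: "(\<lambda>y. LINT x|\<mu>. quenched_sum n y x * quenched_sum n y x) \<in> borel_measurable \<mu>"
    "(\<lambda>y. LINT x|\<mu>. quenched_sum n y x) \<in> borel_measurable \<mu>"
    by (rule integral_pair_measurable, measurable)+
  have "s_sq \<mu> T M n = (\<lambda>y. (LINT x|\<mu>. quenched_sum n y x * quenched_sum n y x) - (LINT x|\<mu>. quenched_sum n y x) * (LINT x|\<mu>. quenched_sum n y x))"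
    by (auto simp: s_sq_eq_Var_quenched_sum Var_def Cov_def)
  then show ?thesis by simp
qed

lemma s_sq_nonneg: "s_sq \<mu> T M n y \<ge> 0"
  unfolding s_sq_eq_Var_quenched_sum by (rule Var_nonneg[OF _ quenched_sum_bound]) measurable

lemma sigma_sq_nonneg: "sigma_sq \<mu> T M n \<ge> 0"
proof -
  have eq: "indicator (rec_set \<mu> T M k) x = (hit k x ((T ^^ k) x) :: real)" for k x
    by (auto simp: rec_set_def indicator_def)
  show ?thesis unfolding sigma_sq_def eq
  proof (rule Var_nonneg)
    show "(\<lambda>x. \<Sum>k=1..n. hit k x ((T ^^ k) x)) \<in> borel_measurable \<mu>"
      by (intro borel_measurable_sum hit_measurable) auto
  qed (rule hit_sum_bound)
qed

text \<open>
  The first absolute moment is at most the standard deviation plus the modulus of the mean. The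
  mean need not vanish, as \<open>\<mu>(B(y, r\<^sub>k(y)))\<close> may differ from \<open>M\<^sub>k\<close> for the finitely many \<open>k < k\<^sub>0\<close>.
\<close>
lemma quenched_sum_abs_integral:
  assumes k0: "k\<^sub>0 \<ge> 1" and small: "small_radii k\<^sub>0 y"
  shows "(LINT x|\<mu>. \<bar>quenched_sum n y x\<bar>) \<le> sqrt (s_sq \<mu> T M n y) + real k\<^sub>0"
proof -
  define E where "E = (LINT x|\<mu>. quenched_sum n y x)"
  have [measurable]: "quenched_sum n y \<in> borel_measurable \<mu>" by measurable
  have iS: "integrable \<mu> (quenched_sum n y)" by (rule integrable_bounded) (use quenched_sum_bound in auto)
  have "E = (\<Sum>k=1..n. LINT x|\<mu>. hit k y ((T ^^ k) x) - M k)"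
    unfolding E_def quenched_sum_def
  proof (rule Bochner_Integration.integral_sum)
    fix k assume k: "k \<in> {1..n}"
    show "integrable \<mu> (\<lambda>x. hit k y ((T ^^ k) x) - M k)"
    proof (rule integrable_bounded)
      show "norm (hit k y ((T ^^ k) x) - M k) \<le> 1" for x
        unfolding real_norm_def using k M_pos[of k] M_le_1[of k] by (intro hit_diff_le) auto
    qed (use k in measurable)
  qed
  also have "\<dots> = (\<Sum>k=1..n. measure \<mu> (ball y (\<rho> k y)) - M k)"
  proof (rule sum.cong[OF refl])
    fix k assume k: "k \<in> {1..n}"
    have "integrable \<mu> (\<lambda>x. hit k y ((T ^^ k) x) :: real)"
      by (rule integrable_bounded[of _ 1]) auto
    then have "(LINT x|\<mu>. hit k y ((T ^^ k) x) - M k) = (LINT x|\<mu>. hit k y ((T ^^ k) x)) - M k"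
      by (simp add: prob_space[simplified])
    also have "(LINT x|\<mu>. hit k y ((T ^^ k) x)) = (LINT x|\<mu>. hit k y x :: real)"
      by (rule integral_iterate) measurable
    finally show "(LINT x|\<mu>. hit k y ((T ^^ k) x) - M k) = measure \<mu> (ball y (\<rho> k y)) - M k" by simp
  qed
  finally have E_eq: "E = (\<Sum>k=1..n. measure \<mu> (ball y (\<rho> k y)) - M k)" .
  have "\<bar>E\<bar> \<le> (\<Sum>k=1..n. \<bar>measure \<mu> (ball y (\<rho> k y)) - M k\<bar>)" unfolding E_eq by (rule sum_abs)
  also have "\<dots> \<le> (\<Sum>k=1..n. if k \<in> {1..<k\<^sub>0} then 1 else 0)"
  proof (rule sum_mono)
    fix k assume k: "k \<in> {1..n}"
    then have "measure \<mu> (ball y (\<rho> k y)) = M k" if "k \<ge> k\<^sub>0"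
      using small that by (intro measure_ball_radius) (auto simp: small_radii_def)
    moreover have "\<bar>measure \<mu> (ball y (\<rho> k y)) - M k\<bar> \<le> 1"
    proof -
      have "0 \<le> measure \<mu> (ball y (\<rho> k y))" "measure \<mu> (ball y (\<rho> k y)) \<le> 1" by auto
      moreover have "0 < M k" "M k \<le> 1" using k M_pos M_le_1 by auto
      ultimately show ?thesis by linarith
    qed
    ultimately show "\<bar>measure \<mu> (ball y (\<rho> k y)) - M k\<bar> \<le> (if k \<in> {1..<k\<^sub>0} then 1 else 0)"
      using k by (auto simp: not_less)
  qed
  also have "\<dots> = real (card ({1..n} \<inter> {1..<k\<^sub>0}))" by (subst sum.inter_restrict[symmetric]) auto
  also have "\<dots> \<le> real k\<^sub>0"
  proof -
    have "card ({1..n} \<inter> {1..<k\<^sub>0}) \<le> card {1..<k\<^sub>0}" by (intro card_mono) auto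
    then show ?thesis by simp
  qed
  finally have E: "\<bar>E\<bar> \<le> real k\<^sub>0" .
  define g where "g x = \<bar>quenched_sum n y x - E\<bar>" for x
  have [measurable]: "g \<in> borel_measurable \<mu>" unfolding g_def by measurable
  have gB: "\<bar>g x\<bar> \<le> real n + \<bar>E\<bar>" for x using quenched_sum_bound[of n y x] unfolding g_def by linarith
  have ig: "integrable \<mu> g" by (rule integrable_bounded) (use gB in auto)
  have "(LINT x|\<mu>. g x) * (LINT x|\<mu>. g x) \<le> (LINT x|\<mu>. g x * g x)"
    using Var_nonneg[of g, OF _ gB] by (simp add: Var_def Cov_def)
  also have "\<dots> = s_sq \<mu> T M n y"
    unfolding s_sq_eq_Var_quenched_sum by (subst Var_eq[OF _ quenched_sum_bound]) (auto simp: g_def E_def power2_eq_square)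
  finally have "(LINT x|\<mu>. g x) \<le> sqrt (s_sq \<mu> T M n y)"
    by (intro real_le_rsqrt) (simp add: power2_eq_square)
  moreover have "(LINT x|\<mu>. \<bar>quenched_sum n y x\<bar>) \<le> (LINT x|\<mu>. g x + real k\<^sub>0)"
  proof (rule integral_mono)
    show "\<bar>quenched_sum n y x\<bar> \<le> g x + real k\<^sub>0" for x using E unfolding g_def by linarith
  qed (use iS ig in auto)
  ultimately show ?thesis using ig by (simp add: prob_space[simplified])
qed

text \<open>
  For large \<open>n\<close> there is a centre \<open>y\<close> with small radii at which the quotient of the variances is below 2. The
  convention \<open>x / 0 = 0\<close> makes the quotient 0 if \<open>\<sigma>\<^sub>n\<close> vanishes, so that this is excluded as well.
\<close>
lemma sigma_sq_growth:
  assumes ratio: "\<And>\<epsilon>. \<epsilon> > 0 \<Longrightarrow> (\<lambda>n. prob {y. \<bar>s_sq \<mu> T M n y / sigma_sq \<mu> T M n - 1\<bar> \<ge> \<epsilon>}) \<longlonglongrightarrow> 0"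
  shows "\<exists>c>0. eventually (\<lambda>n. c * real n powr (1 - \<gamma>) \<le> sigma_sq \<mu> T M n) sequentially"
proof -
  obtain k\<^sub>0 where k0: "k\<^sub>0 \<ge> 1" "AE y in \<mu>. small_radii k\<^sub>0 y" using AE_small_radii by blast
  obtain c where c: "c > 0"
    "eventually (\<lambda>n. \<forall>y. small_radii k\<^sub>0 y \<longrightarrow> c * real n powr (1 - \<gamma>) \<le> s_sq \<mu> T M n y) sequentially"
    using s_sq_growth[OF k0(1)] by blast
  have "eventually (\<lambda>n. prob {y. \<bar>s_sq \<mu> T M n y / sigma_sq \<mu> T M n - 1\<bar> \<ge> 1} < 1) sequentially"
    by (rule order_tendstoD(2)[OF ratio]) auto
  then have "eventually (\<lambda>n. c / 2 * real n powr (1 - \<gamma>) \<le> sigma_sq \<mu> T M n) sequentially"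
    using c(2)
  proof eventually_elim
    case (elim n)
    let ?bad = "{y. \<bar>s_sq \<mu> T M n y / sigma_sq \<mu> T M n - 1\<bar> \<ge> 1}"
    have bad: "?bad \<in> sets \<mu>"
    proof -
      have "{y\<in>space \<mu>. \<bar>s_sq \<mu> T M n y / sigma_sq \<mu> T M n - 1\<bar> \<ge> 1} \<in> sets \<mu>" by measurable
      then show ?thesis by simp
    qed
    have "\<exists>y. small_radii k\<^sub>0 y \<and> y \<notin> ?bad"
    proof (rule ccontr)
      assume "\<not> ?thesis"
      then have "AE y in \<mu>. y \<in> ?bad" using k0(2) by (auto elim!: eventually_mono)
      then have "prob ?bad = 1" using bad by (subst prob_eq_1) auto
      then show False using elim by simp
    qed
    then obtain y where y: "small_radii k\<^sub>0 y" "\<bar>s_sq \<mu> T M n y / sigma_sq \<mu> T M n - 1\<bar> < 1" by auto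
    have pos: "sigma_sq \<mu> T M n > 0"
    proof (rule ccontr)
      assume "\<not> ?thesis"
      then have "sigma_sq \<mu> T M n = 0" using sigma_sq_nonneg[of n] by simp
      then show False using y(2) by simp
    qed
    have "s_sq \<mu> T M n y / sigma_sq \<mu> T M n < 2" using y(2) by linarith
    then have "s_sq \<mu> T M n y < 2 * sigma_sq \<mu> T M n" using pos by (simp add: divide_simps)
    moreover have "c * real n powr (1 - \<gamma>) \<le> s_sq \<mu> T M n y" using elim y by blast
    ultimately show ?case by simp
  qed
  then show ?thesis using c(1) by (intro exI[of _ "c / 2"]) auto
qed

text \<open>
  Normalised by its own standard deviation \<open>s\<^sub>n(y)\<close>, the sum with centre \<open>y\<close> has a characteristic function that
  tends to the Gaussian one for almost every \<open>y\<close>, and dominated convergence integrates this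
  over \<open>y\<close>. Exchanging \<open>s\<^sub>n(y)\<close> for \<open>\<sigma>\<^sub>n\<close> changes the characteristic function by at most
  \<open>\<bar>t\<bar> \<bar>s\<^sub>n(y)/\<sigma>\<^sub>n - 1\<bar>\<close> times a first moment that is bounded by \<open>quenched_sum_abs_integral\<close>,
  and trivially by 2 on the set of small probability where the quotient is not close to 1.
\<close>
lemma quenched_to_annealed:
  assumes clt: "AE y in \<mu>. weak_conv_m (\<lambda>n. distr \<mu> borel (\<lambda>x. quenched_sum n y x / sqrt (s_sq \<mu> T M n y))) std_normal_distribution"
    and ratio: "\<And>\<epsilon>. \<epsilon> > 0 \<Longrightarrow> (\<lambda>n. prob {y. \<bar>s_sq \<mu> T M n y / sigma_sq \<mu> T M n - 1\<bar> \<ge> \<epsilon>}) \<longlonglongrightarrow> 0"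
  shows "(\<lambda>n. LINT y|\<mu>. LINT x|\<mu>. iexp (t / sqrt (sigma_sq \<mu> T M n) * quenched_sum n y x)) \<longlonglongrightarrow> exp (- (t\<^sup>2) / 2)"
proof -
  obtain k\<^sub>0 where k0: "k\<^sub>0 \<ge> 1" "AE y in \<mu>. small_radii k\<^sub>0 y" using AE_small_radii by blast
  obtain c where c: "c > 0"
    "eventually (\<lambda>n. \<forall>y. small_radii k\<^sub>0 y \<longrightarrow> c * real n powr (1 - \<gamma>) \<le> s_sq \<mu> T M n y) sequentially"
    using s_sq_growth[OF k0(1)] by blast
  define \<sigma> where "\<sigma> n = sqrt (sigma_sq \<mu> T M n)" for n
  define s where "s n y = sqrt (s_sq \<mu> T M n y)" for n y
  define \<Phi> where "\<Phi> n y = (LINT x|\<mu>. iexp (t / \<sigma> n * quenched_sum n y x))" for n y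
  define G where "G n y = (LINT x|\<mu>. iexp (t * (quenched_sum n y x / s n y)))" for n y
  have [measurable]: "s n \<in> borel_measurable \<mu>" for n unfolding s_def by measurable
  have [measurable]: "\<Phi> n \<in> borel_measurable \<mu>" "G n \<in> borel_measurable \<mu>" for n
    unfolding \<Phi>_def G_def by (rule integral_pair_measurable, measurable)+
  have b1: "cmod (\<Phi> n y) \<le> 1" "cmod (G n y) \<le> 1" for n y
    unfolding \<Phi>_def G_def by (rule norm_integral_le; simp)+
  have int: "integrable \<mu> (\<Phi> n)" "integrable \<mu> (G n)" for n
    using b1 by (auto intro!: integrable_bounded[of _ 1])
  have G_char: "char (distr \<mu> borel (\<lambda>x. quenched_sum n y x / sqrt (s_sq \<mu> T M n y))) t = G n y" for n y
    unfolding char_def G_def s_def by (subst integral_distr) auto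
  have "AE y in \<mu>. (\<lambda>n. G n y) \<longlonglongrightarrow> exp (- (t\<^sup>2) / 2)"
    using clt
  proof eventually_elim
    case (elim y)
    have "(\<lambda>n. char (distr \<mu> borel (\<lambda>x. quenched_sum n y x / sqrt (s_sq \<mu> T M n y))) t) \<longlonglongrightarrow> char std_normal_distribution t"
      by (rule levy_continuity1[OF _ real_dist_normal_dist elim]) (intro real_distribution_distr, measurable)
    then show ?case unfolding G_char char_std_normal_distribution .
  qed
  then have "(\<lambda>n. LINT y|\<mu>. G n y) \<longlonglongrightarrow> (LINT y|\<mu>. complex_of_real (exp (- (t\<^sup>2) / 2)))"
    by (intro integral_dominated_convergence[where w = "\<lambda>_. 1"]) (use b1 in auto)
  then have G_lim: "(\<lambda>n. LINT y|\<mu>. G n y) \<longlonglongrightarrow> exp (- (t\<^sup>2) / 2)"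
    by (simp add: prob_space[simplified])
  have "(\<lambda>n. (LINT y|\<mu>. \<Phi> n y) - (LINT y|\<mu>. G n y)) \<longlonglongrightarrow> 0"
  proof (rule LIMSEQ_I)
    fix r :: real assume r: "r > 0"
    define K where "K = \<bar>t\<bar> * (1 + real k\<^sub>0)"
    have K: "K \<ge> 0" by (simp add: K_def)
    define \<epsilon> where "\<epsilon> = r / (4 * (K + 1))"
    have \<epsilon>: "\<epsilon> > 0" using r K by (simp add: \<epsilon>_def)
    have K\<epsilon>: "K * \<epsilon> < r / 2" unfolding \<epsilon>_def using r K by (simp add: field_simps add_pos_nonneg)
    define A where "A n = {y. \<bar>s_sq \<mu> T M n y / sigma_sq \<mu> T M n - 1\<bar> \<ge> \<epsilon>}" for n
    have A: "A n \<in> sets \<mu>" for n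
    proof -
      have "{y\<in>space \<mu>. \<bar>s_sq \<mu> T M n y / sigma_sq \<mu> T M n - 1\<bar> \<ge> \<epsilon>} \<in> sets \<mu>" by measurable
      then show ?thesis by (simp add: A_def)
    qed
    have evA: "eventually (\<lambda>n. prob (A n) < r / 4) sequentially"
      unfolding A_def by (rule order_tendstoD(2)[OF ratio[OF \<epsilon>]]) (use r in auto)
    obtain c' where c': "c' > 0" "eventually (\<lambda>n. c' * real n powr (1 - \<gamma>) \<le> sigma_sq \<mu> T M n) sequentially"
      using sigma_sq_growth[OF ratio] by blast
    have "eventually (\<lambda>n. 1 \<le> c * real n powr (1 - \<gamma>)) sequentially" using c(1) exponents by real_asymp
    then have "eventually (\<lambda>n. norm ((LINT y|\<mu>. \<Phi> n y) - (LINT y|\<mu>. G n y) - 0) < r) sequentially"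
      using evA c(2) c'(2) eventually_gt_at_top[of 0]
    proof eventually_elim
      case (elim n)
      have "c' * real n powr (1 - \<gamma>) > 0" using c' elim by simp
      then have \<sigma>_pos: "\<sigma> n > 0" using elim unfolding \<sigma>_def by simp
      have pt: "cmod (\<Phi> n y - G n y) \<le> K * \<epsilon> + 2 * indicator (A n) y" if y: "small_radii k\<^sub>0 y" for y
      proof (cases "y \<in> A n")
        case True
        have "cmod (\<Phi> n y - G n y) \<le> 1 + 1" by (rule norm_triangle_le_diff) (use b1 add_mono in blast)
        then show ?thesis using True mult_nonneg_nonneg[OF K less_imp_le[OF \<epsilon>]] by simp
      next
        case False
        have s1: "s n y \<ge> 1" using elim y unfolding s_def by force
        have quot: "s_sq \<mu> T M n y / sigma_sq \<mu> T M n = (s n y / \<sigma> n)\<^sup>2"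
          using s_sq_nonneg[of n y] sigma_sq_nonneg[of n] by (simp add: s_def \<sigma>_def power_divide)
        define u where "u = s n y / \<sigma> n"
        have u: "u > 0" using s1 \<sigma>_pos by (simp add: u_def)
        have "\<bar>u - 1\<bar> * 1 \<le> \<bar>u - 1\<bar> * (u + 1)" using u by (intro mult_left_mono) auto
        also have "\<dots> = \<bar>(u - 1) * (u + 1)\<bar>" using u by (simp add: abs_mult)
        also have "\<dots> = \<bar>u\<^sup>2 - 1\<bar>" by (simp add: power2_eq_square algebra_simps)
        also have "\<dots> \<le> \<epsilon>" using False by (simp add: A_def quot u_def)
        finally have u1: "\<bar>u - 1\<bar> \<le> \<epsilon>" by simp
        have iS: "integrable \<mu> (quenched_sum n y)" by (rule integrable_bounded[of _ "real n"]) (use quenched_sum_bound in auto)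
        have ii: "integrable \<mu> (\<lambda>x. iexp (t / \<sigma> n * quenched_sum n y x))" "integrable \<mu> (\<lambda>x. iexp (t * (quenched_sum n y x / s n y)))"
          by (rule integrable_bounded[of _ 1]; simp)+
        have "cmod (\<Phi> n y - G n y) = cmod (LINT x|\<mu>. iexp (t / \<sigma> n * quenched_sum n y x) - iexp (t * (quenched_sum n y x / s n y)))"
          unfolding \<Phi>_def G_def using ii by simp
        also have "\<dots> \<le> (LINT x|\<mu>. cmod (iexp (t / \<sigma> n * quenched_sum n y x) - iexp (t * (quenched_sum n y x / s n y))))"
          by (rule integral_norm_bound)
        also have "\<dots> \<le> (LINT x|\<mu>. (\<bar>t\<bar> * \<bar>u - 1\<bar> / s n y) * \<bar>quenched_sum n y x\<bar>)"
        proof (rule integral_mono)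
          show "integrable \<mu> (\<lambda>x. cmod (iexp (t / \<sigma> n * quenched_sum n y x) - iexp (t * (quenched_sum n y x / s n y))))"
            using ii by auto
          show "integrable \<mu> (\<lambda>x. (\<bar>t\<bar> * \<bar>u - 1\<bar> / s n y) * \<bar>quenched_sum n y x\<bar>)" using iS by auto
          fix x
          have "t / \<sigma> n * quenched_sum n y x - t * (quenched_sum n y x / s n y) = t * (u - 1) / s n y * quenched_sum n y x"
            using s1 \<sigma>_pos by (simp add: u_def field_simps)
          then have "\<bar>t / \<sigma> n * quenched_sum n y x - t * (quenched_sum n y x / s n y)\<bar> = \<bar>t\<bar> * \<bar>u - 1\<bar> / s n y * \<bar>quenched_sum n y x\<bar>"
            using s1 by (simp add: abs_mult abs_divide)
          then show "cmod (iexp (t / \<sigma> n * quenched_sum n y x) - iexp (t * (quenched_sum n y x / s n y))) \<le> \<bar>t\<bar> * \<bar>u - 1\<bar> / s n y * \<bar>quenched_sum n y x\<bar>"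
            using iexp_diff_le by metis
        qed
        also have "\<dots> = (\<bar>t\<bar> * \<bar>u - 1\<bar> / s n y) * (LINT x|\<mu>. \<bar>quenched_sum n y x\<bar>)" by simp
        also have "\<dots> \<le> (\<bar>t\<bar> * \<epsilon> / s n y) * (s n y + real k\<^sub>0)"
          using u1 s1 \<epsilon> quenched_sum_abs_integral[OF k0(1) y, of n]
          by (intro mult_mono divide_right_mono mult_left_mono) (auto simp: s_def)
        also have "\<dots> = \<bar>t\<bar> * \<epsilon> * (1 + real k\<^sub>0 / s n y)" using s1 by (simp add: field_simps)
        also have "\<dots> \<le> \<bar>t\<bar> * \<epsilon> * (1 + real k\<^sub>0)"
        proof (intro mult_left_mono add_left_mono)
          have "real k\<^sub>0 / s n y \<le> real k\<^sub>0 / 1" using s1 by (intro divide_left_mono) auto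
          then show "real k\<^sub>0 / s n y \<le> real k\<^sub>0" by simp
        qed (use \<epsilon> in auto)
        finally show ?thesis using False by (simp add: K_def mult_ac)
      qed
      have "cmod ((LINT y|\<mu>. \<Phi> n y) - (LINT y|\<mu>. G n y)) = cmod (LINT y|\<mu>. \<Phi> n y - G n y)"
        using int by simp
      also have "\<dots> \<le> (LINT y|\<mu>. cmod (\<Phi> n y - G n y))" by (rule integral_norm_bound)
      also have "\<dots> \<le> (LINT y|\<mu>. K * \<epsilon> + 2 * indicator (A n) y)"
      proof (rule integral_mono_AE)
        show "integrable \<mu> (\<lambda>y. cmod (\<Phi> n y - G n y))" using int by auto
        show "integrable \<mu> (\<lambda>y. K * \<epsilon> + 2 * indicator (A n) y)"
          using A by (auto simp: emeasure_eq_measure)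
        show "AE y in \<mu>. cmod (\<Phi> n y - G n y) \<le> K * \<epsilon> + 2 * indicator (A n) y"
          using k0(2) by eventually_elim (rule pt)
      qed
      also have "\<dots> = K * \<epsilon> + 2 * prob (A n)"
        using A by (simp add: prob_space[simplified] emeasure_eq_measure)
      also have "\<dots> < r" using K\<epsilon> elim by linarith
      finally show ?case by simp
    qed
    then show "\<exists>no. \<forall>n\<ge>no. norm ((LINT y|\<mu>. \<Phi> n y) - (LINT y|\<mu>. G n y) - 0) < r"
      unfolding eventually_sequentially .
  qed
  from tendsto_add[OF this G_lim] show ?thesis unfolding \<Phi>_def \<sigma>_def by simp
qed

text \<open>
  Chain of four approximations: drop the burn-in on the diagonal, decouple, restore the burn-in for
  independent centres, and pass to the limit. Dropping the burn-in of \<open>m\<close> terms costs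
  \<open>\<bar>t\<bar> m / \<sigma>\<^sub>n\<close>, which tends to 0 since \<open>\<sigma>\<^sub>n\<close> grows at least like \<open>n\<^sup>(\<^sup>1\<^sup>-\<^sup>\<gamma>\<^sup>)\<^sup>/\<^sup>2\<close>. The factor
  \<open>\<kappa>\<close> of modulus 1 accounts for the centring by the \<open>M\<^sub>k\<close>.
\<close>
lemma annealed_clt:
  assumes clt: "AE y in \<mu>. weak_conv_m (\<lambda>n. distr \<mu> borel (\<lambda>x. quenched_sum n y x / sqrt (s_sq \<mu> T M n y))) std_normal_distribution"
    and ratio: "\<And>\<epsilon>. \<epsilon> > 0 \<Longrightarrow> (\<lambda>n. prob {y. \<bar>s_sq \<mu> T M n y / sigma_sq \<mu> T M n - 1\<bar> \<ge> \<epsilon>}) \<longlonglongrightarrow> 0"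
  shows "weak_conv_m (\<lambda>n. distr \<mu> borel (\<lambda>x. (\<Sum>k=1..n. hit k x ((T ^^ k) x) - measure \<mu> (ball x (\<rho> k x)))
            / sqrt (sigma_sq \<mu> T M n))) std_normal_distribution"
proof -
  obtain k\<^sub>0 where k0: "k\<^sub>0 \<ge> 1" "AE y in \<mu>. small_radii k\<^sub>0 y" using AE_small_radii by blast
  obtain c where c: "c > 0" "eventually (\<lambda>n. c * real n powr (1 - \<gamma>) \<le> sigma_sq \<mu> T M n) sequentially"
    using sigma_sq_growth[OF ratio] by blast
  define b where "b k x = measure \<mu> (ball x (\<rho> k x))" for k x
  define V where "V n x = (\<Sum>k=1..n. hit k x ((T ^^ k) x) - b k x)" for n x
  have b_meas: "b k \<in> borel_measurable \<mu>" if "k \<ge> 1" for k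
  proof -
    have "(\<lambda>y. LINT x|\<mu>. hit k y x :: real) \<in> borel_measurable \<mu>"
      by (rule integral_pair_measurable) (use that in measurable)
    then show ?thesis unfolding b_def by simp
  qed
  have V_meas [measurable]: "V n \<in> borel_measurable \<mu>" for n
    unfolding V_def by (intro borel_measurable_sum borel_measurable_diff hit_measurable b_meas) auto
  show ?thesis
  proof (rule levy_continuity[OF _ real_dist_normal_dist])
    show "real_distribution (distr \<mu> borel (\<lambda>x. (\<Sum>k=1..n. hit k x ((T ^^ k) x) - measure \<mu> (ball x (\<rho> k x)))
            / sqrt (sigma_sq \<mu> T M n)))" for n
      unfolding b_def[symmetric] V_def[symmetric] by (intro real_distribution_distr) measurable
    fix t :: real
    define \<theta> where "\<theta> n = t / sqrt (sigma_sq \<mu> T M n)" for n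
    define A where "A n = (LINT x|\<mu>. iexp (\<theta> n * V n x))" for n
    define P where "P n = (LINT x|\<mu>. iexp (\<theta> n * (\<Sum>k=burn_in n..n. hit k x ((T ^^ k) x))))" for n
    define R where "R n = (LINT y|\<mu>. LINT x|\<mu>. iexp (\<theta> n * (\<Sum>k=burn_in n..n. hit k y ((T ^^ k) x))))" for n
    define D' where "D' n = (LINT y|\<mu>. LINT x|\<mu>. iexp (\<theta> n * quenched_sum n y x))" for n
    define \<kappa> where "\<kappa> n = iexp (- \<theta> n * (\<Sum>k=burn_in n..n. M k))" for n
    have A_char: "char (distr \<mu> borel (\<lambda>x. (\<Sum>k=1..n. hit k x ((T ^^ k) x) - measure \<mu> (ball x (\<rho> k x)))
            / sqrt (sigma_sq \<mu> T M n))) t = A n" for n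
      unfolding char_def b_def[symmetric] V_def[symmetric] A_def \<theta>_def by (subst integral_distr) auto
    have \<theta>_burn: "(\<lambda>n. \<bar>\<theta> n\<bar> * real (burn_in n)) \<longlonglongrightarrow> 0"
    proof (rule Lim_null_comparison)
      show "(\<lambda>n. \<bar>t\<bar> / sqrt (c * real n powr (1 - \<gamma>)) * (real n powr ((1 - \<gamma>) / 4) + 1)) \<longlonglongrightarrow> 0"
        using c(1) exponents by real_asymp
      show "eventually (\<lambda>n. norm (\<bar>\<theta> n\<bar> * real (burn_in n))
          \<le> \<bar>t\<bar> / sqrt (c * real n powr (1 - \<gamma>)) * (real n powr ((1 - \<gamma>) / 4) + 1)) sequentially"
        using c(2) eventually_gt_at_top[of 0]
      proof eventually_elim
        case (elim n)
        have p: "0 < c * real n powr (1 - \<gamma>)" using c elim by simp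
        then have "\<bar>\<theta> n\<bar> = \<bar>t\<bar> / sqrt (sigma_sq \<mu> T M n)" using elim by (simp add: \<theta>_def abs_divide)
        also have "\<dots> \<le> \<bar>t\<bar> / sqrt (c * real n powr (1 - \<gamma>))"
          using p elim by (intro divide_left_mono) auto
        finally have "\<bar>\<theta> n\<bar> * real (burn_in n)
            \<le> \<bar>t\<bar> / sqrt (c * real n powr (1 - \<gamma>)) * (real n powr ((1 - \<gamma>) / 4) + 1)"
          using burn_in_bounds(2)[of n] by (rule mult_mono) (use p in auto)
        then show ?case by simp
      qed
    qed
    have \<theta>1: "eventually (\<lambda>n. \<bar>\<theta> n\<bar> \<le> 1) sequentially"
      using order_tendstoD(2)[OF \<theta>_burn zero_less_one] eventually_burn_in[of 1]
    proof eventually_elim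
      case (elim n)
      have "\<bar>\<theta> n\<bar> * 1 \<le> \<bar>\<theta> n\<bar> * real (burn_in n)" using elim by (intro mult_left_mono) auto
      then show ?case using elim by simp
    qed
    have burn: "\<bar>\<theta> n * W - \<theta> n * W'\<bar> \<le> \<bar>\<theta> n\<bar> * real (burn_in n)"
      if "W = (\<Sum>k=1..n. w k)" "W' = (\<Sum>k=burn_in n..n. w k)" "\<And>k. k \<in> {1..n} \<Longrightarrow> \<bar>w k\<bar> \<le> 1"
        "1 \<le> burn_in n" "burn_in n \<le> n" for n W W' and w :: "nat \<Rightarrow> real"
    proof -
      have "{1..n} = {1..<burn_in n} \<union> {burn_in n..n}" using that by auto
      then have "W - W' = (\<Sum>k\<in>{1..<burn_in n}. w k)"
        unfolding that(1,2) by (simp add: sum.union_disjoint ivl_disj_int)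
      also have "\<bar>\<dots>\<bar> \<le> (\<Sum>k\<in>{1..<burn_in n}. 1)"
        by (rule order_trans[OF sum_abs sum_mono]) (use that in auto)
      also have "\<dots> \<le> real (burn_in n)" by simp
      finally have "\<bar>\<theta> n\<bar> * \<bar>W - W'\<bar> \<le> \<bar>\<theta> n\<bar> * real (burn_in n)" by (intro mult_left_mono) auto
      then show ?thesis by (simp add: abs_mult[symmetric] right_diff_distrib)
    qed
    have \<kappa>_mult: "\<kappa> n * iexp (\<theta> n * (\<Sum>k=burn_in n..n. w k)) = iexp (\<theta> n * (\<Sum>k=burn_in n..n. w k - M k))"
      for n and w :: "nat \<Rightarrow> real"
      unfolding \<kappa>_def exp_add[symmetric] by (simp add: sum_subtractf algebra_simps)
    have hit_sum_meas: "(\<lambda>x. \<Sum>k=burn_in n..n. hit k (f x) ((T ^^ k) (g x)) :: real) \<in> borel_measurable N"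
      if "1 \<le> burn_in n" and [measurable]: "f \<in> measurable N \<mu>" "g \<in> measurable N \<mu>" for n f g and N :: "'c measure"
      by (intro borel_measurable_sum hit_measurable) (use that(1) in auto)
    have int_iexp: "integrable \<mu> (\<lambda>x. iexp (u * f x))" if [measurable]: "f \<in> borel_measurable \<mu>"
      for f :: "'a \<Rightarrow> real" and u
      by (rule integrable_bounded[of _ 1]) auto
    have e1: "cmod (A n - \<kappa> n * P n) \<le> \<bar>\<theta> n\<bar> * real (burn_in n)" if n: "k\<^sub>0 \<le> burn_in n" "burn_in n \<le> n" for n
    proof -
      have m1: "1 \<le> burn_in n" using n k0 by simp
      have diag [measurable]: "(\<lambda>x. \<Sum>k=burn_in n..n. hit k x ((T ^^ k) x) :: real) \<in> borel_measurable \<mu>"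
        by (rule hit_sum_meas[OF m1]) auto
      have "A n - \<kappa> n * P n = (LINT x|\<mu>. iexp (\<theta> n * V n x) - \<kappa> n * iexp (\<theta> n * (\<Sum>k=burn_in n..n. hit k x ((T ^^ k) x))))"
        unfolding A_def P_def
        by (subst Bochner_Integration.integral_diff[OF int_iexp integrable_mult_right[OF int_iexp]])
          (simp_all only: integral_mult_right_zero V_meas diag)
      also have "cmod \<dots> \<le> \<bar>\<theta> n\<bar> * real (burn_in n)"
      proof (rule norm_integral_le_AE)
        show "AE x in \<mu>. cmod (iexp (\<theta> n * V n x) - \<kappa> n * iexp (\<theta> n * (\<Sum>k=burn_in n..n. hit k x ((T ^^ k) x))))
            \<le> \<bar>\<theta> n\<bar> * real (burn_in n)"
          using k0(2)
        proof eventually_elim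
          case (elim x)
          have "(\<Sum>k=burn_in n..n. hit k x ((T ^^ k) x) - M k) = (\<Sum>k=burn_in n..n. hit k x ((T ^^ k) x) - b k x)"
            using elim n m1 by (intro sum.cong refl) (auto simp: b_def small_radii_def measure_ball_radius)
          then show ?case
            unfolding \<kappa>_mult
            by (simp only:) (rule order_trans[OF iexp_diff_le burn[OF V_def refl]],
                use n m1 in \<open>auto simp: b_def intro!: hit_diff_le\<close>)
        qed
      qed measurable
      finally show ?thesis .
    qed
    have e2: "cmod (\<kappa> n * R n - D' n) \<le> \<bar>\<theta> n\<bar> * real (burn_in n)" if n: "k\<^sub>0 \<le> burn_in n" "burn_in n \<le> n" for n
    proof -
      have m1: "1 \<le> burn_in n" using n k0 by simp
      have row [measurable]: "(\<lambda>x. \<Sum>k=burn_in n..n. hit k y ((T ^^ k) x) :: real) \<in> borel_measurable \<mu>" for y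
        by (rule hit_sum_meas[OF m1]) auto
      have m2 [measurable]: "(\<lambda>y. LINT x|\<mu>. iexp (\<theta> n * (\<Sum>k=burn_in n..n. hit k y ((T ^^ k) x)))) \<in> borel_measurable \<mu>"
      proof (rule integral_pair_measurable)
        have [measurable]: "(\<lambda>p. \<Sum>k=burn_in n..n. hit k (fst p) ((T ^^ k) (snd p)) :: real) \<in> borel_measurable (\<mu> \<Otimes>\<^sub>M \<mu>)"
          by (rule hit_sum_meas[OF m1]) auto
        show "(\<lambda>p. iexp (\<theta> n * (\<Sum>k=burn_in n..n. hit k (fst p) ((T ^^ k) (snd p))))) \<in> borel_measurable (\<mu> \<Otimes>\<^sub>M \<mu>)"
          by measurable
      qed
      have m3 [measurable]: "(\<lambda>y. LINT x|\<mu>. iexp (\<theta> n * quenched_sum n y x)) \<in> borel_measurable \<mu>"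
        by (rule integral_pair_measurable) measurable
      have bd: "cmod (LINT x|\<mu>. iexp (u * f x)) \<le> 1" if [measurable]: "f \<in> borel_measurable \<mu>"
        for f :: "'a \<Rightarrow> real" and u
        by (rule norm_integral_le) auto
      have i1: "integrable \<mu> (\<lambda>y. LINT x|\<mu>. iexp (\<theta> n * (\<Sum>k=burn_in n..n. hit k y ((T ^^ k) x))))"
        by (rule integrable_bounded[OF m2 bd[OF row]])
      have i2: "integrable \<mu> (\<lambda>y. LINT x|\<mu>. iexp (\<theta> n * quenched_sum n y x))"
        by (rule integrable_bounded[OF m3 bd]) measurable
      have "\<kappa> n * R n - D' n = (LINT y|\<mu>. \<kappa> n * (LINT x|\<mu>. iexp (\<theta> n * (\<Sum>k=burn_in n..n. hit k y ((T ^^ k) x))))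
          - (LINT x|\<mu>. iexp (\<theta> n * quenched_sum n y x)))"
        unfolding R_def D'_def
        by (subst Bochner_Integration.integral_diff[OF integrable_mult_right[OF i1] i2])
          (simp only: integral_mult_right_zero)
      also have "cmod \<dots> \<le> \<bar>\<theta> n\<bar> * real (burn_in n)"
      proof (rule norm_integral_le)
        fix y
        have "\<kappa> n * (LINT x|\<mu>. iexp (\<theta> n * (\<Sum>k=burn_in n..n. hit k y ((T ^^ k) x)))) - (LINT x|\<mu>. iexp (\<theta> n * quenched_sum n y x))
            = (LINT x|\<mu>. \<kappa> n * iexp (\<theta> n * (\<Sum>k=burn_in n..n. hit k y ((T ^^ k) x))) - iexp (\<theta> n * quenched_sum n y x))"
          by (subst Bochner_Integration.integral_diff[OF integrable_mult_right[OF int_iexp[OF row]] int_iexp])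
            (simp_all only: integral_mult_right_zero, measurable)
        also have "cmod \<dots> \<le> \<bar>\<theta> n\<bar> * real (burn_in n)"
        proof (rule norm_integral_le)
          fix x
          show "cmod (\<kappa> n * iexp (\<theta> n * (\<Sum>k=burn_in n..n. hit k y ((T ^^ k) x))) - iexp (\<theta> n * quenched_sum n y x))
              \<le> \<bar>\<theta> n\<bar> * real (burn_in n)"
            unfolding \<kappa>_mult norm_minus_commute[of _ "iexp (\<theta> n * quenched_sum n y x)"]
            by (rule order_trans[OF iexp_diff_le burn[OF quenched_sum_def refl]])
              (use n m1 M_le_1 in \<open>auto intro!: hit_diff_le less_imp_le[OF M_pos]\<close>)
        qed measurable
        finally show "cmod (\<kappa> n * (LINT x|\<mu>. iexp (\<theta> n * (\<Sum>k=burn_in n..n. hit k y ((T ^^ k) x))))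
            - (LINT x|\<mu>. iexp (\<theta> n * quenched_sum n y x))) \<le> \<bar>\<theta> n\<bar> * real (burn_in n)" .
      qed measurable
      finally show ?thesis .
    qed
    have l1: "(\<lambda>n. A n - \<kappa> n * P n) \<longlonglongrightarrow> 0"
      by (rule Lim_null_comparison[OF _ \<theta>_burn]) (use eventually_burn_in[of k\<^sub>0] e1 in \<open>auto elim!: eventually_mono\<close>)
    have l3: "(\<lambda>n. \<kappa> n * R n - D' n) \<longlonglongrightarrow> 0"
      by (rule Lim_null_comparison[OF _ \<theta>_burn]) (use eventually_burn_in[of k\<^sub>0] e2 in \<open>auto elim!: eventually_mono\<close>)
    have l2: "(\<lambda>n. \<kappa> n * (P n - R n)) \<longlonglongrightarrow> 0"
    proof (rule Lim_null_comparison)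
      have "(\<lambda>n. P n - R n) \<longlonglongrightarrow> 0" unfolding P_def R_def by (rule characteristic_decoupling_tendsto[OF \<theta>1])
      then show "(\<lambda>n. cmod (P n - R n)) \<longlonglongrightarrow> 0" by (rule tendsto_norm_zero)
      show "eventually (\<lambda>n. cmod (\<kappa> n * (P n - R n)) \<le> cmod (P n - R n)) sequentially"
        by (simp add: norm_mult \<kappa>_def)
    qed
    have "D' \<longlonglongrightarrow> exp (- (t\<^sup>2) / 2)"
      unfolding D'_def \<theta>_def by (rule quenched_to_annealed[OF clt ratio])
    from tendsto_add[OF tendsto_add[OF tendsto_add[OF l1 l2] l3] this]
    have "A \<longlonglongrightarrow> exp (- (t\<^sup>2) / 2)" by (simp add: algebra_simps)
    then show "(\<lambda>n. char (distr \<mu> borel (\<lambda>x. (\<Sum>k=1..n. hit k x ((T ^^ k) x) - measure \<mu> (ball x (\<rho> k x)))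
            / sqrt (sigma_sq \<mu> T M n))) t) \<longlonglongrightarrow> char std_normal_distribution t"
      unfolding A_char char_std_normal_distribution .
  qed
qed

end

theorem theorem3p2:
  fixes A :: "('a::{metric_space, second_countable_topology}, 'e::euclidean_space) chart set"
    and g :: "('a, 'e) metric_tensor"
    and \<mu> :: "'a measure"
    and T :: "'a \<Rightarrow> 'a"
    and M :: "nat \<Rightarrow> real"
    and \<gamma> \<upsilon> :: real
  assumes "compact_riemannian_manifold A g"
    and "measure_preserving_system \<mu> T"
    and "multiple_decorrelation \<mu> T"
    and "\<And>n. n \<ge> 1 \<Longrightarrow> M n \<in> {0..1}"
    and "frostman \<mu>" and "thin_annuli \<mu>"
    and "0 < \<gamma>" and "\<gamma> < 1" and "\<upsilon> > 1" and "condition_S \<gamma> \<upsilon> M"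
    and "AE y in \<mu>. weak_conv_m
           (\<lambda>n. distr \<mu> borel (\<lambda>x. (\<Sum>k=1..n. indicator (ball y (radius \<mu> M k y)) ((T ^^ k) x) - M k)
                                   / sqrt (s_sq \<mu> T M n y)))
           std_normal_distribution"
    and "weak_conv_m (\<lambda>n. distr \<mu> borel (\<lambda>y. s_sq \<mu> T M n y / sigma_sq \<mu> T M n)) (return borel 1)"
  shows "weak_conv_m
           (\<lambda>n. distr \<mu> borel (\<lambda>x. (\<Sum>k=1..n. indicator (ball x (radius \<mu> M k x)) ((T ^^ k) x)
                                              - measure \<mu> (ball x (radius \<mu> M k x)))
                                   / sqrt (sigma_sq \<mu> T M n)))
           std_normal_distribution"
proof -
  obtain C\<^sub>N q\<^sub>N where N: "C\<^sub>N > 0" "q\<^sub>N \<ge> 0" "polynomial_nets TYPE('a) C\<^sub>N q\<^sub>N"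
    using compact_riemannian_polynomial_nets[OF assms(1)] by blast
  obtain D d \<tau> where dec: "decorrelating_system \<mu> T D d \<tau>"
    using decorrelating_systemI[OF assms(2,3)] by blast
  obtain s\<^sub>0 C\<^sub>F where F: "s\<^sub>0 > 0" "C\<^sub>F > 0" "\<And>x r. r > 0 \<Longrightarrow> measure \<mu> (ball x r) \<le> C\<^sub>F * r powr s\<^sub>0"
    using assms(5) unfolding frostman_def by blast
  obtain \<alpha>\<^sub>0 \<rho>\<^sub>0 C\<^sub>A where ann: "\<alpha>\<^sub>0 > 0" "\<rho>\<^sub>0 > 0" "C\<^sub>A > 0"
      "\<And>x r \<epsilon>. 0 < \<epsilon> \<Longrightarrow> \<epsilon> \<le> r \<Longrightarrow> r \<le> \<rho>\<^sub>0 \<Longrightarrow>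
         measure \<mu> (ball x (r + \<epsilon>) - ball x r) \<le> C\<^sub>A * \<epsilon> powr \<alpha>\<^sub>0"
    using assms(6) unfolding thin_annuli_def by blast
  obtain C\<^sub>M where CM: "C\<^sub>M > 0" "\<And>n. n \<ge> 1 \<Longrightarrow> inverse C\<^sub>M * real n powr (- \<gamma>) \<le> M n"
      "\<And>n. n \<ge> 2 \<Longrightarrow> M n \<le> C\<^sub>M * ln (real n) powr (- \<upsilon>)"
    and anti: "antimono_on {1..} M"
    using assms(10) unfolding condition_S_def by blast
  interpret decorrelating_system \<mu> T D d \<tau> by (rule dec)
  interpret shrinking_targets \<mu> T D d \<tau> M \<gamma> \<upsilon> C\<^sub>M s\<^sub>0 C\<^sub>F \<alpha>\<^sub>0 \<rho>\<^sub>0 C\<^sub>A C\<^sub>N q\<^sub>N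
  proof unfold_locales
    show "M k \<le> M j" if "1 \<le> j" "j \<le> k" for j k
      using anti that by (auto simp: monotone_on_def)
  qed (use N F ann CM assms(4,7,8,9) in auto)
  have ratio: "(\<lambda>n. prob {y. \<bar>s_sq \<mu> T M n y / sigma_sq \<mu> T M n - 1\<bar> \<ge> \<epsilon>}) \<longlonglongrightarrow> 0" if "\<epsilon> > 0" for \<epsilon>
    using tendsto_in_prob_of_weak_conv_return[OF _ assms(12) that] by simp
  show ?thesis by (rule annealed_clt[OF assms(11)[folded quenched_sum_def] ratio])
qed

end
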